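(* There is an absolute constant $c>0$ such that the following holds. Let $\xi$ be a sub-Gaussian real random variable with density bounded by $K$, let $n\ge 2$, let $A\in\mathbb{R}^{n\times n}$ with $\|A\|\le 1$, let $\delta\in(0,1)$, and let $M=A+\delta G_n$, where $G_n=G_n(\xi)$. For $K'>0$, let $\mathcal{E}_{K'}$ denote the event that $\|G_n\|\le K'$. Then, for $0<s\le 1$, \[\mathbb{P}[\mathcal{E}_{K'}\cap\{\eta(M)\le s\}]\le c\,\log_2\!\left(\frac{2(1+\delta K')}{s}\right)(1+\delta K')^2\max(K^2,K^3)\,n^5\,\frac{s}{\delta^3}.\]
   Context: $\|\cdot\|$ denotes the $\ell^2\to\ell^2$ operator norm. A random variable $X$ is sub-Gaussian if there are constants $a,b>0$ with $\mathbb{P}[|X|>t]\le be^{-at^2}$ for all $t\ge 0$. The density of $\xi$ (with respect to Lebesgue measure on $\mathbb{R}$) is assumed continuous and bounded by $K$. $G_n(\xi)$ is the random $n\times n$ matrix such that the entries of $n^{1/2}G_n(\xi)$ are independent copies of $\xi$. For an $n\times n$ matrix $M$ with (complex) eigenvalues $\lambda_1,\dots,\lambda_n$ counted with multiplicity, $\eta(M):=\min_{i\ne j}|\lambda_i-\lambda_j|$ is the minimum eigenvalue gap. *)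

theory Defs
  imports "HOL-Probability.Probability" "Jordan_Normal_Form.Char_Poly"
begin

text \<open>Vectors and matrices are those of Jordan_Normal_Form, because the dimension \<open>n\<close> is quantified
  inside the statement, after the absolute constant.\<close>

definition l2_norm :: "real vec \<Rightarrow> real" where
  "l2_norm v = L2_set (vec_index v) {..<dim_vec v}"

definition op_norm :: "real mat \<Rightarrow> real" where
  "op_norm A = (SUP v \<in> {v \<in> carrier_vec (dim_col A). l2_norm v \<le> 1}. l2_norm (A *\<^sub>v v))"

definition complex_eigenvalues :: "real mat \<Rightarrow> complex multiset" where
  "complex_eigenvalues M = proots (char_poly (map_mat complex_of_real M))"

text \<open>The condition \<open>{#a, b#} \<subseteq># \<dots>\<close> lets \<open>(a, b)\<close> range over the pairs \<open>(\<lambda>\<^sub>i, \<lambda>\<^sub>j)\<close> with distinct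
  indices \<open>i \<noteq> j\<close>; in particular \<open>a = b\<close> is allowed exactly for a repeated eigenvalue, and then the
  gap is 0. The set is nonempty once \<open>M\<close> is at least 2 by 2.\<close>
definition eigenvalue_gap :: "real mat \<Rightarrow> real" where
  "eigenvalue_gap M = Min {cmod (a - b) | a b. {#a, b#} \<subseteq># complex_eigenvalues M}"

text \<open>A real random variable \<open>\<xi>\<close> enters only through its law, a probability measure on the real line.
  Working with laws also keeps the constant in the theorem independent of the sample space (and
  of its type).\<close>

definition sub_gaussian :: "real measure \<Rightarrow> bool" where
  "sub_gaussian \<xi> \<longleftrightarrow>
     (\<exists>a>0. \<exists>b>0. \<forall>t\<ge>0. measure \<xi> {x \<in> space \<xi>. \<bar>x\<bar> > t} \<le> b * exp (- a * t\<^sup>2))"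

definition has_continuous_density_bounded_by :: "real measure \<Rightarrow> real \<Rightarrow> bool" where
  "has_continuous_density_bounded_by \<xi> K \<longleftrightarrow>
     (\<exists>f :: real \<Rightarrow> real. continuous_on UNIV f \<and> (\<forall>x. 0 \<le> f x \<and> f x \<le> K) \<and>
        \<xi> = density lborel (\<lambda>x. ennreal (f x)))"

text \<open>The joint law of an \<open>n \<times> n\<close> array of independent copies of \<open>\<xi>\<close>; the random matrix \<open>G\<^sub>n(\<xi>)\<close> is the
  function \<open>G_mat n\<close> on this probability space, so that the entries of \<open>\<surd>n G\<^sub>n(\<xi>)\<close> are the
  coordinates.\<close>

definition iid_array :: "nat \<Rightarrow> real measure \<Rightarrow> (nat \<times> nat \<Rightarrow> real) measure" where
  "iid_array n \<xi> = PiM ({..<n} \<times> {..<n}) (\<lambda>_. \<xi>)"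

definition G_mat :: "nat \<Rightarrow> (nat \<times> nat \<Rightarrow> real) \<Rightarrow> real mat" where
  "G_mat n \<omega> = mat n n (\<lambda>(i, j). \<omega> (i, j) / sqrt (real n))"

end

theory Submission
  imports Defs "Jordan_Normal_Form.Schur_Decomposition"
begin

text \<open>
  If the gap of \<open>M = A + \<delta> G\<close> is at most \<open>s\<close>, two eigenvalues \<open>a\<close>, \<open>a'\<close> of \<open>M\<close> lie within \<open>s\<close> of each other, and
  \<open>(a - z) (a' - z)\<close> is at most of order \<open>s\<^sup>2\<close> for every shift \<open>z\<close> close to \<open>a\<close>. The inverse \<open>H\<close> of \<open>M - z\<close> then has two by
  two minors of order at least \<open>s\<^bsup>-2\<^esup>\<close>, up to powers of \<open>n\<close> (lemma \<open>sum_wedge_sq_inverse_ge\<close>). The proof bounds the probability \<open>p(z)\<close> of such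
  minors for a fixed shift and averages over \<open>z\<close>. If \<open>a\<close> is within \<open>2 s\<close> of the real line, the good shifts contain
  a real interval of length \<open>s\<close>; otherwise they contain a square of side \<open>s\<close> at height at least \<open>s\<close>. So the
  probability of a small gap is at most \<open>s\<^bsup>-1\<^esup> \<integral> p(x) dx + s\<^bsup>-2\<^esup> \<integral> p(z) dz\<close> over shifts of modulus \<open>O(R)\<close>, with
  \<open>R = 1 + \<delta> K'\<close> (lemma \<open>prob_gap_event_le\<close>).

  For real shifts \<open>p(x)\<close> must be of order \<open>s\<^sup>2\<close>. When all entries of the matrix outside a two by two block \<open>X\<close>
  are fixed, the complementary block of \<open>H\<close> is the inverse of \<open>X - B\<close> for a fixed matrix \<open>B\<close>
  (lemma \<open>minor_inverse_change_block\<close>). A minor of modulus at least \<open>u\<close> thus means \<open>|det (X - B)| \<le> 1/u\<close>, which has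
  probability \<open>O(K\<^sup>2 / u)\<close> for entries of unit scale (lemma \<open>prob_minor_inverse_ge\<close>). These tails are so heavy that the
  sum of the squared minors behaves like its largest term (lemma \<open>nn_integral_weak_sum_le\<close>), and the loss is
  just the number \<open>n\<^sup>4\<close> of minors.

  For nonreal shifts \<open>p(z)\<close> must be of order \<open>s\<^sup>3\<close>, and the extra factor comes from \<open>M\<close> being real: the real
  and imaginary parts of a long column of \<open>H\<close> enclose an angle of order at least \<open>|Im z| / R\<close>
  (lemma \<open>wedge_sq_cnj_ge\<close>). One complex equation for a row of \<open>M\<close> then counts as two independent real ones. For two
  columns of \<open>H\<close> with large wedge product, one row contributes two factors \<open>K\<close> and the other a third
  (lemma \<open>prob_skew_wedge_ge\<close>), at the cost of a factor \<open>R / |Im z|\<close>. Its integral over \<open>s \<le> |Im z| \<le> 2 R\<close> is the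
  logarithm in the bound.
\<close>

section \<open>Squared norms and wedge products of complex vectors\<close>

definition sq_norm :: "nat \<Rightarrow> (nat \<Rightarrow> complex) \<Rightarrow> real" where
  "sq_norm n u = (\<Sum>k<n. (cmod (u k))\<^sup>2)"

text \<open>Twice the squared norm of \<open>u \<and> v\<close>, because each minor occurs for both orders of \<open>k\<close> and \<open>l\<close>.\<close>
definition wedge_sq :: "nat \<Rightarrow> (nat \<Rightarrow> complex) \<Rightarrow> (nat \<Rightarrow> complex) \<Rightarrow> real" where
  "wedge_sq n u v = (\<Sum>k<n. \<Sum>l<n. (cmod (u k * v l - u l * v k))\<^sup>2)"

text \<open>Matrices are functions of two indices, of which only the values below \<open>n\<close> matter; entries can then
  depend on further parameters, such as the shift, without a carrier condition.\<close>
definition mutually_inverse ::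
    "nat \<Rightarrow> (nat \<Rightarrow> nat \<Rightarrow> complex) \<Rightarrow> (nat \<Rightarrow> nat \<Rightarrow> complex) \<Rightarrow> bool" where
  "mutually_inverse n Y H \<longleftrightarrow>
     (\<forall>i<n. \<forall>j<n. (\<Sum>k<n. Y i k * H k j) = of_bool (i = j)) \<and>
     (\<forall>i<n. \<forall>j<n. (\<Sum>k<n. H i k * Y k j) = of_bool (i = j))"

lemma sq_norm_nonneg [simp]: "0 \<le> sq_norm n u"
  by (simp add: sq_norm_def sum_nonneg)

lemma wedge_sq_nonneg [simp]: "0 \<le> wedge_sq n u v"
  by (simp add: wedge_sq_def sum_nonneg)

lemma wedge_sq_self [simp]: "wedge_sq n u u = 0"
  by (simp add: wedge_sq_def)

lemma wedge_sq_commute: "wedge_sq n u v = wedge_sq n v u"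
  unfolding wedge_sq_def by (intro sum.cong refl) (metis norm_minus_commute mult.commute)

lemma sq_norm_scale: "sq_norm n (\<lambda>k. c * u k) = (cmod c)\<^sup>2 * sq_norm n u"
  by (simp add: sq_norm_def norm_mult power_mult_distrib sum_distrib_left)

lemma wedge_sq_scale: "wedge_sq n (\<lambda>k. c * u k) (\<lambda>k. d * v k) = (cmod c)\<^sup>2 * (cmod d)\<^sup>2 * wedge_sq n u v"
proof -
  have "c * a * (d * b) - c * e * (d * f) = c * d * (a * b - e * f)" for a b e f :: complex
    by (simp add: algebra_simps)
  then show ?thesis
    by (simp add: wedge_sq_def norm_mult power_mult_distrib sum_distrib_left)
qed

lemma sq_norm_cong: "(\<And>k. k < n \<Longrightarrow> u k = u' k) \<Longrightarrow> sq_norm n u = sq_norm n u'"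
  by (simp add: sq_norm_def)

lemma wedge_sq_cong:
  "(\<And>k. k < n \<Longrightarrow> u k = u' k) \<Longrightarrow> (\<And>k. k < n \<Longrightarrow> v k = v' k) \<Longrightarrow> wedge_sq n u v = wedge_sq n u' v'"
  by (simp add: wedge_sq_def)

lemma square_norm_diff_le: "(cmod (a - b))\<^sup>2 \<le> 2 * (cmod a)\<^sup>2 + 2 * (cmod b)\<^sup>2"
proof -
  have "(cmod (a - b))\<^sup>2 \<le> (cmod a + cmod b)\<^sup>2"
    by (simp add: power_mono norm_triangle_ineq4)
  also have "\<dots> \<le> 2 * (cmod a)\<^sup>2 + 2 * (cmod b)\<^sup>2"
    using sum_squares_bound[of "cmod a" "cmod b"] by (simp add: power2_sum)
  finally show ?thesis .
qed

text \<open>Lagrange's identity gives the constant 2; the factor 4 comes from estimating each minor separately.\<close>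
lemma wedge_sq_le: "wedge_sq n u v \<le> 4 * sq_norm n u * sq_norm n v"
proof -
  have "wedge_sq n u v \<le> (\<Sum>k<n. \<Sum>l<n. 2 * ((cmod (u k))\<^sup>2 * (cmod (v l))\<^sup>2) + 2 * ((cmod (u l))\<^sup>2 * (cmod (v k))\<^sup>2))"
    unfolding wedge_sq_def
    by (intro sum_mono order.trans[OF square_norm_diff_le]) (simp add: norm_mult power_mult_distrib)
  also have "\<dots> = 2 * (sq_norm n u * sq_norm n v) + 2 * (sq_norm n v * sq_norm n u)"
    unfolding sum.distrib sq_norm_def sum_distrib_left[symmetric] sum_distrib_right[symmetric]
    by (simp only: mult.commute)
  finally show ?thesis by (simp add: mult_ac)
qed

lemma Cauchy_Schwarz_complex_sum:
  fixes f g :: "'a \<Rightarrow> complex"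
  shows "(cmod (\<Sum>a\<in>S. f a * g a))\<^sup>2 \<le> (\<Sum>a\<in>S. (cmod (f a))\<^sup>2) * (\<Sum>a\<in>S. (cmod (g a))\<^sup>2)"
proof -
  have "cmod (\<Sum>a\<in>S. f a * g a) \<le> (\<Sum>a\<in>S. cmod (f a) * cmod (g a))"
    by (rule order.trans[OF norm_sum]) (simp add: norm_mult)
  then have "(cmod (\<Sum>a\<in>S. f a * g a))\<^sup>2 \<le> (\<Sum>a\<in>S. cmod (f a) * cmod (g a))\<^sup>2"
    by (simp add: power_mono)
  also have "\<dots> \<le> (\<Sum>a\<in>S. (cmod (f a))\<^sup>2) * (\<Sum>a\<in>S. (cmod (g a))\<^sup>2)"
    by (rule Cauchy_Schwarz_ineq_sum)
  finally show ?thesis .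
qed

section \<open>Minors and columns of an inverse matrix\<close>

lemma mutually_inverse_expand:
  assumes "mutually_inverse n Y H" "p < n"
  shows "(\<Sum>a<n. H p a * (\<Sum>q<n. Y a q * x q)) = x p"
proof -
  have "(\<Sum>a<n. H p a * (\<Sum>q<n. Y a q * x q)) = (\<Sum>a<n. \<Sum>q<n. H p a * Y a q * x q)"
    by (simp add: sum_distrib_left mult.assoc)
  also have "\<dots> = (\<Sum>q<n. (\<Sum>a<n. H p a * Y a q) * x q)"
    by (subst sum.swap) (simp add: sum_distrib_right)
  also have "\<dots> = (\<Sum>q<n. of_bool (p = q) * x q)"
    using assms by (intro sum.cong) (auto simp: mutually_inverse_def)
  also have "\<dots> = (\<Sum>q<n. if p = q then x q else 0)" by (intro sum.cong) auto
  also have "\<dots> = x p" using assms by simp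
  finally show ?thesis .
qed

text \<open>Two eigenvalues \<open>a\<close>, \<open>b\<close> of \<open>Y\<close> with small product force large minors of its inverse. On the plane
  spanned by the generalized eigenvectors the inverse has determinant \<open>1 / (a b)\<close>, so the second
  compound matrix of \<open>H\<close>, whose entries are the minors, has this eigenvalue, and the Hilbert-Schmidt
  norm dominates the modulus of an eigenvalue. Allowing a Jordan block (\<open>c\<close>) covers the case of a double
  eigenvalue.\<close>
lemma sum_wedge_sq_inverse_ge:
  assumes inv: "mutually_inverse n Y H"
    and u: "\<And>i. i < n \<Longrightarrow> (\<Sum>k<n. Y i k * u k) = a * u i"
    and v: "\<And>i. i < n \<Longrightarrow> (\<Sum>k<n. Y i k * v k) = b * v i + c * u i"
    and indep: "wedge_sq n u v > 0"
  shows "4 \<le> (cmod (a * b))\<^sup>2 * (\<Sum>i<n. \<Sum>j<n. wedge_sq n (\<lambda>k. H k i) (\<lambda>k. H k j))"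
proof -
  note HY = mutually_inverse_expand[OF inv]
  \<comment> \<open>On the plane spanned by \<open>u\<close> and \<open>v\<close> the matrix \<open>H\<close> inverts \<open>Y\<close>.\<close>
  define Hu where "Hu i = (\<Sum>k<n. H i k * u k)" for i
  define Hv where "Hv i = (\<Sum>k<n. H i k * v k)" for i
  have Hu: "a * Hu i = u i" if "i < n" for i
  proof -
    have "a * Hu i = (\<Sum>k<n. H i k * (a * u k))"
      by (simp add: Hu_def sum_distrib_left mult_ac)
    also have "\<dots> = (\<Sum>k<n. H i k * (\<Sum>l<n. Y k l * u l))"
      by (simp add: u)
    finally have "a * Hu i = (\<Sum>k<n. H i k * (\<Sum>l<n. Y k l * u l))" .
    then show ?thesis using HY that by simp
  qed
  have Hv: "b * Hv i + c * Hu i = v i" if "i < n" for i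
  proof -
    have "b * Hv i + c * Hu i = (\<Sum>k<n. H i k * (b * v k + c * u k))"
      unfolding Hu_def Hv_def sum_distrib_left sum.distrib[symmetric]
      by (intro sum.cong refl) (simp add: algebra_simps)
    also have "\<dots> = (\<Sum>k<n. H i k * (\<Sum>l<n. Y k l * v l))"
      by (simp add: v)
    finally have "b * Hv i + c * Hu i = (\<Sum>k<n. H i k * (\<Sum>l<n. Y k l * v l))" .
    then show ?thesis using HY that by simp
  qed
  \<comment> \<open>The tensor \<open>u \<otimes> v - v \<otimes> u\<close> is an eigenvector of \<open>H \<otimes> H\<close> for \<open>1 / (a b)\<close>; being antisymmetric, it only sees
      the minors of \<open>H\<close>, once for each order of the two column indices.\<close>
  define W where "W = (\<lambda>(k, l). u k * v l - u l * v k)"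
  define S where "S = {..<n} \<times> {..<n}"
  have wedge_sq_pairs: "wedge_sq n x y = (\<Sum>(k, l)\<in>S. (cmod (x k * y l - x l * y k))\<^sup>2)" for x y
    by (simp add: wedge_sq_def S_def sum.cartesian_product)
  have wW: "(\<Sum>p\<in>S. (cmod (W p))\<^sup>2) = wedge_sq n u v"
    unfolding wedge_sq_pairs W_def by (intro sum.cong) auto
  have key: "2 * W (i, j) = a * b * (\<Sum>(k, l)\<in>S. (H i k * H j l - H i l * H j k) * W (k, l))"
    if ij: "i < n" "j < n" for i j
  proof -
    have "W (i, j) = a * b * (Hu i * Hv j - Hu j * Hv i)"
    proof -
      have "W (i, j) = a * Hu i * (b * Hv j + c * Hu j) - a * Hu j * (b * Hv i + c * Hu i)"
        unfolding W_def using Hu[of i] Hu[of j] Hv[of i] Hv[of j] ij by simp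
      then show ?thesis by (simp add: algebra_simps)
    qed
    moreover have "2 * (Hu i * Hv j - Hu j * Hv i)
        = (\<Sum>(k, l)\<in>S. (H i k * H j l - H i l * H j k) * W (k, l))"
    proof -
      have 1: "Hu i * Hv j - Hu j * Hv i = (\<Sum>k<n. \<Sum>l<n. H i k * H j l * W (k, l))"
      proof -
        have "Hu i * Hv j = (\<Sum>k<n. \<Sum>l<n. H i k * H j l * (u k * v l))"
          unfolding Hu_def Hv_def sum_product by (intro sum.cong refl) simp
        moreover have "Hv i * Hu j = (\<Sum>k<n. \<Sum>l<n. H i k * H j l * (u l * v k))"
          unfolding Hu_def Hv_def sum_product by (intro sum.cong refl) simp
        ultimately show ?thesis
          by (simp add: W_def algebra_simps sum_subtractf)
      qed
      have 2: "Hu i * Hv j - Hu j * Hv i = - (\<Sum>k<n. \<Sum>l<n. H i l * H j k * W (k, l))"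
        unfolding 1 by (subst sum.swap) (simp add: W_def sum_negf[symmetric] algebra_simps)
      have "2 * (Hu i * Hv j - Hu j * Hv i)
          = (\<Sum>k<n. \<Sum>l<n. H i k * H j l * W (k, l)) - (\<Sum>k<n. \<Sum>l<n. H i l * H j k * W (k, l))"
        using 1 2 by simp
      also have "\<dots> = (\<Sum>k<n. \<Sum>l<n. (H i k * H j l - H i l * H j k) * W (k, l))"
        by (simp add: sum_subtractf algebra_simps)
      finally show ?thesis by (simp add: S_def sum.cartesian_product)
    qed
    ultimately show ?thesis by (simp add: mult.left_commute)
  qed
  let ?m = "\<lambda>i j. \<Sum>(k, l)\<in>S. (cmod (H i k * H j l - H i l * H j k))\<^sup>2"
  have "4 * (cmod (W (i, j)))\<^sup>2 \<le> (cmod (a * b))\<^sup>2 * (?m i j * wedge_sq n u v)"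
    if ij: "i < n" "j < n" for i j
  proof -
    have "4 * (cmod (W (i, j)))\<^sup>2 = (cmod (2 * W (i, j)))\<^sup>2"
      by (simp add: norm_mult power_mult_distrib)
    also have "\<dots> = (cmod (a * b))\<^sup>2 *
        (cmod (\<Sum>(k, l)\<in>S. (H i k * H j l - H i l * H j k) * W (k, l)))\<^sup>2"
      by (simp only: key[OF ij] norm_mult power_mult_distrib)
    also have "\<dots> \<le> (cmod (a * b))\<^sup>2 * (?m i j * wedge_sq n u v)"
    proof (rule mult_left_mono)
      show "(cmod (\<Sum>(k, l)\<in>S. (H i k * H j l - H i l * H j k) * W (k, l)))\<^sup>2
          \<le> ?m i j * wedge_sq n u v"
        using Cauchy_Schwarz_complex_sum[where S=S and g=W
            and f="\<lambda>(k, l). H i k * H j l - H i l * H j k"]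
        by (simp add: wW case_prod_unfold)
    qed simp
    finally show ?thesis .
  qed
  then have "(\<Sum>(i, j)\<in>S. 4 * (cmod (W (i, j)))\<^sup>2)
      \<le> (\<Sum>(i, j)\<in>S. (cmod (a * b))\<^sup>2 * (?m i j * wedge_sq n u v))"
    by (intro sum_mono) (auto simp: S_def)
  then have "4 * wedge_sq n u v \<le> (cmod (a * b))\<^sup>2 * (\<Sum>(i, j)\<in>S. ?m i j) * wedge_sq n u v"
    by (simp only: wW[symmetric] sum_distrib_left[symmetric] sum_distrib_right[symmetric]
        case_prod_unfold mult.assoc prod.collapse)
  then have 3: "4 \<le> (cmod (a * b))\<^sup>2 * (\<Sum>(i, j)\<in>S. ?m i j)"
    using indep by simp
  have "(\<Sum>(i, j)\<in>S. ?m i j) = (\<Sum>(k, l)\<in>S. \<Sum>(i, j)\<in>S. (cmod (H i k * H j l - H i l * H j k))\<^sup>2)"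
    unfolding case_prod_unfold by (rule sum.swap)
  also have "\<dots> = (\<Sum>(k, l)\<in>S. wedge_sq n (\<lambda>i. H i k) (\<lambda>i. H i l))"
    unfolding wedge_sq_pairs case_prod_unfold
    by (intro sum.cong refl arg_cong[where f="\<lambda>x. (cmod x)\<^sup>2"]) (simp add: mult.commute)
  also have "\<dots> = (\<Sum>i<n. \<Sum>j<n. wedge_sq n (\<lambda>k. H k i) (\<lambda>k. H k j))"
    by (simp add: S_def sum.cartesian_product)
  finally show ?thesis using 3 by simp
qed

text \<open>For a real matrix \<open>M\<close> and a shift with imaginary part \<open>y\<close>, a long column \<open>h\<close> of the inverse of \<open>M - z\<close>
  cannot be close to a complex multiple of a real vector. The conjugate of \<open>h\<close> nearly belongs to the
  conjugate shift, so \<open>M - z\<close> moves it by about \<open>2 y\<close>, whereas \<open>h\<close> is nearly annihilated: the two vectors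
  are separated by an angle of order \<open>|y| / B\<close>. The wedge of \<open>h\<close> with its conjugate measures the area
  spanned by its real and imaginary parts.\<close>
lemma wedge_sq_cnj_ge:
  fixes d x0 y B :: real
  assumes j: "j < n" and y: "y \<noteq> 0" and d: "d > 0"
    and bound: "\<And>x. sq_norm n (\<lambda>i. (\<Sum>k<n. complex_of_real (M i k) * x k) - Complex x0 y * x i) \<le> B\<^sup>2 * sq_norm n x"
    and B: "B > 0"
    and h: "\<And>i. i < n \<Longrightarrow> (\<Sum>k<n. complex_of_real (M i k) * h k) - Complex x0 y * h i = d * of_bool (i = j)"
    and large: "2 * d \<le> \<bar>y\<bar> * sqrt (sq_norm n h)"
  shows "(\<bar>y\<bar> / B)\<^sup>2 * (sq_norm n h)\<^sup>2 \<le> wedge_sq n h (\<lambda>k. cnj (h k))"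
proof -
  define z where "z = Complex x0 y"
  define N where "N = sq_norm n h"
  have N: "N > 0"
  proof -
    have "sqrt (sq_norm n h) > 0" using large d y
      by (metis N_def abs_ge_zero mult_nonneg_nonpos less_le_trans linorder_not_less mult_pos_pos zero_less_numeral)
    then show ?thesis by (simp add: N_def)
  qed
  define T where "T x i = (\<Sum>k<n. complex_of_real (M i k) * x k) - z * x i" for x i
  have Tlin: "T (\<lambda>k. a * x k - b * x' k) i = a * T x i - b * T x' i" for a b x x' i
    by (simp add: T_def sum_distrib_left sum_subtractf algebra_simps)
  have Th: "T h i = d * of_bool (i = j)" if "i < n" for i
    using h[OF that] by (simp add: T_def z_def)
  have Tc: "T (\<lambda>k. cnj (h k)) i = d * of_bool (i = j) - 2 * \<i> * y * cnj (h i)" if "i < n" for i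
  proof -
    have "cnj (T h i) = d * of_bool (i = j)" using Th[OF that] by simp
    moreover have "cnj (T h i) = (\<Sum>k<n. complex_of_real (M i k) * cnj (h k)) - cnj z * cnj (h i)"
      by (simp add: T_def)
    moreover have "cnj z = z - 2 * \<i> * y" by (simp add: z_def complex_eq_iff)
    ultimately show ?thesis by (simp add: T_def algebra_simps)
  qed
  \<comment> \<open>\<open>r\<close> is \<open>|h|\<^sup>2\<close> times the component of the conjugate of \<open>h\<close> orthogonal to \<open>h\<close>. As a contraction of
      \<open>h \<and> cnj h\<close> it is short when the wedge is small, but \<open>M - z\<close> sends it close to \<open>- 2 i y |h|\<^sup>2 cnj h\<close>.\<close>
  define \<beta> where "\<beta> = (\<Sum>l<n. cnj (h l) * cnj (h l))"
  define r where "r k = complex_of_real N * cnj (h k) - \<beta> * h k" for k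
  have \<beta>: "cmod \<beta> \<le> N"
    unfolding \<beta>_def N_def sq_norm_def
    by (rule order.trans[OF norm_sum]) (simp add: norm_mult power2_eq_square)
  have r_eq: "r k = (\<Sum>l<n. cnj (h l) * (h l * cnj (h k) - h k * cnj (h l)))" for k
  proof -
    have "complex_of_real N = (\<Sum>l<n. cnj (h l) * h l)"
      unfolding N_def sq_norm_def of_real_sum complex_norm_square by (simp only: mult.commute)
    then have "r k = (\<Sum>l<n. cnj (h l) * h l * cnj (h k)) - (\<Sum>l<n. cnj (h l) * cnj (h l) * h k)"
      by (simp only: r_def \<beta>_def sum_distrib_right)
    also have "\<dots> = (\<Sum>l<n. cnj (h l) * (h l * cnj (h k) - h k * cnj (h l)))"
      unfolding sum_subtractf[symmetric] by (simp add: algebra_simps)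
    finally show ?thesis .
  qed
  have "sq_norm n r \<le> N * wedge_sq n h (\<lambda>k. cnj (h k))"
  proof -
    have "(cmod (r k))\<^sup>2 \<le> N * (\<Sum>l<n. (cmod (h l * cnj (h k) - h k * cnj (h l)))\<^sup>2)" for k
      unfolding r_eq using Cauchy_Schwarz_complex_sum[of "\<lambda>l. cnj (h l)" _ "{..<n}"]
      by (simp add: N_def sq_norm_def)
    then have "sq_norm n r \<le> (\<Sum>k<n. N * (\<Sum>l<n. (cmod (h l * cnj (h k) - h k * cnj (h l)))\<^sup>2))"
      unfolding sq_norm_def by (intro sum_mono)
    also have "\<dots> = N * wedge_sq n h (\<lambda>k. cnj (h k))"
      unfolding wedge_sq_def sum_distrib_left[symmetric]
      by (rule arg_cong[where f="(*) N"]) (rule sum.swap)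
    finally show ?thesis .
  qed
  then have Tr: "sq_norm n (T r) \<le> B\<^sup>2 * (N * wedge_sq n h (\<lambda>k. cnj (h k)))"
    using bound[of r] by (simp add: T_def[abs_def] z_def) (meson mult_left_mono order_trans zero_le_power2)
  have T_r: "T r i = (of_real N - \<beta>) * d * of_bool (i = j) - 2 * \<i> * y * N * cnj (h i)" if "i < n" for i
    unfolding r_def Tlin Th[OF that] Tc[OF that] by (simp add: algebra_simps)
  define q where "q i = 2 * \<i> * y * N * cnj (h i)" for i
  define p where "p i = (of_real N - \<beta>) * d * of_bool (i = j)" for i
  have q: "sq_norm n q = 4 * y\<^sup>2 * N ^ 3"
  proof -
    have "sq_norm n q = (cmod (2 * \<i> * y * N))\<^sup>2 * sq_norm n (\<lambda>i. cnj (h i))"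
      unfolding q_def by (rule sq_norm_scale)
    also have "sq_norm n (\<lambda>i. cnj (h i)) = N" by (simp add: N_def sq_norm_def)
    also have "(cmod (2 * \<i> * y * N))\<^sup>2 = 4 * y\<^sup>2 * N\<^sup>2"
      by (simp add: norm_mult power_mult_distrib)
    finally show ?thesis by (simp add: power3_eq_cube power2_eq_square)
  qed
  have p: "sq_norm n p \<le> 4 * N\<^sup>2 * d\<^sup>2"
  proof -
    have "sq_norm n p = (\<Sum>i<n. if i = j then (cmod (of_real N - \<beta>) * d)\<^sup>2 else 0)"
      unfolding sq_norm_def p_def by (intro sum.cong refl) (simp add: norm_mult d less_imp_le)
    also have "\<dots> = (cmod (of_real N - \<beta>) * d)\<^sup>2" using j by simp
    also have "\<dots> \<le> (2 * N * d)\<^sup>2"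
      using norm_triangle_ineq4[of "of_real N" \<beta>] \<beta> N d by (intro power_mono mult_right_mono) auto
    finally show ?thesis by (simp add: power_mult_distrib)
  qed
  have "sq_norm n q \<le> 2 * sq_norm n (T r) + 2 * sq_norm n p"
  proof -
    have "(cmod (q i))\<^sup>2 \<le> 2 * (cmod (T r i))\<^sup>2 + 2 * (cmod (p i))\<^sup>2" if "i < n" for i
    proof -
      have "q i = p i - T r i" using T_r[OF that] by (simp add: q_def p_def)
      then show ?thesis using square_norm_diff_le[of "p i" "T r i"] by simp
    qed
    then show ?thesis unfolding sq_norm_def sum_distrib_left sum.distrib[symmetric]
      by (intro sum_mono) auto
  qed
  then have 1: "4 * y\<^sup>2 * N ^ 3 \<le> 2 * (B\<^sup>2 * (N * wedge_sq n h (\<lambda>k. cnj (h k)))) + 8 * N\<^sup>2 * d\<^sup>2"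
    using q p Tr by simp
  have "(2 * d)\<^sup>2 \<le> (\<bar>y\<bar> * sqrt N)\<^sup>2"
    using large d by (intro power_mono) (auto simp: N_def)
  then have "4 * d\<^sup>2 \<le> y\<^sup>2 * N" using N by (simp add: power_mult_distrib)
  then have "2 * N\<^sup>2 * (4 * d\<^sup>2) \<le> 2 * N\<^sup>2 * (y\<^sup>2 * N)" by (intro mult_left_mono) auto
  then have "2 * y\<^sup>2 * N ^ 3 \<le> 2 * (B\<^sup>2 * (N * wedge_sq n h (\<lambda>k. cnj (h k))))"
    using 1 by (simp add: power2_eq_square power3_eq_cube algebra_simps)
  then have "N * (y\<^sup>2 * N\<^sup>2) \<le> N * (B\<^sup>2 * wedge_sq n h (\<lambda>k. cnj (h k)))"
    by (simp add: power2_eq_square power3_eq_cube algebra_simps)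
  then have "y\<^sup>2 * N\<^sup>2 \<le> B\<^sup>2 * wedge_sq n h (\<lambda>k. cnj (h k))" using N by simp
  then show ?thesis using B
    by (simp add: N_def power_divide field_simps)
qed

text \<open>The resolvent identity. When only the entries of \<open>Y\<close> in rows \<open>i\<close>, \<open>j\<close> and columns \<open>k\<close>, \<open>l\<close> change, the
  inverse of the complementary block of \<open>H\<close> (rows \<open>k\<close>, \<open>l\<close>, columns \<open>i\<close>, \<open>j\<close>) changes by exactly the same
  two by two matrix. Hence that block is always the inverse of a translate of the block of \<open>Y\<close>, and a
  large minor of \<open>H\<close> is a small determinant of the translated block. This takes the place of Jacobi's
  formula for complementary minors.\<close>
lemma minor_inverse_change_block:
  assumes inv: "mutually_inverse n Y H" and inv': "mutually_inverse n Y' H'"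
    and ij: "i < n" "j < n" "i \<noteq> j" and kl: "k < n" "l < n" "k \<noteq> l"
    and same: "\<And>a b. a < n \<Longrightarrow> b < n \<Longrightarrow> \<not> (a \<in> {i, j} \<and> b \<in> {k, l}) \<Longrightarrow> Y' a b = Y a b"
  defines "m \<equiv> H k i * H l j - H l i * H k j"
  assumes m: "m \<noteq> 0"
  shows "(H' k i * H' l j - H' l i * H' k j) *
      ((Y' i k - Y i k + H l j / m) * (Y' j l - Y j l + H k i / m)
       - (Y' i l - Y i l - H k j / m) * (Y' j k - Y j k - H l i / m)) = 1"
proof -
  let ?d = "\<lambda>a b. Y' a b - Y a b"
  have res: "H p a - H' p a = (H p i * (?d i k * H' k a + ?d i l * H' l a)
      + H p j * (?d j k * H' k a + ?d j l * H' l a))" if pa: "p < n" "a < n" for p a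
  proof -
    have 1: "H' p a = (\<Sum>b<n. H p b * (\<Sum>c<n. Y b c * H' c a))"
      using mutually_inverse_expand[OF inv pa(1), of "\<lambda>c. H' c a"] by simp
    have "(\<Sum>b<n. H p b * (\<Sum>c<n. Y' b c * H' c a)) = (\<Sum>b<n. if b = a then H p b else 0)"
      using inv' pa by (intro sum.cong) (auto simp: mutually_inverse_def)
    then have 2: "H p a = (\<Sum>b<n. H p b * (\<Sum>c<n. Y' b c * H' c a))" using pa by simp
    have "H p a - H' p a = (\<Sum>b<n. H p b * (\<Sum>c<n. ?d b c * H' c a))"
      by (subst 1, subst 2) (simp only: sum_subtractf left_diff_distrib right_diff_distrib)
    also have "\<dots> = (\<Sum>b\<in>{i, j}. H p b * (\<Sum>c<n. ?d b c * H' c a))"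
      using ij same by (intro sum.mono_neutral_right) (auto intro!: sum.neutral)
    also have "\<dots> = (\<Sum>b\<in>{i, j}. H p b * (\<Sum>c\<in>{k, l}. ?d b c * H' c a))"
      using ij kl same
      by (intro sum.cong refl arg_cong2[where f="(*)"] sum.mono_neutral_right) auto
    finally show ?thesis using ij kl by simp
  qed
  \<comment> \<open>With \<open>T\<close>, \<open>T'\<close> the blocks of \<open>H\<close>, \<open>H'\<close>, and \<open>X\<close> the change of the block of \<open>Y\<close>, the four equations say
      \<open>T - T' = T X T'\<close>, and \<open>U = X + T\<^bsup>-1\<^esup>\<close> then satisfies \<open>U T' = 1\<close>.\<close>
  define x1 x2 x3 x4 where "x1 = ?d i k" and "x2 = ?d i l" and "x3 = ?d j k" and "x4 = ?d j l"
  define t1 t2 t3 t4 where "t1 = H k i" and "t2 = H k j" and "t3 = H l i" and "t4 = H l j"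
  define t1' t2' t3' t4' where "t1' = H' k i" and "t2' = H' k j" and "t3' = H' l i" and "t4' = H' l j"
  have mm: "m = t1 * t4 - t3 * t2" by (simp add: m_def t1_def t2_def t3_def t4_def)
  have e1: "t1 - t1' = t1 * (x1 * t1' + x2 * t3') + t2 * (x3 * t1' + x4 * t3')"
    and e2: "t2 - t2' = t1 * (x1 * t2' + x2 * t4') + t2 * (x3 * t2' + x4 * t4')"
    and e3: "t3 - t3' = t3 * (x1 * t1' + x2 * t3') + t4 * (x3 * t1' + x4 * t3')"
    and e4: "t4 - t4' = t3 * (x1 * t2' + x2 * t4') + t4 * (x3 * t2' + x4 * t4')"
    using res[of k i] res[of k j] res[of l i] res[of l j] ij kl
    by (simp_all add: x1_def x2_def x3_def x4_def t1_def t2_def t3_def t4_def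
        t1'_def t2'_def t3'_def t4'_def)
  define u1 u2 u3 u4 where "u1 = x1 + t4 / m" and "u2 = x2 - t2 / m" and "u3 = x3 - t3 / m" and "u4 = x4 + t1 / m"
  have mu: "m * u1 = m * x1 + t4" "m * u2 = m * x2 - t2" "m * u3 = m * x3 - t3" "m * u4 = m * x4 + t1"
    using m by (simp_all add: u1_def u2_def u3_def u4_def algebra_simps)
  have p11: "m * (u1 * t1' + u2 * t3') = m"
  proof -
    have f: "t4 * (t1 - t1') - t2 * (t3 - t3') = m * (x1 * t1' + x2 * t3')"
      unfolding e1 e3 mm by (simp add: algebra_simps)
    have "m * (u1 * t1' + u2 * t3') = (m * u1) * t1' + (m * u2) * t3'" by (simp add: algebra_simps)
    also have "\<dots> = m * (x1 * t1' + x2 * t3') + t4 * t1' - t2 * t3'" unfolding mu by (simp add: algebra_simps)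
    also have "\<dots> = m" unfolding f[symmetric] by (simp add: mm algebra_simps)
    finally show ?thesis .
  qed
  have p12: "m * (u1 * t2' + u2 * t4') = 0"
  proof -
    have f: "t4 * (t2 - t2') - t2 * (t4 - t4') = m * (x1 * t2' + x2 * t4')"
      unfolding e2 e4 mm by (simp add: algebra_simps)
    have "m * (u1 * t2' + u2 * t4') = (m * u1) * t2' + (m * u2) * t4'" by (simp add: algebra_simps)
    also have "\<dots> = m * (x1 * t2' + x2 * t4') + t4 * t2' - t2 * t4'" unfolding mu by (simp add: algebra_simps)
    also have "\<dots> = 0" unfolding f[symmetric] by (simp add: mm algebra_simps)
    finally show ?thesis .
  qed
  have p21: "m * (u3 * t1' + u4 * t3') = 0"
  proof -
    have f: "t1 * (t3 - t3') - t3 * (t1 - t1') = m * (x3 * t1' + x4 * t3')"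
      unfolding e3 e1 mm by (simp add: algebra_simps)
    have "m * (u3 * t1' + u4 * t3') = (m * u3) * t1' + (m * u4) * t3'" by (simp add: algebra_simps)
    also have "\<dots> = m * (x3 * t1' + x4 * t3') - t3 * t1' + t1 * t3'" unfolding mu by (simp add: algebra_simps)
    also have "\<dots> = 0" unfolding f[symmetric] by (simp add: mm algebra_simps)
    finally show ?thesis .
  qed
  have p22: "m * (u3 * t2' + u4 * t4') = m"
  proof -
    have f: "t1 * (t4 - t4') - t3 * (t2 - t2') = m * (x3 * t2' + x4 * t4')"
      unfolding e4 e2 mm by (simp add: algebra_simps)
    have "m * (u3 * t2' + u4 * t4') = (m * u3) * t2' + (m * u4) * t4'" by (simp add: algebra_simps)
    also have "\<dots> = m * (x3 * t2' + x4 * t4') - t3 * t2' + t1 * t4'" unfolding mu by (simp add: algebra_simps)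
    also have "\<dots> = m" unfolding f[symmetric] by (simp add: mm algebra_simps)
    finally show ?thesis .
  qed
  have id: "u1 * t1' + u2 * t3' = 1" "u1 * t2' + u2 * t4' = 0" "u3 * t1' + u4 * t3' = 0" "u3 * t2' + u4 * t4' = 1"
    using p11 p12 p21 p22 m by simp_all
  have "(t1' * t4' - t3' * t2') * (u1 * u4 - u2 * u3)
      = (u1 * t1' + u2 * t3') * (u3 * t2' + u4 * t4') - (u1 * t2' + u2 * t4') * (u3 * t1' + u4 * t3')"
    by (simp add: algebra_simps)
  also have "\<dots> = 1" unfolding id by simp
  finally have "(t1' * t4' - t3' * t2') * (u1 * u4 - u2 * u3) = 1" .
  then show ?thesis
    by (simp add: u1_def u2_def u3_def u4_def x1_def x2_def x3_def x4_def t1_def t2_def t3_def t4_def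
        t1'_def t2'_def t3'_def t4'_def)
qed

text \<open>Column \<open>j\<close> of the inverse is annihilated by all rows but the \<open>j\<close>-th. Its direction therefore does not
  depend on row \<open>j\<close>, which only fixes the length.\<close>
lemma inverse_column_change_row:
  assumes "mutually_inverse n Y H" and "mutually_inverse n Y' H'" and "j < n" "p < n"
    and same: "\<And>a b. a < n \<Longrightarrow> b < n \<Longrightarrow> a \<noteq> j \<Longrightarrow> Y' a b = Y a b"
  shows "H' p j * (\<Sum>q<n. Y' j q * H q j) = H p j"
proof -
  have "(\<Sum>q<n. Y' a q * H q j) = 0" if "a < n" "a \<noteq> j" for a
  proof -
    have "(\<Sum>q<n. Y' a q * H q j) = (\<Sum>q<n. Y a q * H q j)"
      using that same by (intro sum.cong) auto
    then show ?thesis using assms(1,3) that by (simp add: mutually_inverse_def)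
  qed
  then have "(\<Sum>a<n. H' p a * (\<Sum>q<n. Y' a q * H q j)) = (\<Sum>a<n. if a = j then H' p a * (\<Sum>q<n. Y' a q * H q j) else 0)"
    by (intro sum.cong) auto
  then show ?thesis
    using mutually_inverse_expand[OF assms(2,4), of "\<lambda>q. H q j"] \<open>j < n\<close> by simp
qed

text \<open>A vector annihilated by all rows except \<open>i\<close> and \<open>j\<close> is a combination of the columns \<open>i\<close> and \<open>j\<close> of \<open>H\<close>,
  and the coefficient of column \<open>i\<close> is read off from row \<open>i\<close>.\<close>
lemma wedge_sq_two_columns:
  assumes inv: "mutually_inverse n Y H" and ij: "i < n" "j < n" "i \<noteq> j"
    and ker: "\<And>a. a < n \<Longrightarrow> a \<noteq> i \<Longrightarrow> a \<noteq> j \<Longrightarrow> (\<Sum>q<n. Y a q * x q) = 0"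
  shows "wedge_sq n x (\<lambda>k. H k j) = (cmod (\<Sum>q<n. Y i q * x q))\<^sup>2 * wedge_sq n (\<lambda>k. H k i) (\<lambda>k. H k j)"
proof -
  define \<alpha> \<beta> where "\<alpha> = (\<Sum>q<n. Y i q * x q)" and "\<beta> = (\<Sum>q<n. Y j q * x q)"
  have "x p = \<alpha> * H p i + \<beta> * H p j" if "p < n" for p
  proof -
    have "x p = (\<Sum>a<n. H p a * (\<Sum>q<n. Y a q * x q))"
      using mutually_inverse_expand[OF inv that] by simp
    also have "\<dots> = (\<Sum>a\<in>{i, j}. H p a * (\<Sum>q<n. Y a q * x q))"
      using ij ker by (intro sum.mono_neutral_right) auto
    finally show ?thesis using ij by (simp add: \<alpha>_def \<beta>_def mult.commute)
  qed
  then have "wedge_sq n x (\<lambda>k. H k j) = wedge_sq n (\<lambda>k. \<alpha> * H k i + \<beta> * H k j) (\<lambda>k. H k j)"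
    by (intro wedge_sq_cong) auto
  also have "\<dots> = wedge_sq n (\<lambda>k. \<alpha> * H k i) (\<lambda>k. 1 * H k j)"
    unfolding wedge_sq_def by (simp add: algebra_simps)
  finally show ?thesis by (simp only: wedge_sq_scale \<alpha>_def) simp
qed

section \<open>Measurability of determinants and inverses\<close>

definition fun_det :: "nat \<Rightarrow> (nat \<Rightarrow> nat \<Rightarrow> complex) \<Rightarrow> complex" where
  "fun_det n Y = det (mat n n (\<lambda>(i, j). Y i j))"

definition fun_inverse :: "nat \<Rightarrow> (nat \<Rightarrow> nat \<Rightarrow> complex) \<Rightarrow> nat \<Rightarrow> nat \<Rightarrow> complex" where
  "fun_inverse n Y p q = adj_mat (mat n n (\<lambda>(i, j). Y i j)) $$ (p, q) / fun_det n Y"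

lemma mutually_inverse_fun_inverse:
  assumes "fun_det n Y \<noteq> 0"
  shows "mutually_inverse n Y (fun_inverse n Y)"
proof -
  let ?A = "mat n n (\<lambda>(i, j). Y i j)"
  have A: "?A \<in> carrier_mat n n" by simp
  note adj = adj_mat[OF A]
  have entry: "(B * C) $$ (i, j) = (\<Sum>k<n. B $$ (i, k) * C $$ (k, j))"
    if "B \<in> carrier_mat n n" "C \<in> carrier_mat n n" "i < n" "j < n" for B C :: "complex mat" and i j
    using that by (simp add: scalar_prod_def atLeast0LessThan)
  have "(\<Sum>k<n. Y i k * fun_inverse n Y k j) = of_bool (i = j)" if "i < n" "j < n" for i j
  proof -
    have "(\<Sum>k<n. Y i k * fun_inverse n Y k j) = (?A * adj_mat ?A) $$ (i, j) / fun_det n Y"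
      unfolding entry[OF A adj(1) that] using that
      by (simp add: fun_inverse_def sum_divide_distrib)
    also have "\<dots> = of_bool (i = j)"
      unfolding adj(2) using that assms by (simp add: fun_det_def)
    finally show ?thesis .
  qed
  moreover have "(\<Sum>k<n. fun_inverse n Y i k * Y k j) = of_bool (i = j)" if "i < n" "j < n" for i j
  proof -
    have "(\<Sum>k<n. fun_inverse n Y i k * Y k j) = (adj_mat ?A * ?A) $$ (i, j) / fun_det n Y"
      unfolding entry[OF adj(1) A that] using that
      by (simp add: fun_inverse_def sum_divide_distrib)
    also have "\<dots> = of_bool (i = j)"
      unfolding adj(3) using that assms by (simp add: fun_det_def)
    finally show ?thesis .
  qed
  ultimately show ?thesis by (simp add: mutually_inverse_def)
qed

lemma measurable_fun_det:
  assumes "\<And>i j. i < n \<Longrightarrow> j < n \<Longrightarrow> (\<lambda>x. Y x i j) \<in> borel_measurable M"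
  shows "(\<lambda>x. fun_det n (Y x)) \<in> borel_measurable M"
proof -
  have "(\<lambda>x. fun_det n (Y x)) = (\<lambda>x. \<Sum>p\<in>{p. p permutes {0..<n}}. signof p * (\<Prod>i = 0..<n. Y x i (p i)))"
    unfolding fun_det_def by (subst det_def') (auto intro!: ext sum.cong prod.cong arg_cong2[where f="(*)"]
        simp: permutes_in_image)
  also have "\<dots> \<in> borel_measurable M"
    by (intro borel_measurable_sum borel_measurable_times borel_measurable_prod measurable_const assms)
       (auto simp: permutes_in_image)
  finally show ?thesis .
qed

lemma measurable_fun_inverse:
  assumes Y: "\<And>i j. i < n \<Longrightarrow> j < n \<Longrightarrow> (\<lambda>x. Y x i j) \<in> borel_measurable M"
    and pq: "p < n" "q < n"
  shows "(\<lambda>x. fun_inverse n (Y x) p q) \<in> borel_measurable M"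
proof -
  let ?Z = "\<lambda>x i j. Y x (if i < q then i else Suc i) (if j < p then j else Suc j)"
  have "(\<lambda>x. fun_inverse n (Y x) p q) = (\<lambda>x. (-1) ^ (q + p) * fun_det (n - 1) (?Z x) / fun_det n (Y x))"
  proof
    fix x
    have "mat_delete (mat n n (\<lambda>(i, j). Y x i j)) q p = mat (n - 1) (n - 1) (\<lambda>(i, j). ?Z x i j)"
      unfolding mat_delete_def by (intro eq_matI) auto
    then show "fun_inverse n (Y x) p q = (-1) ^ (q + p) * fun_det (n - 1) (?Z x) / fun_det n (Y x)"
      using pq by (simp add: fun_inverse_def adj_mat_def cofactor_def fun_det_def)
  qed
  also have "\<dots> \<in> borel_measurable M"
    using Y by (intro borel_measurable_divide borel_measurable_times measurable_const measurable_fun_det) auto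
  finally show ?thesis .
qed

section \<open>Laws with bounded density\<close>

lemma nn_integral_lborel_le_interval:
  fixes \<alpha> \<beta> :: complex
  assumes "\<alpha> \<noteq> 0" "0 \<le> \<epsilon>"
  shows "(\<integral>\<^sup>+x. indicator {x. cmod (\<alpha> * complex_of_real x + \<beta>) \<le> \<epsilon>} x \<partial>lborel)
    \<le> ennreal (2 * \<epsilon> / cmod \<alpha>)"
proof -
  define c where "c = - Re (\<beta> / \<alpha>)"
  define r where "r = \<epsilon> / cmod \<alpha>"
  have r: "r \<ge> 0" using assms by (simp add: r_def)
  have sub: "{x. cmod (\<alpha> * complex_of_real x + \<beta>) \<le> \<epsilon>} \<subseteq> {c - r..c + r}"
  proof
    fix x assume "x \<in> {x. cmod (\<alpha> * complex_of_real x + \<beta>) \<le> \<epsilon>}"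
    moreover have "\<alpha> * complex_of_real x + \<beta> = \<alpha> * (complex_of_real x + \<beta> / \<alpha>)"
      using assms by (simp add: field_simps)
    ultimately have "cmod \<alpha> * cmod (complex_of_real x + \<beta> / \<alpha>) \<le> \<epsilon>"
      by (simp add: norm_mult)
    then have "cmod (complex_of_real x + \<beta> / \<alpha>) \<le> r"
      using assms by (simp add: r_def pos_le_divide_eq mult.commute)
    then have "\<bar>Re (complex_of_real x + \<beta> / \<alpha>)\<bar> \<le> r"
      using abs_Re_le_cmod order_trans by blast
    then show "x \<in> {c - r..c + r}" by (auto simp: c_def abs_le_iff)
  qed
  have "(\<integral>\<^sup>+x. indicator {x. cmod (\<alpha> * complex_of_real x + \<beta>) \<le> \<epsilon>} x \<partial>lborel)
     \<le> (\<integral>\<^sup>+x. indicator {c - r..c + r} x \<partial>lborel)"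
    using sub by (intro nn_integral_mono) (auto split: split_indicator)
  also have "\<dots> = ennreal (2 * r)" using r by simp
  finally show ?thesis by (simp add: r_def)
qed

text \<open>The exact value is \<open>pi / sqrt c\<close>.\<close>
lemma nn_integral_Cauchy_density_le:
  assumes "c > 0"
  shows "(\<integral>\<^sup>+x. ennreal (1 / (1 + c * (x + b)\<^sup>2)) \<partial>lborel) \<le> ennreal (4 / sqrt c)"
proof -
  have int: "integrable lborel (\<lambda>x::real. inverse (1 + x\<^sup>2))"
    and val: "integral\<^sup>L lborel (\<lambda>x::real. inverse (1 + x\<^sup>2)) = pi"
    using integrable_inverse_1_plus_square LBINT_inverse_1_plus_square
    by (simp_all add: set_integrable_def interval_lebesgue_integral_def set_lebesgue_integral_def einterval_def)
  have s: "sqrt c > 0" using assms by simp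
  have "(\<integral>\<^sup>+x. ennreal (inverse (1 + x\<^sup>2)) \<partial>lborel) = ennreal pi"
    by (subst nn_integral_eq_integral[OF int]) (auto simp: val)
  also have "(\<integral>\<^sup>+x. ennreal (inverse (1 + x\<^sup>2)) \<partial>lborel)
      = ennreal (sqrt c) * (\<integral>\<^sup>+x. ennreal (inverse (1 + (sqrt c * b + sqrt c * x)\<^sup>2)) \<partial>lborel)"
    using s by (subst nn_integral_real_affine[where c="sqrt c" and t="sqrt c * b"]) auto
  also have "(\<integral>\<^sup>+x. ennreal (inverse (1 + (sqrt c * b + sqrt c * x)\<^sup>2)) \<partial>lborel)
     = (\<integral>\<^sup>+x. ennreal (1 / (1 + c * (x + b)\<^sup>2)) \<partial>lborel)"
  proof (rule nn_integral_cong)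
    fix x
    have "sqrt c * b + sqrt c * x = sqrt c * (x + b)" by (simp add: algebra_simps)
    then have "(sqrt c * b + sqrt c * x)\<^sup>2 = c * (x + b)\<^sup>2"
      using assms by (simp add: power_mult_distrib)
    then show "ennreal (inverse (1 + (sqrt c * b + sqrt c * x)\<^sup>2)) = ennreal (1 / (1 + c * (x + b)\<^sup>2))"
      by (simp add: inverse_eq_divide)
  qed
  finally have eq: "ennreal (sqrt c) * (\<integral>\<^sup>+x. ennreal (1 / (1 + c * (x + b)\<^sup>2)) \<partial>lborel) = ennreal pi" .
  have "(\<integral>\<^sup>+x. ennreal (1 / (1 + c * (x + b)\<^sup>2)) \<partial>lborel)
     = ennreal (1 / sqrt c) * (ennreal (sqrt c) * (\<integral>\<^sup>+x. ennreal (1 / (1 + c * (x + b)\<^sup>2)) \<partial>lborel))"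
    using s by (simp add: mult.assoc[symmetric] ennreal_mult'[symmetric])
  also have "\<dots> = ennreal (pi / sqrt c)"
    unfolding eq using s by (simp add: ennreal_mult'[symmetric])
  also have "\<dots> \<le> ennreal (4 / sqrt c)"
    using pi_less_4 s by (intro ennreal_leI divide_right_mono) auto
  finally show ?thesis .
qed

lemma nn_integral_inverse_sqrt_le:
  assumes "\<rho> > 0"
  shows "(\<integral>\<^sup>+x. inverse (ennreal (sqrt \<bar>x - b\<bar>)) * indicator {b - \<rho>..b + \<rho>} x \<partial>lborel) \<le> ennreal (4 * sqrt \<rho>)"
proof -
  define f where "f x = x powr (-1/2) * indicator {0..\<rho>} x" for x :: real
  have [measurable]: "f \<in> borel_measurable borel" unfolding f_def by measurable
  have half: "(\<integral>\<^sup>+x. ennreal (f x) \<partial>lborel) = ennreal (2 * sqrt \<rho>)"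
  proof -
    have hi: "((\<lambda>x. x powr (-1/2)) has_integral (\<rho> powr (-1/2 + 1) / (-1/2 + 1))) {0..\<rho>}"
      using assms by (intro has_integral_powr_from_0) auto
    have "(f has_integral (\<rho> powr (-1/2 + 1) / (-1/2 + 1))) UNIV"
      using hi unfolding has_integral_restrict_UNIV[symmetric, of _ _ "{0..\<rho>}"]
      by (rule has_integral_eq[rotated]) (auto simp: f_def)
    moreover have "0 \<le> f x" for x by (simp add: f_def)
    ultimately have "(\<integral>\<^sup>+x. ennreal (f x) \<partial>lborel) = ennreal (\<rho> powr (-1/2 + 1) / (-1/2 + 1))"
      by (intro nn_integral_has_integral_lborel) auto
    also have "\<rho> powr (-1/2 + 1) / (-1/2 + 1) = 2 * sqrt \<rho>"
      using assms by (simp add: powr_half_sqrt)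
    finally show ?thesis .
  qed
  have half': "(\<integral>\<^sup>+x. ennreal (f (x - b)) \<partial>lborel) = ennreal (2 * sqrt \<rho>)"
    using nn_integral_real_affine[of "\<lambda>x. ennreal (f x)" 1 "-b"] by (simp add: half)
  have half'': "(\<integral>\<^sup>+x. ennreal (f (b - x)) \<partial>lborel) = ennreal (2 * sqrt \<rho>)"
    using nn_integral_real_affine[of "\<lambda>x. ennreal (f x)" "-1" "b"] by (simp add: half)
  have "(\<integral>\<^sup>+x. inverse (ennreal (sqrt \<bar>x - b\<bar>)) * indicator {b - \<rho>..b + \<rho>} x \<partial>lborel)
      \<le> (\<integral>\<^sup>+x. ennreal (f (x - b)) + ennreal (f (b - x)) \<partial>lborel)"
  proof (rule nn_integral_mono_AE)
    have "AE x in lborel. x \<noteq> b" by (rule AE_lborel_singleton)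
    then show "AE x in lborel. inverse (ennreal (sqrt \<bar>x - b\<bar>)) * indicator {b - \<rho>..b + \<rho>} x
       \<le> ennreal (f (x - b)) + ennreal (f (b - x))"
    proof eventually_elim
      case (elim x)
      have 1: "inverse (ennreal (sqrt \<bar>x - b\<bar>)) = ennreal (\<bar>x - b\<bar> powr (-1/2))"
        using elim by (subst inverse_ennreal) (auto simp: powr_minus powr_half_sqrt)
      show ?case
      proof (cases "x > b")
        case True
        then show ?thesis unfolding 1 by (auto simp: f_def split: split_indicator)
      next
        case False
        then show ?thesis using elim unfolding 1 by (auto simp: f_def split: split_indicator)
      qed
    qed
  qed
  also have "\<dots> = ennreal (4 * sqrt \<rho>)"
    using assms by (subst nn_integral_add) (auto simp: half' half'' ennreal_plus[symmetric] simp del: ennreal_plus)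
  finally show ?thesis .
qed

text \<open>Domination by \<open>K\<close> times Lebesgue measure is stated for integrals, so that no density has to be carried
  along when coordinates are integrated one by one.\<close>
locale bounded_density = prob_space \<xi> for \<xi> :: "real measure" +
  fixes K :: real
  assumes sets_law [measurable_cong]: "sets \<xi> = sets borel"
    and nn_integral_law_le: "f \<in> borel_measurable borel \<Longrightarrow>
      (\<integral>\<^sup>+x. f x \<partial>\<xi>) \<le> ennreal K * (\<integral>\<^sup>+x. f x \<partial>lborel)"
begin

lemma space_law [simp]: "space \<xi> = UNIV"
  using sets_eq_imp_space_eq[OF sets_law] by simp

lemma emeasure_law_UNIV [simp]: "emeasure \<xi> UNIV = 1"
  using emeasure_space_1 by simp

lemma K_pos: "K > 0"
proof (rule ccontr)
  assume "\<not> K > 0"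
  then have "ennreal K = 0" by (simp add: ennreal_neg)
  then show False
    using nn_integral_law_le[of "\<lambda>_. 1"] emeasure_space_1 by simp
qed

lemma nn_integral_law_const [simp]: "(\<integral>\<^sup>+x. c \<partial>\<xi>) = c"
  using emeasure_space_1 by simp

lemma nn_integral_le_interval:
  fixes \<alpha> \<beta> :: complex
  assumes "\<alpha> \<noteq> 0" "0 \<le> \<epsilon>"
  shows "(\<integral>\<^sup>+x. indicator {x. cmod (\<alpha> * complex_of_real x + \<beta>) \<le> \<epsilon>} x \<partial>\<xi>)
    \<le> ennreal (2 * K * \<epsilon> / cmod \<alpha>)"
proof -
  have "(\<integral>\<^sup>+x. indicator {x. cmod (\<alpha> * complex_of_real x + \<beta>) \<le> \<epsilon>} x \<partial>\<xi>)
    \<le> ennreal K * (\<integral>\<^sup>+x. indicator {x. cmod (\<alpha> * complex_of_real x + \<beta>) \<le> \<epsilon>} x \<partial>lborel)"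
    by (rule nn_integral_law_le) measurable
  also have "\<dots> \<le> ennreal K * ennreal (2 * \<epsilon> / cmod \<alpha>)"
    using assms by (intro mult_left_mono nn_integral_lborel_le_interval) auto
  also have "\<dots> = ennreal (2 * K * \<epsilon> / cmod \<alpha>)"
    using K_pos by (simp add: ennreal_mult'[symmetric] mult_ac)
  finally show ?thesis .
qed

text \<open>The exponent \<open>1/2\<close> is integrable at the singularity. Splitting \<open>1 / max |\<alpha>| |\<beta>|\<close> into two such factors
  is what avoids a logarithm in the estimate for two by two determinants.\<close>
lemma nn_integral_inverse_sqrt_dist_le:
  "(\<integral>\<^sup>+x. inverse (ennreal (sqrt \<bar>x - b\<bar>)) \<partial>\<xi>) \<le> ennreal (5 * sqrt K)"
proof -
  \<comment> \<open>The scale at which the two parts of the bound balance.\<close>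
  define \<rho> where "\<rho> = 1 / K"
  have \<rho>: "\<rho> > 0" using K_pos by (simp add: \<rho>_def)
  let ?g = "\<lambda>x. inverse (ennreal (sqrt \<bar>x - b\<bar>)) * indicator {b - \<rho>..b + \<rho>} x"
  have "(\<integral>\<^sup>+x. inverse (ennreal (sqrt \<bar>x - b\<bar>)) \<partial>\<xi>) \<le> (\<integral>\<^sup>+x. ennreal (sqrt K) + ?g x \<partial>\<xi>)"
  proof (rule nn_integral_mono)
    fix x
    show "inverse (ennreal (sqrt \<bar>x - b\<bar>)) \<le> ennreal (sqrt K) + ?g x"
    proof (cases "x \<in> {b - \<rho>..b + \<rho>}")
      case False
      then have "\<bar>x - b\<bar> \<ge> \<rho>" by (auto simp: abs_if)
      then have "sqrt \<bar>x - b\<bar> \<ge> sqrt \<rho>" "sqrt \<rho> > 0" using \<rho> by auto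
      then have "inverse (sqrt \<bar>x - b\<bar>) \<le> inverse (sqrt \<rho>)" by (intro le_imp_inverse_le) auto
      also have "\<dots> = sqrt K" by (simp add: \<rho>_def real_sqrt_divide)
      finally show ?thesis using False \<open>\<bar>x - b\<bar> \<ge> \<rho>\<close> \<rho>
        by (subst inverse_ennreal) (auto intro!: ennreal_leI)
    qed simp
  qed
  also have "\<dots> = ennreal (sqrt K) + (\<integral>\<^sup>+x. ?g x \<partial>\<xi>)"
    by (subst nn_integral_add) auto
  also have "(\<integral>\<^sup>+x. ?g x \<partial>\<xi>) \<le> ennreal K * (\<integral>\<^sup>+x. ?g x \<partial>lborel)"
    by (rule nn_integral_law_le) measurable
  also have "\<dots> \<le> ennreal K * ennreal (4 * sqrt \<rho>)"
    by (intro mult_left_mono nn_integral_inverse_sqrt_le \<rho>) auto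
  also have "ennreal K * ennreal (4 * sqrt \<rho>) = ennreal (4 * sqrt K)"
  proof -
    have "K * sqrt \<rho> = sqrt K"
      using K_pos by (simp add: \<rho>_def real_sqrt_divide real_div_sqrt)
    then show ?thesis using K_pos by (simp add: ennreal_mult'[symmetric] mult_ac)
  qed
  finally show ?thesis
    using K_pos by (simp add: ennreal_plus[symmetric] del: ennreal_plus)
qed

text \<open>A random two by two matrix with complex shift has determinant at most \<open>t\<close> with probability of order
  \<open>K\<^sup>2 t\<close>: given the first row, the determinant is an affine form in the second row whose coefficients are
  the entries of the first.\<close>
lemma nn_integral_small_det_le:
  fixes b1 b2 b3 b4 :: complex
  assumes t: "t > 0"
  shows "(\<integral>\<^sup>+x1. \<integral>\<^sup>+x2. \<integral>\<^sup>+x3. \<integral>\<^sup>+x4. indicator {r. r \<le> t}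
      (cmod ((complex_of_real x1 - b1) * (complex_of_real x4 - b4) - (complex_of_real x2 - b2) * (complex_of_real x3 - b3)))
      \<partial>\<xi> \<partial>\<xi> \<partial>\<xi> \<partial>\<xi>) \<le> ennreal (50 * K\<^sup>2 * t)"
proof -
  interpret PP: pair_sigma_finite \<xi> \<xi> ..
  let ?f = "\<lambda>x1 x2 x3 x4. indicator {r. r \<le> t}
      (cmod ((complex_of_real x1 - b1) * (complex_of_real x4 - b4) - (complex_of_real x2 - b2) * (complex_of_real x3 - b3))) :: ennreal"
  let ?g = "\<lambda>b x. inverse (ennreal (sqrt \<bar>x - b\<bar>))"
  \<comment> \<open>The last row meets an affine form whose largest coefficient is at least the geometric mean of
      both; this makes the bound a product over the entries of the first row. Where a factor
      vanishes its inverse is \<open>\<infinity>\<close>.\<close>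
  have inner: "(\<integral>\<^sup>+x3. \<integral>\<^sup>+x4. ?f x1 x2 x3 x4 \<partial>\<xi> \<partial>\<xi>) \<le> ennreal (2 * K * t) * ?g (Re b1) x1 * ?g (Re b2) x2" for x1 x2
  proof (cases "x1 = Re b1 \<or> x2 = Re b2")
    case True
    then have "ennreal (2 * K * t) * ?g (Re b1) x1 * ?g (Re b2) x2 = \<infinity>"
      using t K_pos by (auto simp: ennreal_mult_eq_top_iff)
    then show ?thesis by simp
  next
    case False
    define \<alpha> where "\<alpha> = complex_of_real x1 - b1"
    define \<beta> where "\<beta> = complex_of_real x2 - b2"
    have a: "\<bar>x1 - Re b1\<bar> \<le> cmod \<alpha>" "\<bar>x2 - Re b2\<bar> \<le> cmod \<beta>"
      using abs_Re_le_cmod[of \<alpha>] abs_Re_le_cmod[of \<beta>] by (auto simp: \<alpha>_def \<beta>_def)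
    have nz: "\<alpha> \<noteq> 0" "\<beta> \<noteq> 0" using a False by auto
    define m where "m = max (cmod \<alpha>) (cmod \<beta>)"
    have m: "(\<integral>\<^sup>+x3. \<integral>\<^sup>+x4. ?f x1 x2 x3 x4 \<partial>\<xi> \<partial>\<xi>) \<le> ennreal (2 * K * t / m)"
    proof (cases "cmod \<alpha> \<ge> cmod \<beta>")
      case True
      have "(\<integral>\<^sup>+x4. ?f x1 x2 x3 x4 \<partial>\<xi>) \<le> ennreal (2 * K * t / m)" for x3
      proof -
        have "(\<integral>\<^sup>+x4. ?f x1 x2 x3 x4 \<partial>\<xi>) = (\<integral>\<^sup>+x. indicator {x. cmod (\<alpha> * complex_of_real x +
            (- \<alpha> * b4 - \<beta> * (complex_of_real x3 - b3))) \<le> t} x \<partial>\<xi>)"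
          by (intro nn_integral_cong) (simp add: \<alpha>_def \<beta>_def indicator_def algebra_simps)
        also have "\<dots> \<le> ennreal (2 * K * t / cmod \<alpha>)" using nz t by (intro nn_integral_le_interval) auto
        finally show ?thesis using True by (simp add: m_def max_def)
      qed
      then have "(\<integral>\<^sup>+x3. \<integral>\<^sup>+x4. ?f x1 x2 x3 x4 \<partial>\<xi> \<partial>\<xi>) \<le> (\<integral>\<^sup>+x3. ennreal (2 * K * t / m) \<partial>\<xi>)"
        by (intro nn_integral_mono) auto
      then show ?thesis by simp
    next
      case False
      have "(\<integral>\<^sup>+x3. ?f x1 x2 x3 x4 \<partial>\<xi>) \<le> ennreal (2 * K * t / m)" for x4
      proof -
        have "(\<integral>\<^sup>+x3. ?f x1 x2 x3 x4 \<partial>\<xi>) = (\<integral>\<^sup>+x. indicator {x. cmod (- \<beta> * complex_of_real x +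
            (\<alpha> * (complex_of_real x4 - b4) + \<beta> * b3)) \<le> t} x \<partial>\<xi>)"
          by (intro nn_integral_cong) (simp add: \<alpha>_def \<beta>_def indicator_def algebra_simps)
        also have "\<dots> \<le> ennreal (2 * K * t / cmod (- \<beta>))" using nz t by (intro nn_integral_le_interval) auto
        finally show ?thesis using False by (simp add: m_def max_def)
      qed
      then have "(\<integral>\<^sup>+x4. \<integral>\<^sup>+x3. ?f x1 x2 x3 x4 \<partial>\<xi> \<partial>\<xi>) \<le> (\<integral>\<^sup>+x4. ennreal (2 * K * t / m) \<partial>\<xi>)"
        by (intro nn_integral_mono) auto
      also have "(\<integral>\<^sup>+x4. \<integral>\<^sup>+x3. ?f x1 x2 x3 x4 \<partial>\<xi> \<partial>\<xi>) = (\<integral>\<^sup>+x3. \<integral>\<^sup>+x4. ?f x1 x2 x3 x4 \<partial>\<xi> \<partial>\<xi>)"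
        by (rule PP.Fubini') measurable
      finally show ?thesis by simp
    qed
    have "sqrt \<bar>x1 - Re b1\<bar> * sqrt \<bar>x2 - Re b2\<bar> \<le> sqrt m * sqrt m"
      using a by (intro mult_mono) (auto simp: m_def)
    moreover have "m \<ge> 0" by (simp add: m_def le_max_iff_disj)
    ultimately have "sqrt \<bar>x1 - Re b1\<bar> * sqrt \<bar>x2 - Re b2\<bar> \<le> m" by simp
    then have "2 * K * t / m \<le> 2 * K * t * (inverse (sqrt \<bar>x1 - Re b1\<bar>) * inverse (sqrt \<bar>x2 - Re b2\<bar>))"
      using False t K_pos nz unfolding inverse_mult_distrib[symmetric] divide_inverse
      by (intro mult_left_mono le_imp_inverse_le) auto
    also have "ennreal \<dots> = ennreal (2 * K * t) * ?g (Re b1) x1 * ?g (Re b2) x2"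
      using False t K_pos by (simp add: inverse_ennreal ennreal_mult' mult.assoc)
    finally show ?thesis using m order_trans ennreal_leI by meson
  qed
  have "(\<integral>\<^sup>+x1. \<integral>\<^sup>+x2. \<integral>\<^sup>+x3. \<integral>\<^sup>+x4. ?f x1 x2 x3 x4 \<partial>\<xi> \<partial>\<xi> \<partial>\<xi> \<partial>\<xi>)
     \<le> (\<integral>\<^sup>+x1. \<integral>\<^sup>+x2. ennreal (2 * K * t) * ?g (Re b1) x1 * ?g (Re b2) x2 \<partial>\<xi> \<partial>\<xi>)"
    by (intro nn_integral_mono inner)
  also have "\<dots> = ennreal (2 * K * t) * (\<integral>\<^sup>+x1. ?g (Re b1) x1 \<partial>\<xi>) * (\<integral>\<^sup>+x2. ?g (Re b2) x2 \<partial>\<xi>)"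
    by (simp add: nn_integral_cmult nn_integral_multc)
  also have "\<dots> \<le> ennreal (2 * K * t) * ennreal (5 * sqrt K) * ennreal (5 * sqrt K)"
    by (intro mult_mono nn_integral_inverse_sqrt_dist_le) auto
  also have "\<dots> = ennreal (50 * K\<^sup>2 * t)"
    using K_pos t by (simp add: ennreal_mult'[symmetric] power2_eq_square mult_ac)
  finally show ?thesis .
qed

section \<open>Resampling coordinates of an independent array\<close>

abbreviation (input) iid :: "'i set \<Rightarrow> ('i \<Rightarrow> real) measure" where
  "iid I \<equiv> PiM I (\<lambda>_. \<xi>)"

lemma prob_space_iid: "prob_space (iid I)"
  by (intro prob_space_PiM prob_space_axioms)

lemma nn_integral_iid_const [simp]: "(\<integral>\<^sup>+x. c \<partial>iid I) = c"
  by (simp add: prob_space.emeasure_space_1[OF prob_space_iid])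

text \<open>Replacing some coordinates by those of an independent copy does not change the law. Estimates that
  hold with all other coordinates fixed then integrate at once, without decomposing the index set.\<close>
lemma nn_integral_resample:
  fixes I J :: "'i set"
  assumes I: "finite I" "J \<subseteq> I" and F [measurable]: "F \<in> borel_measurable (iid I)"
  shows "(\<integral>\<^sup>+\<omega>. F \<omega> \<partial>iid I)
    = (\<integral>\<^sup>+\<omega>. \<integral>\<^sup>+\<eta>. F (\<lambda>a. if a \<in> J then \<eta> a else \<omega> a) \<partial>iid I \<partial>iid I)"
proof -
  interpret P: prob_space "iid I" by (rule prob_space_iid)
  interpret PP: pair_sigma_finite "iid I" "iid I" ..
  interpret product_sigma_finite "\<lambda>_::'i. \<xi>" ..
  let ?T = "\<lambda>(\<omega>, \<eta>) a. if a \<in> J then \<eta> a else \<omega> a"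
  have T [measurable]: "?T \<in> iid I \<Otimes>\<^sub>M iid I \<rightarrow>\<^sub>M iid I"
  proof (rule measurable_PiM_single')
    show "(\<lambda>p. ?T p a) \<in> iid I \<Otimes>\<^sub>M iid I \<rightarrow>\<^sub>M \<xi>" if "a \<in> I" for a
      using that by (simp add: case_prod_unfold)
    show "?T \<in> space (iid I \<Otimes>\<^sub>M iid I) \<rightarrow> (\<Pi>\<^sub>E i\<in>I. space \<xi>)"
      using I by (auto simp: space_pair_measure space_PiM PiE_def extensional_def)
  qed
  have "distr (iid I \<Otimes>\<^sub>M iid I) (iid I) ?T = iid I"
  proof (rule PiM_eqI[OF I(1)])
    fix A assume A: "\<And>i. i \<in> I \<Longrightarrow> A i \<in> sets \<xi>"
    let ?A1 = "\<lambda>a. if a \<in> J then UNIV else A a" and ?A2 = "\<lambda>a. if a \<in> J then A a else UNIV"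
    have s: "?A1 i \<in> sets \<xi>" "?A2 i \<in> sets \<xi>" if "i \<in> I" for i
      using A[OF that] sets.top[of \<xi>] by auto
    have "emeasure (distr (iid I \<Otimes>\<^sub>M iid I) (iid I) ?T) (Pi\<^sub>E I A)
       = emeasure (iid I \<Otimes>\<^sub>M iid I) (?T -` (Pi\<^sub>E I A) \<inter> space (iid I \<Otimes>\<^sub>M iid I))"
      using A I by (intro emeasure_distr T sets_PiM_I_finite) auto
    also have "?T -` (Pi\<^sub>E I A) \<inter> space (iid I \<Otimes>\<^sub>M iid I) = Pi\<^sub>E I ?A1 \<times> Pi\<^sub>E I ?A2"
      using I(2) by (auto simp: space_pair_measure space_PiM PiE_iff extensional_def subset_iff split: if_splits)
    also have "emeasure (iid I \<Otimes>\<^sub>M iid I) \<dots> = emeasure (iid I) (Pi\<^sub>E I ?A1) * emeasure (iid I) (Pi\<^sub>E I ?A2)"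
      using s I by (intro P.emeasure_pair_measure_Times sets_PiM_I_finite) auto
    also have "\<dots> = (\<Prod>i\<in>I. emeasure \<xi> (?A1 i)) * (\<Prod>i\<in>I. emeasure \<xi> (?A2 i))"
      using s I by (subst (1 2) emeasure_PiM) auto
    also have "\<dots> = (\<Prod>i\<in>I. emeasure \<xi> (A i))"
      unfolding prod.distrib[symmetric] using emeasure_space_1
      by (intro prod.cong refl) auto
    finally show "emeasure (distr (iid I \<Otimes>\<^sub>M iid I) (iid I) ?T) (Pi\<^sub>E I A) = (\<Prod>i\<in>I. emeasure \<xi> (A i))" .
  qed simp
  then have "(\<integral>\<^sup>+\<omega>. F \<omega> \<partial>iid I) = (\<integral>\<^sup>+\<omega>. F \<omega> \<partial>distr (iid I \<Otimes>\<^sub>M iid I) (iid I) ?T)" by simp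
  also have "\<dots> = (\<integral>\<^sup>+p. F (?T p) \<partial>(iid I \<Otimes>\<^sub>M iid I))"
    by (rule nn_integral_distr) measurable
  also have "\<dots> = (\<integral>\<^sup>+\<omega>. \<integral>\<^sup>+\<eta>. F (?T (\<omega>, \<eta>)) \<partial>iid I \<partial>iid I)"
    by (rule P.nn_integral_fst[symmetric]) measurable
  finally show ?thesis by simp
qed

lemma nn_integral_resample_coord:
  fixes I :: "'i set"
  assumes I: "finite I" "a \<in> I" and F [measurable]: "F \<in> borel_measurable (iid I)"
  shows "(\<integral>\<^sup>+\<omega>. F \<omega> \<partial>iid I) = (\<integral>\<^sup>+\<omega>. \<integral>\<^sup>+x. F (fun_upd \<omega> a x) \<partial>\<xi> \<partial>iid I)"
proof -
  interpret product_prob_space "\<lambda>_::'i. \<xi>" ..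
  have upd: "(\<lambda>b. if b \<in> {a} then \<eta> b else \<omega> b) = fun_upd \<omega> a (\<eta> a)" for \<omega> \<eta> :: "'i \<Rightarrow> real"
    by auto
  have "(\<integral>\<^sup>+\<omega>. F \<omega> \<partial>iid I) = (\<integral>\<^sup>+\<omega>. \<integral>\<^sup>+\<eta>. F (fun_upd \<omega> a (\<eta> a)) \<partial>iid I \<partial>iid I)"
    using nn_integral_resample[of I "{a}" F] I F unfolding upd by simp
  also have "\<dots> = (\<integral>\<^sup>+\<omega>. \<integral>\<^sup>+x. F (fun_upd \<omega> a x) \<partial>\<xi> \<partial>iid I)"
  proof (rule nn_integral_cong)
    fix \<omega> assume w: "\<omega> \<in> space (iid I)"
    have m: "(\<lambda>x. fun_upd \<omega> a x) \<in> \<xi> \<rightarrow>\<^sub>M iid I"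
    proof (rule measurable_PiM_single')
      show "(\<lambda>x. (fun_upd \<omega> a x) b) \<in> \<xi> \<rightarrow>\<^sub>M \<xi>" if "b \<in> I" for b
        by (cases "b = a") auto
    qed (use w I in \<open>auto simp: space_PiM PiE_def extensional_def\<close>)
    have "(\<integral>\<^sup>+\<eta>. F (fun_upd \<omega> a (\<eta> a)) \<partial>iid I) = (\<integral>\<^sup>+x. F (fun_upd \<omega> a x) \<partial>distr (iid I) \<xi> (\<lambda>\<eta>. \<eta> a))"
      using I measurable_compose[OF m F] by (intro nn_integral_distr[symmetric]) auto
    also have "distr (iid I) \<xi> (\<lambda>\<eta>. \<eta> a) = \<xi>" by (rule PiM_component[OF I(2)])
    finally show "(\<integral>\<^sup>+\<eta>. F (fun_upd \<omega> a (\<eta> a)) \<partial>iid I) = (\<integral>\<^sup>+x. F (fun_upd \<omega> a x) \<partial>\<xi>)" .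
  qed
  finally show ?thesis .
qed

end

section \<open>Sums of variables with heavy tails\<close>

text \<open>Tails \<open>C w\<^bsup>-q\<^esup>\<close> with \<open>q < 1\<close> survive summation with a loss only linear in the number of terms, whereas
  a union bound over the largest of \<open>m\<close> terms would cost \<open>m\<^bsup>1 + q\<^esup>\<close>. A sum exceeds \<open>W\<close> only if the
  truncated terms \<open>min 1 (Z / W)\<close> add up to 1, and their expectations are dyadic sums of the tails.
  Squared minors of the inverse have \<open>q = 1/2\<close> or \<open>q = 3/4\<close>.\<close>
lemma nn_integral_weak_sum_le:
  fixes Z :: "'a \<Rightarrow> 'b \<Rightarrow> real"
  assumes A: "finite A" and q: "0 \<le> q" "q \<le> 3 / 4" and C: "0 \<le> C" and W: "W > 0"
    and Z [measurable]: "\<And>a. a \<in> A \<Longrightarrow> Z a \<in> borel_measurable M"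
    and P [measurable]: "Measurable.pred M P"
    and Z_nonneg: "\<And>a \<omega>. a \<in> A \<Longrightarrow> 0 \<le> Z a \<omega>"
    and tail: "\<And>a w. a \<in> A \<Longrightarrow> w > 0 \<Longrightarrow>
      (\<integral>\<^sup>+\<omega>. indicator {\<omega>. P \<omega> \<and> w \<le> Z a \<omega>} \<omega> \<partial>M) \<le> ennreal (C * w powr - q)"
  shows "(\<integral>\<^sup>+\<omega>. indicator {\<omega>. P \<omega> \<and> W \<le> (\<Sum>a\<in>A. Z a \<omega>)} \<omega> \<partial>M)
      \<le> ennreal (16 * real (card A) * C * W powr - q)"
proof -
  let ?I = "\<lambda>a k \<omega>. ennreal ((1/2) ^ k) * indicator {\<omega>. P \<omega> \<and> W * (1/2) ^ Suc k \<le> Z a \<omega>} \<omega>"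
  \<comment> \<open>With \<open>k\<close> least such that \<open>Z / W\<close> exceeds \<open>2\<^bsup>-k-1\<^esup>\<close>, the \<open>k\<close>-th term alone is enough.\<close>
  have dyadic: "ennreal (min 1 (Z a \<omega> / W)) \<le> (\<Sum>k. ?I a k \<omega>)" if "a \<in> A" "P \<omega>" for a \<omega>
  proof (cases "Z a \<omega> = 0")
    case False
    define x where "x = Z a \<omega> / W"
    have x: "x > 0" using False Z_nonneg[OF that(1), of \<omega>] W by (simp add: x_def)
    obtain k0 where "(1/2::real) ^ k0 < x" using real_arch_pow_inv[OF x, of "1/2"] by auto
    then have "(1/2::real) ^ Suc k0 \<le> x" using x by simp
    define k where "k = (LEAST k. (1/2::real) ^ Suc k \<le> x)"
    have k: "(1/2) ^ Suc k \<le> x" unfolding k_def by (rule LeastI) fact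
    have "min 1 x \<le> (1/2) ^ k"
    proof (cases k)
      case (Suc k')
      then have "\<not> (1/2) ^ Suc k' \<le> x" using not_less_Least[of k' "\<lambda>k. (1/2::real) ^ Suc k \<le> x"]
        by (simp add: k_def)
      then show ?thesis using Suc by simp
    qed simp
    moreover have "W * (1/2) ^ Suc k \<le> Z a \<omega>"
      using k W by (simp add: x_def field_simps)
    ultimately have "ennreal (min 1 x) \<le> ?I a k \<omega>"
      using that by (simp add: ennreal_leI)
    also have "\<dots> \<le> (\<Sum>k. ?I a k \<omega>)"
    proof -
      have "(\<Sum>k\<in>{k}. ?I a k \<omega>) \<le> (\<Sum>k. ?I a k \<omega>)" by (intro sum_le_suminf) auto
      then show ?thesis by (simp only: sum.insert finite.emptyI empty_iff not_False_eq_True sum.empty add_0_right)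
    qed
    finally show ?thesis by (simp add: x_def)
  qed simp
  have "(\<integral>\<^sup>+\<omega>. indicator {\<omega>. P \<omega> \<and> W \<le> (\<Sum>a\<in>A. Z a \<omega>)} \<omega> \<partial>M)
      \<le> (\<integral>\<^sup>+\<omega>. (\<Sum>a\<in>A. \<Sum>k. ?I a k \<omega>) \<partial>M)"
  proof (rule nn_integral_mono)
    fix \<omega>
    show "indicator {\<omega>. P \<omega> \<and> W \<le> (\<Sum>a\<in>A. Z a \<omega>)} \<omega> \<le> (\<Sum>a\<in>A. \<Sum>k. ?I a k \<omega>)"
    proof (cases "P \<omega> \<and> W \<le> (\<Sum>a\<in>A. Z a \<omega>)")
      case True
      have "1 \<le> (\<Sum>a\<in>A. min 1 (Z a \<omega> / W))"
      proof (cases "\<exists>a\<in>A. Z a \<omega> \<ge> W")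
        case True
        then obtain a where a: "a \<in> A" "Z a \<omega> \<ge> W" by auto
        then have "1 = min 1 (Z a \<omega> / W)" using W by simp
        also have "\<dots> \<le> (\<Sum>a\<in>A. min 1 (Z a \<omega> / W))"
          using a A Z_nonneg W by (intro member_le_sum) auto
        finally show ?thesis .
      next
        case False
        then have "(\<Sum>a\<in>A. min 1 (Z a \<omega> / W)) = (\<Sum>a\<in>A. Z a \<omega> / W)"
          using W by (intro sum.cong) (auto simp: not_le min_def)
        also have "\<dots> = (\<Sum>a\<in>A. Z a \<omega>) / W" by (simp add: sum_divide_distrib)
        finally show ?thesis using True W by simp
      qed
      then have "ennreal 1 \<le> ennreal (\<Sum>a\<in>A. min 1 (Z a \<omega> / W))" by (rule ennreal_leI)
      also have "\<dots> = (\<Sum>a\<in>A. ennreal (min 1 (Z a \<omega> / W)))"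
        using Z_nonneg W by (intro sum_ennreal[symmetric]) auto
      also have "\<dots> \<le> (\<Sum>a\<in>A. \<Sum>k. ?I a k \<omega>)"
        using dyadic True by (intro sum_mono) auto
      finally show ?thesis using True by simp
    qed simp
  qed
  also have "\<dots> = (\<Sum>a\<in>A. \<Sum>k. \<integral>\<^sup>+\<omega>. ?I a k \<omega> \<partial>M)"
    by (subst nn_integral_sum) (auto intro!: sum.cong nn_integral_suminf)
  also have "\<dots> \<le> (\<Sum>a\<in>A. \<Sum>k. ennreal (2 * C * W powr - q * (7/8) ^ k))"
  proof (intro sum_mono suminf_le)
    fix a k assume a: "a \<in> A"
    \<comment> \<open>The terms decay like \<open>2\<^bsup>-k(1 - q)\<^esup>\<close>, at worst like \<open>2\<^bsup>-k/4\<^esup>\<close>, and \<open>2\<^bsup>3/4\<^esup> \<le> 7/4\<close> turns this into \<open>(7/8)\<^bsup>k\<^esup>\<close>.\<close>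
    have two: "2 powr (3/4) \<le> (7/4::real)"
    proof -
      have "(2 powr (3/4)) ^ 4 = (2 powr (3/4) :: real) powr 4" by simp
      also have "\<dots> = 2 powr 3" unfolding powr_powr by simp
      also have "\<dots> = 8" by simp
      also have "\<dots> \<le> (7/4) ^ 4" by (simp add: power4_eq_xxxx)
      finally show ?thesis using power_le_imp_le_base[of "2 powr (3/4::real)" 3 "7/4"] by simp
    qed
    have "(\<integral>\<^sup>+\<omega>. ?I a k \<omega> \<partial>M)
        = ennreal ((1/2) ^ k) * (\<integral>\<^sup>+\<omega>. indicator {\<omega>. P \<omega> \<and> W * (1/2) ^ Suc k \<le> Z a \<omega>} \<omega> \<partial>M)"
      using a by (intro nn_integral_cmult) measurable
    also have "\<dots> \<le> ennreal ((1/2) ^ k) * ennreal (C * (W * (1/2) ^ Suc k) powr - q)"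
      using a W by (intro mult_left_mono tail) auto
    also have "\<dots> = ennreal ((1/2) ^ k * (C * (W * (1/2) ^ Suc k) powr - q))"
      using C by (subst ennreal_mult) auto
    also have "\<dots> \<le> ennreal (2 * C * W powr - q * (7/8) ^ k)"
    proof (rule ennreal_leI)
      have "((1/2::real) ^ Suc k) powr - q = 2 powr (q * real (Suc k))"
      proof -
        have half: "(1/2::real) ^ Suc k = 2 powr - real (Suc k)"
          unfolding powr_minus by (subst powr_realpow) (simp_all add: power_one_over inverse_eq_divide)
        show ?thesis unfolding half powr_powr mult_minus_left mult_minus_right minus_minus
          by (simp only: mult.commute)
      qed
      also have "\<dots> \<le> 2 powr (3/4 * real (Suc k))"
        using q by (intro powr_mono mult_right_mono) auto
      also have "\<dots> = (2 powr (3/4)) ^ Suc k"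
        unfolding powr_powr[symmetric] by (subst powr_realpow) simp_all
      also have "\<dots> \<le> (7/4) ^ Suc k" by (intro power_mono two) auto
      finally have 1: "((1/2::real) ^ Suc k) powr - q \<le> (7/4) ^ Suc k" .
      have "(1/2) ^ k * (C * (W * (1/2) ^ Suc k) powr - q)
          = (1/2) ^ k * C * W powr - q * ((1/2) ^ Suc k) powr - q"
        using W powr_mult[of W "(1/2) ^ Suc k" "-q"] by (simp del: power_Suc)
      also have "\<dots> \<le> (1/2) ^ k * C * W powr - q * (7/4) ^ Suc k"
        using C by (intro mult_left_mono 1) auto
      also have "\<dots> = (7/4) * (C * W powr - q) * (7/8) ^ k"
      proof -
        have "(7/8::real) ^ k = (1/2) ^ k * (7/4) ^ k"
          unfolding power_mult_distrib[symmetric] by simp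
        then show ?thesis by simp
      qed
      also have "\<dots> \<le> 2 * (C * W powr - q) * (7/8) ^ k"
        using C by (intro mult_right_mono) auto
      finally show "(1/2) ^ k * (C * (W * (1/2) ^ Suc k) powr - q) \<le> 2 * C * W powr - q * (7/8) ^ k"
        by (simp add: mult_ac)
    qed
    finally show "(\<integral>\<^sup>+\<omega>. ?I a k \<omega> \<partial>M) \<le> ennreal (2 * C * W powr - q * (7/8) ^ k)" .
  qed auto
  also have "\<dots> = (\<Sum>a\<in>A. ennreal (16 * C * W powr - q))"
  proof (rule sum.cong[OF refl])
    fix a
    have "(\<Sum>k. ennreal (2 * C * W powr - q * (7/8) ^ k)) = ennreal (\<Sum>k. 2 * C * W powr - q * (7/8) ^ k)"
      using C by (intro suminf_ennreal2 summable_mult summable_geometric) auto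
    also have "(\<Sum>k. 2 * C * W powr - q * (7/8) ^ k) = 2 * C * W powr - q * (\<Sum>k. (7/8) ^ k)"
      by (intro suminf_mult summable_geometric) auto
    also have "\<dots> = 16 * C * W powr - q" by (subst suminf_geometric) auto
    finally show "(\<Sum>k. ennreal (2 * C * W powr - q * (7/8) ^ k)) = ennreal (16 * C * W powr - q)" .
  qed
  also have "\<dots> = ennreal (16 * real (card A) * C * W powr - q)"
    using C by (simp add: ennreal_of_nat_eq_real_of_nat ennreal_mult'[symmetric] mult_ac)
  finally show ?thesis .
qed

section \<open>Minors of the inverse of a random matrix\<close>

definition perturbed :: "(nat \<Rightarrow> nat \<Rightarrow> complex) \<Rightarrow> (nat \<times> nat \<Rightarrow> real) \<Rightarrow> nat \<Rightarrow> nat \<Rightarrow> complex" where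
  "perturbed D \<omega> a b = complex_of_real (\<omega> (a, b)) + D a b"

context bounded_density
begin

lemma measurable_resample_coord:
  fixes I :: "'i set"
  assumes "a \<in> I" and F [measurable]: "F \<in> borel_measurable (iid I)"
  shows "(\<lambda>\<omega>. \<integral>\<^sup>+x. F (fun_upd \<omega> a x) \<partial>\<xi>) \<in> borel_measurable (iid I)"
proof (rule borel_measurable_nn_integral)
  have [measurable]: "(\<lambda>(\<omega>, x). fun_upd \<omega> a x) \<in> iid I \<Otimes>\<^sub>M \<xi> \<rightarrow>\<^sub>M iid I"
  proof (rule measurable_PiM_single')
    show "(\<lambda>p. (case p of (\<omega>, x) \<Rightarrow> fun_upd \<omega> a x) b) \<in> iid I \<Otimes>\<^sub>M \<xi> \<rightarrow>\<^sub>M \<xi>" if "b \<in> I" for b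
      using that by (cases "b = a") (simp_all add: case_prod_unfold)
  qed (use assms(1) in \<open>auto simp: space_pair_measure space_PiM PiE_def extensional_def\<close>)
  have "(\<lambda>p. F ((\<lambda>(\<omega>, x). fun_upd \<omega> a x) p)) \<in> borel_measurable (iid I \<Otimes>\<^sub>M \<xi>)"
    by measurable
  then show "(\<lambda>(\<omega>, x). F (fun_upd \<omega> a x)) \<in> borel_measurable (iid I \<Otimes>\<^sub>M \<xi>)"
    by (simp add: case_prod_unfold)
qed

lemma nn_integral_resample2:
  fixes I :: "'i set"
  assumes I: "finite I" "a \<in> I" "b \<in> I" and F: "F \<in> borel_measurable (iid I)"
  shows "(\<integral>\<^sup>+\<omega>. F \<omega> \<partial>iid I) = (\<integral>\<^sup>+\<omega>. \<integral>\<^sup>+x. \<integral>\<^sup>+y. F (fun_upd (fun_upd \<omega> a x) b y) \<partial>\<xi> \<partial>\<xi> \<partial>iid I)"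
  using nn_integral_resample_coord[OF I(1,3) F]
    nn_integral_resample_coord[OF I(1,2) measurable_resample_coord[OF I(3) F]] by simp

lemma measurable_resample2:
  fixes I :: "'i set"
  assumes I: "a \<in> I" "b \<in> I" and F: "F \<in> borel_measurable (iid I)"
  shows "(\<lambda>\<omega>. \<integral>\<^sup>+x. \<integral>\<^sup>+y. F (fun_upd (fun_upd \<omega> a x) b y) \<partial>\<xi> \<partial>\<xi>) \<in> borel_measurable (iid I)"
  using measurable_resample_coord[OF I(1) measurable_resample_coord[OF I(2) F]] .

lemma measurable_perturbed:
  assumes "i < n" "j < n"
  shows "(\<lambda>\<omega>. perturbed D \<omega> i j) \<in> borel_measurable (iid ({..<n} \<times> {..<n}))"
proof -
  have "(\<lambda>\<omega>. \<omega> (i, j)) \<in> iid ({..<n} \<times> {..<n}) \<rightarrow>\<^sub>M \<xi>"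
    using assms by (intro measurable_component_singleton) auto
  then have [measurable]: "(\<lambda>\<omega>. \<omega> (i, j)) \<in> borel_measurable (iid ({..<n} \<times> {..<n}))"
    by (simp add: measurable_cong_sets[OF refl sets_law])
  show ?thesis unfolding perturbed_def by measurable
qed

lemma measurable_fun_det_perturbed:
  "(\<lambda>\<omega>. fun_det n (perturbed D \<omega>)) \<in> borel_measurable (iid ({..<n} \<times> {..<n}))"
  by (intro measurable_fun_det measurable_perturbed)

lemma measurable_fun_inverse_perturbed:
  "p < n \<Longrightarrow> q < n \<Longrightarrow>
    (\<lambda>\<omega>. fun_inverse n (perturbed D \<omega>) p q) \<in> borel_measurable (iid ({..<n} \<times> {..<n}))"
  by (intro measurable_fun_inverse measurable_perturbed)

text \<open>A single minor is estimated by resampling the four entries of the complementary block. If one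
  value of these entries makes the minor large, it serves as the origin of the translation; if none
  does, there is nothing to prove.\<close>
lemma prob_minor_inverse_ge:
  fixes D :: "nat \<Rightarrow> nat \<Rightarrow> complex" and w :: real
  assumes ij: "i < n" "j < n" and kl: "k < n" "l < n" and w: "w > 0"
  defines "H \<equiv> \<lambda>\<omega>. fun_inverse n (perturbed D \<omega>)"
  shows "(\<integral>\<^sup>+\<omega>. indicator {\<omega>. fun_det n (perturbed D \<omega>) \<noteq> 0 \<and>
        w \<le> (cmod (H \<omega> k i * H \<omega> l j - H \<omega> l i * H \<omega> k j))\<^sup>2} \<omega> \<partial>iid ({..<n} \<times> {..<n}))
      \<le> ennreal (50 * K\<^sup>2 * w powr - (1/2))"
proof -
  let ?S = "{..<n} \<times> {..<n}"
  let ?m = "\<lambda>\<omega>. H \<omega> k i * H \<omega> l j - H \<omega> l i * H \<omega> k j"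
  define E where "E = {\<omega>. fun_det n (perturbed D \<omega>) \<noteq> 0 \<and> w \<le> (cmod (?m \<omega>))\<^sup>2}"
  define F :: "_ \<Rightarrow> ennreal" where "F = indicator E"
  show ?thesis
  proof (cases "i = j \<or> k = l")
    case True
    then have "?m \<omega> = 0" for \<omega> by auto
    then have "E = {}" using w by (simp add: E_def)
    then show ?thesis unfolding E_def[symmetric] by simp
  next
    case False
    have [measurable]: "(\<lambda>\<omega>. H \<omega> p q) \<in> borel_measurable (iid ?S)" if "p < n" "q < n" for p q
      unfolding H_def using that by (rule measurable_fun_inverse_perturbed)
    have [measurable]: "(\<lambda>\<omega>. fun_det n (perturbed D \<omega>)) \<in> borel_measurable (iid ?S)"
      by (rule measurable_fun_det_perturbed)
    have F: "F \<in> borel_measurable (iid ?S)"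
      unfolding F_def E_def using ij kl by measurable
    have S: "(i, k) \<in> ?S" "(i, l) \<in> ?S" "(j, k) \<in> ?S" "(j, l) \<in> ?S" "finite ?S" using ij kl by auto
    define upd where "upd \<omega> x1 x2 x3 x4 = fun_upd (fun_upd (fun_upd (fun_upd \<omega> (i, k) x1) (i, l) x2) (j, k) x3) (j, l) x4"
      for \<omega> :: "nat \<times> nat \<Rightarrow> real" and x1 x2 x3 x4
    have "(\<integral>\<^sup>+\<omega>. F \<omega> \<partial>iid ?S) = (\<integral>\<^sup>+\<omega>. \<integral>\<^sup>+x1. \<integral>\<^sup>+x2. \<integral>\<^sup>+x3. \<integral>\<^sup>+x4. F (upd \<omega> x1 x2 x3 x4) \<partial>\<xi> \<partial>\<xi> \<partial>\<xi> \<partial>\<xi> \<partial>iid ?S)"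
      unfolding upd_def
      using nn_integral_resample2[OF S(5,3,4) F]
        nn_integral_resample2[OF S(5,1,2) measurable_resample2[OF S(3,4) F]] by simp
    also have "\<dots> \<le> (\<integral>\<^sup>+\<omega>. ennreal (50 * K\<^sup>2 * (1 / sqrt w)) \<partial>iid ?S)"
    proof (rule nn_integral_mono)
      fix \<omega>
      show "(\<integral>\<^sup>+x1. \<integral>\<^sup>+x2. \<integral>\<^sup>+x3. \<integral>\<^sup>+x4. F (upd \<omega> x1 x2 x3 x4) \<partial>\<xi> \<partial>\<xi> \<partial>\<xi> \<partial>\<xi>) \<le> ennreal (50 * K\<^sup>2 * (1 / sqrt w))"
      proof (cases "\<exists>x1 x2 x3 x4. upd \<omega> x1 x2 x3 x4 \<in> E")
        case False
        then show ?thesis by (simp add: F_def)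
      next
        case True
        then obtain y1 y2 y3 y4 where y: "upd \<omega> y1 y2 y3 y4 \<in> E" by auto
        define H0 where "H0 = H (upd \<omega> y1 y2 y3 y4)"
        define m where "m = H0 k i * H0 l j - H0 l i * H0 k j"
        have inv0: "mutually_inverse n (perturbed D (upd \<omega> y1 y2 y3 y4)) H0"
          using y unfolding E_def H0_def H_def by (intro mutually_inverse_fun_inverse) auto
        have m: "m \<noteq> 0" using y w by (auto simp: E_def m_def H0_def)
        \<comment> \<open>The inverse of the block of \<open>H0\<close>, subtracted from the sampled block.\<close>
        define b1 b2 b3 b4 where "b1 = complex_of_real y1 - H0 l j / m" and "b2 = complex_of_real y2 + H0 k j / m"
          and "b3 = complex_of_real y3 + H0 l i / m" and "b4 = complex_of_real y4 - H0 k i / m"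
        have "F (upd \<omega> x1 x2 x3 x4) \<le> indicator {r. r \<le> 1 / sqrt w}
           (cmod ((complex_of_real x1 - b1) * (complex_of_real x4 - b4) - (complex_of_real x2 - b2) * (complex_of_real x3 - b3)))"
          for x1 x2 x3 x4
        proof (cases "upd \<omega> x1 x2 x3 x4 \<in> E")
          case True
          let ?w = "upd \<omega> x1 x2 x3 x4"
          have inv: "mutually_inverse n (perturbed D ?w) (H ?w)"
            using True unfolding E_def H_def by (intro mutually_inverse_fun_inverse) auto
          have same: "perturbed D ?w a b = perturbed D (upd \<omega> y1 y2 y3 y4) a b"
            if "\<not> (a \<in> {i, j} \<and> b \<in> {k, l})" for a b
            using that by (auto simp: perturbed_def upd_def)
          let ?q = "(complex_of_real x1 - b1) * (complex_of_real x4 - b4) - (complex_of_real x2 - b2) * (complex_of_real x3 - b3)"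
          let ?d = "\<lambda>a b. perturbed D ?w a b - perturbed D (upd \<omega> y1 y2 y3 y4) a b"
          have d: "?d i k + H0 l j / m = complex_of_real x1 - b1" "?d i l - H0 k j / m = complex_of_real x2 - b2"
            "?d j k - H0 l i / m = complex_of_real x3 - b3" "?d j l + H0 k i / m = complex_of_real x4 - b4"
            using False by (simp_all add: perturbed_def upd_def b1_def b2_def b3_def b4_def)
          have ne: "i \<noteq> j" "k \<noteq> l" using False by auto
          have "?m ?w * ((?d i k + H0 l j / m) * (?d j l + H0 k i / m) - (?d i l - H0 k j / m) * (?d j k - H0 l i / m)) = 1"
            unfolding m_def using same m
            by (intro minor_inverse_change_block[OF inv0 inv ij ne(1) kl ne(2)]) (auto simp: m_def)
          then have "?m ?w * ?q = 1" unfolding d .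
          then have eq: "cmod (?m ?w) * cmod ?q = 1"
            by (metis norm_mult norm_one)
          have "sqrt w \<le> cmod (?m ?w)"
            using True by (simp add: E_def real_le_lsqrt)
          then have "sqrt w * cmod ?q \<le> 1"
            using eq mult_right_mono[of "sqrt w" "cmod (?m ?w)" "cmod ?q"] by simp
          then have "cmod ?q \<le> 1 / sqrt w" using w by (simp add: field_simps)
          then show ?thesis using True by (simp add: F_def)
        qed (simp add: F_def)
        then have "(\<integral>\<^sup>+x1. \<integral>\<^sup>+x2. \<integral>\<^sup>+x3. \<integral>\<^sup>+x4. F (upd \<omega> x1 x2 x3 x4) \<partial>\<xi> \<partial>\<xi> \<partial>\<xi> \<partial>\<xi>)
          \<le> (\<integral>\<^sup>+x1. \<integral>\<^sup>+x2. \<integral>\<^sup>+x3. \<integral>\<^sup>+x4. indicator {r. r \<le> 1 / sqrt w}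
           (cmod ((complex_of_real x1 - b1) * (complex_of_real x4 - b4) - (complex_of_real x2 - b2) * (complex_of_real x3 - b3)))
           \<partial>\<xi> \<partial>\<xi> \<partial>\<xi> \<partial>\<xi>)"
          by (intro nn_integral_mono)
        also have "\<dots> \<le> ennreal (50 * K\<^sup>2 * (1 / sqrt w))"
          using w by (intro nn_integral_small_det_le) auto
        finally show ?thesis .
      qed
    qed
    also have "\<dots> = ennreal (50 * K\<^sup>2 * w powr - (1/2))"
      using w by (simp only: nn_integral_iid_const) (simp add: powr_minus_divide powr_half_sqrt)
    finally show ?thesis by (simp add: F_def E_def)
  qed
qed

text \<open>A complex affine constraint in two real variables amounts to two real constraints, and the area of
  the resulting parallelogram is governed by the determinant of its coefficients, which is an
  imaginary part.\<close>
lemma nn_integral_two_constraints_le: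
  fixes \<alpha> \<beta> \<gamma> :: complex
  assumes ab: "Im (\<alpha> * cnj \<beta>) \<noteq> 0" and \<epsilon>: "0 \<le> \<epsilon>"
  shows "(\<integral>\<^sup>+y. \<integral>\<^sup>+x. indicator {r. r \<le> \<epsilon>}
        (cmod (\<alpha> * complex_of_real x + \<beta> * complex_of_real y + \<gamma>)) \<partial>\<xi> \<partial>\<xi>)
      \<le> ennreal (4 * K\<^sup>2 * \<epsilon>\<^sup>2 / \<bar>Im (\<alpha> * cnj \<beta>)\<bar>)"
proof -
  have \<alpha>: "\<alpha> \<noteq> 0" using ab by auto
  \<comment> \<open>After division by the phase of \<open>\<alpha>\<close> the variable \<open>x\<close> has a real coefficient, so that the imaginary
      part constrains \<open>y\<close> alone.\<close>
  define c where "c = Im (\<beta> * cnj \<alpha>) / cmod \<alpha>"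
  define c' where "c' = Im (\<gamma> * cnj \<alpha>) / cmod \<alpha>"
  have sw: "Im (\<beta> * cnj \<alpha>) = - Im (\<alpha> * cnj \<beta>)" by (simp add: algebra_simps)
  have c: "c \<noteq> 0" using ab \<alpha> by (simp only: c_def sw) simp
  have "(\<integral>\<^sup>+y. \<integral>\<^sup>+x. indicator {r. r \<le> \<epsilon>}
        (cmod (\<alpha> * complex_of_real x + \<beta> * complex_of_real y + \<gamma>)) \<partial>\<xi> \<partial>\<xi>)
     \<le> (\<integral>\<^sup>+y. ennreal (2 * K * \<epsilon> / cmod \<alpha>) *
          indicator {y. cmod (of_real c * complex_of_real y + of_real c') \<le> \<epsilon>} y \<partial>\<xi>)"
  proof (rule nn_integral_mono)
    fix y
    let ?in = "y \<in> {y. cmod (of_real c * complex_of_real y + of_real c') \<le> \<epsilon>}"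
    show "(\<integral>\<^sup>+x. indicator {r. r \<le> \<epsilon>} (cmod (\<alpha> * complex_of_real x + \<beta> * complex_of_real y + \<gamma>)) \<partial>\<xi>)
       \<le> ennreal (2 * K * \<epsilon> / cmod \<alpha>) *
          indicator {y. cmod (of_real c * complex_of_real y + of_real c') \<le> \<epsilon>} y"
    proof (cases ?in)
      case True
      then show ?thesis
        using nn_integral_le_interval[OF \<alpha> \<epsilon>, of "\<beta> * complex_of_real y + \<gamma>"]
        by (simp add: indicator_def add.assoc)
    next
      case False
      have "\<epsilon> < cmod (\<alpha> * complex_of_real x + \<beta> * complex_of_real y + \<gamma>)" for x
      proof -
        let ?v = "\<alpha> * complex_of_real x + \<beta> * complex_of_real y + \<gamma>"
        have "Im (?v * cnj \<alpha>) = Im (\<beta> * cnj \<alpha>) * y + Im (\<gamma> * cnj \<alpha>)"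
          by (simp add: algebra_simps)
        then have "c * y + c' = Im (?v * cnj \<alpha>) / cmod \<alpha>"
          by (simp only: c_def c'_def add_divide_distrib times_divide_eq_left)
        moreover have "\<bar>Im (?v * cnj \<alpha>)\<bar> \<le> cmod ?v * cmod \<alpha>"
          using abs_Im_le_cmod[of "?v * cnj \<alpha>"] by (simp only: norm_mult complex_mod_cnj)
        ultimately have "\<bar>c * y + c'\<bar> \<le> cmod ?v"
          using \<alpha> by (simp add: divide_le_eq)
        moreover have "\<epsilon> < \<bar>c * y + c'\<bar>"
          using False by (simp flip: of_real_mult of_real_add)
        ultimately show ?thesis by simp
      qed
      then show ?thesis using False by (simp add: not_le)
    qed
  qed
  also have "\<dots> = ennreal (2 * K * \<epsilon> / cmod \<alpha>) *
      (\<integral>\<^sup>+y. indicator {y. cmod (of_real c * complex_of_real y + of_real c') \<le> \<epsilon>} y \<partial>\<xi>)"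
    by (rule nn_integral_cmult) measurable
  also have "\<dots> \<le> ennreal (2 * K * \<epsilon> / cmod \<alpha>) * ennreal (2 * K * \<epsilon> / cmod (of_real c))"
    using c \<epsilon> by (intro mult_left_mono nn_integral_le_interval) auto
  also have "\<dots> = ennreal (2 * K * \<epsilon> / cmod \<alpha> * (2 * K * \<epsilon> / \<bar>c\<bar>))"
    using K_pos \<epsilon> by (subst ennreal_mult) auto
  also have "2 * K * \<epsilon> / cmod \<alpha> * (2 * K * \<epsilon> / \<bar>c\<bar>) = 4 * K\<^sup>2 * \<epsilon>\<^sup>2 / \<bar>Im (\<alpha> * cnj \<beta>)\<bar>"
  proof -
    have "\<bar>c\<bar> = \<bar>Im (\<alpha> * cnj \<beta>)\<bar> / cmod \<alpha>"
      by (simp only: c_def sw abs_divide abs_minus_cancel abs_norm_cancel)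
    moreover have "2 * K * \<epsilon> / a * (2 * K * \<epsilon> / (b / a)) = 4 * K\<^sup>2 * \<epsilon>\<^sup>2 / b" if "a > 0" "b > 0" for a b
      using that by (simp add: power2_eq_square)
    moreover have "cmod \<alpha> > 0" "\<bar>Im (\<alpha> * cnj \<beta>)\<bar> > 0" using \<alpha> ab by simp_all
    ultimately show ?thesis by metis
  qed
  finally show ?thesis .
qed

end

lemma exists_ge_average:
  fixes f :: "'a \<Rightarrow> real"
  assumes "finite A" "A \<noteq> {}" "c \<le> sum f A"
  shows "\<exists>a\<in>A. c / real (card A) \<le> f a"
proof (rule ccontr)
  assume "\<not> ?thesis"
  then have "\<And>a. a \<in> A \<Longrightarrow> f a < c / real (card A)" by (auto simp: not_le)
  then have "sum f A < (\<Sum>a\<in>A. c / real (card A))" using assms(1,2) by (intro sum_strict_mono)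
  then show False using assms by simp
qed

lemma perturbed_row_sum_fun_upd:
  assumes "k < n"
  shows "(\<Sum>q<n. perturbed D (fun_upd \<omega> (j, k) x) j q * g q)
    = g k * complex_of_real x + (\<Sum>q<n. (if q = k then D j k else perturbed D \<omega> j q) * g q)"
proof -
  have "(\<Sum>q<n. perturbed D (fun_upd \<omega> (j, k) x) j q * g q)
    = (\<Sum>q<n. (if q = k then g k * complex_of_real x else 0) + (if q = k then D j k else perturbed D \<omega> j q) * g q)"
    by (intro sum.cong refl) (auto simp: perturbed_def algebra_simps)
  then show ?thesis using assms by (simp add: sum.distrib)
qed

lemma measurable_indicator_skew_event:
  fixes f :: "'a \<Rightarrow> complex" and a c d :: "'a \<Rightarrow> real" and w b t :: real
  assumes [measurable]: "f \<in> borel_measurable M" "a \<in> borel_measurable M"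
      "c \<in> borel_measurable M" "d \<in> borel_measurable M"
  shows "indicator {x. f x \<noteq> 0 \<and> w \<le> a x \<and> b \<le> c x \<and> t * (c x)\<^sup>2 \<le> d x}
      \<in> (borel_measurable M :: ('a \<Rightarrow> ennreal) set)"
proof -
  have [measurable]: "Measurable.pred M (\<lambda>x. f x \<noteq> 0)"
    "Measurable.pred M (\<lambda>x. w \<le> a x)" "Measurable.pred M (\<lambda>x. b \<le> c x)"
    "Measurable.pred M (\<lambda>x. t * (c x)\<^sup>2 \<le> d x)"
    by measurable
  show ?thesis by measurable
qed

lemma measurable_sq_norm:
  assumes "\<And>k. k < n \<Longrightarrow> (\<lambda>x. u x k) \<in> borel_measurable M"
  shows "(\<lambda>x. sq_norm n (u x)) \<in> borel_measurable M"
  unfolding sq_norm_def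
  by (intro borel_measurable_sum borel_measurable_power measurable_compose[OF _ borel_measurable_norm] assms) auto

lemma measurable_wedge_sq:
  assumes "\<And>k. k < n \<Longrightarrow> (\<lambda>x. u x k) \<in> borel_measurable M"
    and "\<And>k. k < n \<Longrightarrow> (\<lambda>x. v x k) \<in> borel_measurable M"
  shows "(\<lambda>x. wedge_sq n (u x) (v x)) \<in> borel_measurable M"
  unfolding wedge_sq_def
  by (intro borel_measurable_sum borel_measurable_power measurable_compose[OF _ borel_measurable_norm] borel_measurable_diff
      borel_measurable_times assms) auto

text \<open>The column index comes first, so that a column is a partial application.\<close>
definition inverse_column ::
    "nat \<Rightarrow> (nat \<Rightarrow> nat \<Rightarrow> complex) \<Rightarrow> (nat \<times> nat \<Rightarrow> real) \<Rightarrow> nat \<Rightarrow> nat \<Rightarrow> complex" where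
  "inverse_column n D \<omega> j k = fun_inverse n (perturbed D \<omega>) k j"

context bounded_density
begin

lemma measurable_row_sum:
  assumes "j < n"
  shows "(\<lambda>\<omega>. \<Sum>q<n. perturbed D \<omega> j q * g q) \<in> borel_measurable (iid ({..<n} \<times> {..<n}))"
  using assms by (intro borel_measurable_sum borel_measurable_times measurable_const measurable_perturbed) auto

text \<open>The real and imaginary parts of \<open>g\<close> span an area of order \<open>\<kappa>\<close>, so one of the \<open>n\<^sup>2\<close> coordinate planes sees at
  least the fraction \<open>1/n\<close> of it. The two entries of the row in that plane suffice.\<close>
lemma prob_row_small_le:
  assumes j: "j < n" and \<kappa>: "\<kappa> > 0" and e: "e \<ge> 0"
    and g: "\<kappa>\<^sup>2 \<le> wedge_sq n g (\<lambda>k. cnj (g k))"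
  shows "(\<integral>\<^sup>+\<omega>. indicator {\<omega>. (cmod (\<Sum>q<n. perturbed D \<omega> j q * g q))\<^sup>2 \<le> e} \<omega> \<partial>iid ({..<n} \<times> {..<n}))
    \<le> ennreal (8 * real n * K\<^sup>2 * e / \<kappa>)"
proof -
  let ?S = "{..<n} \<times> {..<n}"
  have n: "n > 0" using j by simp
  have avg: "\<kappa>\<^sup>2 \<le> (\<Sum>(k, l)\<in>?S. (cmod (g k * cnj (g l) - g l * cnj (g k)))\<^sup>2)"
    using g by (simp add: wedge_sq_def sum.cartesian_product)
  obtain p where p: "p \<in> ?S" "\<kappa>\<^sup>2 / real (card ?S)
      \<le> (case p of (k, l) \<Rightarrow> (cmod (g k * cnj (g l) - g l * cnj (g k)))\<^sup>2)"
    using exists_ge_average[OF _ _ avg] n by auto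
  obtain k l where kl: "k < n" "l < n" and kl2: "(\<kappa> / n)\<^sup>2 \<le> (cmod (g k * cnj (g l) - g l * cnj (g k)))\<^sup>2"
    using p by (cases p) (auto simp: power_divide power2_eq_square)
  define I where "I = \<bar>Im (g k * cnj (g l))\<bar>"
  have "g k * cnj (g l) - g l * cnj (g k) = g k * cnj (g l) - cnj (g k * cnj (g l))"
    by (simp add: mult.commute)
  also have "\<dots> = complex_of_real (2 * Im (g k * cnj (g l))) * \<i>" by (rule complex_diff_cnj)
  finally have "cmod (g k * cnj (g l) - g l * cnj (g k)) = 2 * I"
    by (simp only: norm_mult norm_of_real I_def norm_ii abs_mult)
  moreover have "\<kappa> / n \<le> cmod (g k * cnj (g l) - g l * cnj (g k))"
    using kl2 by (rule power2_le_imp_le) simp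
  ultimately have I: "\<kappa> / n \<le> 2 * I" by simp
  then have I_pos: "I > 0" using \<kappa> n by (smt (verit) divide_pos_pos of_nat_0_less_iff)
  then have neq: "k \<noteq> l" by (auto simp: I_def)
  define F :: "_ \<Rightarrow> ennreal" where "F = indicator {\<omega>. (cmod (\<Sum>q<n. perturbed D \<omega> j q * g q))\<^sup>2 \<le> e}"
  have [measurable]: "(\<lambda>\<omega>. \<Sum>q<n. perturbed D \<omega> j q * g q) \<in> borel_measurable (iid ?S)"
    using j by (rule measurable_row_sum)
  have F: "F \<in> borel_measurable (iid ?S)" unfolding F_def by measurable
  have "(\<integral>\<^sup>+\<omega>. F \<omega> \<partial>iid ?S)
      = (\<integral>\<^sup>+\<omega>. \<integral>\<^sup>+y. \<integral>\<^sup>+x. F (fun_upd (fun_upd \<omega> (j, l) y) (j, k) x) \<partial>\<xi> \<partial>\<xi> \<partial>iid ?S)"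
    using j kl by (intro nn_integral_resample2 F) auto
  also have "\<dots> \<le> (\<integral>\<^sup>+\<omega>. ennreal (8 * real n * K\<^sup>2 * e / \<kappa>) \<partial>iid ?S)"
  proof (rule nn_integral_mono)
    fix \<omega>
    define \<gamma> where "\<gamma> = (\<Sum>q<n. (if q = k then D j k else if q = l then D j l else perturbed D \<omega> j q) * g q)"
    have sum_eq: "(\<Sum>q<n. perturbed D (fun_upd (fun_upd \<omega> (j, l) y) (j, k) x) j q * g q)
        = g k * complex_of_real x + g l * complex_of_real y + \<gamma>" for x y
    proof -
      have "(\<Sum>q<n. (if q = k then D j k else perturbed D (fun_upd \<omega> (j, l) y) j q) * g q)
          = (\<Sum>q<n. (if q = l then g l * complex_of_real y else 0) +
              (if q = k then D j k else if q = l then D j l else perturbed D \<omega> j q) * g q)"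
        using neq by (intro sum.cong refl) (auto simp: perturbed_def algebra_simps)
      also have "\<dots> = g l * complex_of_real y + \<gamma>" using kl by (simp add: sum.distrib \<gamma>_def)
      finally show ?thesis unfolding perturbed_row_sum_fun_upd[OF kl(1)] by simp
    qed
    have "F (fun_upd (fun_upd \<omega> (j, l) y) (j, k) x)
        = indicator {r. r \<le> sqrt e} (cmod (g k * complex_of_real x + g l * complex_of_real y + \<gamma>))" for x y
    proof -
      have "r\<^sup>2 \<le> e \<longleftrightarrow> r \<le> sqrt e" if "r \<ge> 0" for r
        using that e by (metis real_le_rsqrt real_sqrt_le_iff real_sqrt_abs abs_of_nonneg)
      then show ?thesis by (simp add: F_def sum_eq indicator_def)
    qed
    then have "(\<integral>\<^sup>+y. \<integral>\<^sup>+x. F (fun_upd (fun_upd \<omega> (j, l) y) (j, k) x) \<partial>\<xi> \<partial>\<xi>)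
       = (\<integral>\<^sup>+y. \<integral>\<^sup>+x. indicator {r. r \<le> sqrt e} (cmod (g k * complex_of_real x + g l * complex_of_real y + \<gamma>)) \<partial>\<xi> \<partial>\<xi>)"
      by simp
    also have "\<dots> \<le> ennreal (4 * K\<^sup>2 * (sqrt e)\<^sup>2 / \<bar>Im (g k * cnj (g l))\<bar>)"
      using I_pos e by (intro nn_integral_two_constraints_le) (auto simp: I_def)
    also have "\<dots> \<le> ennreal (8 * real n * K\<^sup>2 * e / \<kappa>)"
    proof (rule ennreal_leI)
      have "1 / I \<le> 2 * n / \<kappa>" using I I_pos \<kappa> n by (simp add: field_simps)
      then have "4 * K\<^sup>2 * e * (1 / I) \<le> 4 * K\<^sup>2 * e * (2 * n / \<kappa>)"
        using e by (intro mult_left_mono) auto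
      then show "4 * K\<^sup>2 * (sqrt e)\<^sup>2 / \<bar>Im (g k * cnj (g l))\<bar> \<le> 8 * real n * K\<^sup>2 * e / \<kappa>"
        using e by (simp add: I_def mult_ac)
    qed
    finally show "(\<integral>\<^sup>+y. \<integral>\<^sup>+x. F (fun_upd (fun_upd \<omega> (j, l) y) (j, k) x) \<partial>\<xi> \<partial>\<xi>) \<le> \<dots>" .
  qed
  finally show ?thesis by (simp only: nn_integral_iid_const F_def)
qed

text \<open>Some coordinate of the unit vector \<open>\<phi>\<close> has modulus at least \<open>1 / sqrt n\<close>; integrating over the matching
  entry of the row leaves a Cauchy density.\<close>
lemma expectation_row_weight_le:
  assumes i: "i < n" and w: "w > 0" and \<phi>: "sq_norm n \<phi> = 1"
  shows "(\<integral>\<^sup>+\<omega>. ennreal (8 / (sqrt w + w * (cmod (\<Sum>q<n. perturbed D \<omega> i q * \<phi> q))\<^sup>2)) \<partial>iid ({..<n} \<times> {..<n}))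
    \<le> ennreal (32 * K * sqrt n * w powr - (3/4))"
proof -
  let ?S = "{..<n} \<times> {..<n}"
  have n: "n > 0" using i by simp
  obtain p where p: "p < n" "1 / real n \<le> (cmod (\<phi> p))\<^sup>2"
    using exists_ge_average[of "{..<n}" 1 "\<lambda>k. (cmod (\<phi> k))\<^sup>2"] \<phi> n by (auto simp: sq_norm_def)
  have \<phi>p: "\<phi> p \<noteq> 0" using p n by (auto simp: divide_le_0_iff)
  define F where "F \<omega> = ennreal (8 / (sqrt w + w * (cmod (\<Sum>q<n. perturbed D \<omega> i q * \<phi> q))\<^sup>2))" for \<omega>
  have [measurable]: "(\<lambda>\<omega>. \<Sum>q<n. perturbed D \<omega> i q * \<phi> q) \<in> borel_measurable (iid ?S)"
    using i by (rule measurable_row_sum)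
  have F: "F \<in> borel_measurable (iid ?S)" unfolding F_def by measurable
  define c where "c = sqrt w / n"
  have c: "c > 0" using w n by (simp add: c_def)
  have "(\<integral>\<^sup>+\<omega>. F \<omega> \<partial>iid ?S) = (\<integral>\<^sup>+\<omega>. \<integral>\<^sup>+x. F (fun_upd \<omega> (i, p) x) \<partial>\<xi> \<partial>iid ?S)"
    using i p by (intro nn_integral_resample_coord F) auto
  also have "\<dots> \<le> (\<integral>\<^sup>+\<omega>. ennreal (32 * K * sqrt n * w powr - (3/4)) \<partial>iid ?S)"
  proof (rule nn_integral_mono)
    fix \<omega>
    define \<gamma> where "\<gamma> = (\<Sum>q<n. (if q = p then D i p else perturbed D \<omega> i q) * \<phi> q)"
    define b where "b = Re (\<gamma> / \<phi> p)"
    have "F (fun_upd \<omega> (i, p) x) \<le> ennreal (8 / sqrt w) * ennreal (1 / (1 + c * (x + b)\<^sup>2))" for x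
    proof -
      define v where "v = \<phi> p * complex_of_real x + \<gamma>"
      have "v = \<phi> p * (complex_of_real x + \<gamma> / \<phi> p)" using \<phi>p by (simp add: v_def field_simps)
      then have "(cmod v)\<^sup>2 = (cmod (\<phi> p))\<^sup>2 * (cmod (complex_of_real x + \<gamma> / \<phi> p))\<^sup>2"
        by (simp only: norm_mult power_mult_distrib)
      moreover have "(x + b)\<^sup>2 \<le> (cmod (complex_of_real x + \<gamma> / \<phi> p))\<^sup>2"
        using power_mono[OF abs_Re_le_cmod[of "complex_of_real x + \<gamma> / \<phi> p"], of 2] by (simp add: b_def)
      ultimately have v: "1 / real n * (x + b)\<^sup>2 \<le> (cmod v)\<^sup>2"
        using p by (simp only:) (intro mult_mono, auto)
      have "8 / (sqrt w + w * (cmod v)\<^sup>2) \<le> 8 / (sqrt w + w * (1 / real n * (x + b)\<^sup>2))"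
        using w v n by (intro divide_left_mono add_left_mono mult_left_mono mult_pos_pos add_pos_nonneg) auto
      also have "w = sqrt w * sqrt w" using w by simp
      then have "sqrt w + w * (1 / real n * (x + b)\<^sup>2) = sqrt w * (1 + c * (x + b)\<^sup>2)"
        by (simp only: c_def) (simp add: algebra_simps)
      also have "8 / (sqrt w * (1 + c * (x + b)\<^sup>2)) = 8 / sqrt w * (1 / (1 + c * (x + b)\<^sup>2))"
        by simp
      finally have "8 / (sqrt w + w * (cmod v)\<^sup>2) \<le> 8 / sqrt w * (1 / (1 + c * (x + b)\<^sup>2))" .
      then have "ennreal (8 / (sqrt w + w * (cmod v)\<^sup>2)) \<le> ennreal (8 / sqrt w * (1 / (1 + c * (x + b)\<^sup>2)))"
        by (rule ennreal_leI)
      also have "\<dots> = ennreal (8 / sqrt w) * ennreal (1 / (1 + c * (x + b)\<^sup>2))"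
        using w c by (intro ennreal_mult) auto
      finally show ?thesis
        unfolding F_def perturbed_row_sum_fun_upd[OF p(1)] v_def \<gamma>_def .
    qed
    then have "(\<integral>\<^sup>+x. F (fun_upd \<omega> (i, p) x) \<partial>\<xi>)
        \<le> (\<integral>\<^sup>+x. ennreal (8 / sqrt w) * ennreal (1 / (1 + c * (x + b)\<^sup>2)) \<partial>\<xi>)"
      by (intro nn_integral_mono)
    also have "\<dots> \<le> ennreal K * (\<integral>\<^sup>+x. ennreal (8 / sqrt w) * ennreal (1 / (1 + c * (x + b)\<^sup>2)) \<partial>lborel)"
      by (rule nn_integral_law_le) measurable
    also have "\<dots> = ennreal K * (ennreal (8 / sqrt w) * (\<integral>\<^sup>+x. ennreal (1 / (1 + c * (x + b)\<^sup>2)) \<partial>lborel))"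
      by (subst nn_integral_cmult) auto
    also have "\<dots> \<le> ennreal K * (ennreal (8 / sqrt w) * ennreal (4 / sqrt c))"
      by (intro mult_left_mono nn_integral_Cauchy_density_le c) auto
    also have "\<dots> = ennreal (K * (8 / sqrt w * (4 / sqrt c)))"
      using K_pos w c by (simp add: ennreal_mult[symmetric] mult_ac)
    also have "K * (8 / sqrt w * (4 / sqrt c)) = 32 * K * sqrt n * w powr - (3/4)"
    proof -
      have c_eq: "sqrt c = w powr (1/4) / sqrt n"
        using w by (simp add: c_def real_sqrt_divide powr_half_sqrt[symmetric] powr_powr)
      have w_eq: "1 / (sqrt w * w powr (1/4)) = w powr - (3/4)"
        using w by (simp add: powr_half_sqrt[symmetric] powr_add[symmetric] powr_minus_divide)
      have "K * (8 / sqrt w * (4 / sqrt c)) = 32 * K * sqrt n * (1 / (sqrt w * w powr (1/4)))"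
        by (simp add: c_eq)
      then show ?thesis by (simp only: w_eq)
    qed
    finally show "(\<integral>\<^sup>+x. F (fun_upd \<omega> (i, p) x) \<partial>\<xi>) \<le> ennreal (32 * K * sqrt n * w powr - (3/4))" .
  qed
  finally show ?thesis by (simp only: nn_integral_iid_const F_def)
qed

lemma measurable_mix:
  assumes "\<omega> \<in> space (iid I)"
  shows "(\<lambda>\<eta> a. if a \<in> J then \<eta> a else \<omega> a) \<in> iid I \<rightarrow>\<^sub>M iid I"
proof (rule measurable_PiM_single')
  show "(\<lambda>\<eta>. if b \<in> J then \<eta> b else \<omega> b) \<in> iid I \<rightarrow>\<^sub>M \<xi>" if "b \<in> I" for b
    using that by (cases "b \<in> J") auto
qed (use assms in \<open>auto simp: space_PiM PiE_def extensional_def\<close>)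

section \<open>Wedges of skew columns\<close>

text \<open>Compared with a bare large minor, one more real constraint is gained when column \<open>j\<close> is long and skew,
  that is, far from the multiples of real vectors; this turns the exponent \<open>1/2\<close> into \<open>3/4\<close>. All rows
  except \<open>i\<close> and \<open>j\<close> are fixed. The length of column \<open>j\<close> is \<open>1 / |r\<^sub>j \<cdot> g|\<close> for the unit direction \<open>g\<close> of that
  column, and it is bounded below both by a power of \<open>w\<close> and in terms of \<open>|r\<^sub>i \<cdot> \<phi>|\<close>. Row \<open>j\<close> thus obeys two
  real constraints at a scale set by row \<open>i\<close>, and averaging over row \<open>i\<close> contributes the third factor \<open>K\<close>.
  Choosing coordinates after conditioning, instead of summing over all choices, keeps the power of \<open>n\<close>
  at \<open>3/2\<close>.\<close>
lemma prob_skew_wedge_ge: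
  fixes D :: "nat \<Rightarrow> nat \<Rightarrow> complex" and w \<kappa> :: real
  assumes ij: "i < n" "j < n" "i \<noteq> j" and w: "w > 0" and \<kappa>: "\<kappa> > 0"
  defines "h \<equiv> inverse_column n D"
  shows "(\<integral>\<^sup>+\<omega>. indicator {\<omega>. fun_det n (perturbed D \<omega>) \<noteq> 0 \<and>
        w \<le> wedge_sq n (h \<omega> i) (h \<omega> j) \<and> sqrt w / 2 \<le> sq_norm n (h \<omega> j) \<and>
        \<kappa>\<^sup>2 * (sq_norm n (h \<omega> j))\<^sup>2 \<le> wedge_sq n (h \<omega> j) (\<lambda>k. cnj (h \<omega> j k))} \<omega> \<partial>iid ({..<n} \<times> {..<n}))
      \<le> ennreal (256 * real n * sqrt n * K ^ 3 / \<kappa> * w powr - (3/4))"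
proof -
  let ?S = "{..<n} \<times> {..<n}"
  define E where "E = {\<omega>. fun_det n (perturbed D \<omega>) \<noteq> 0 \<and>
        w \<le> wedge_sq n (h \<omega> i) (h \<omega> j) \<and> sqrt w / 2 \<le> sq_norm n (h \<omega> j) \<and>
        \<kappa>\<^sup>2 * (sq_norm n (h \<omega> j))\<^sup>2 \<le> wedge_sq n (h \<omega> j) (\<lambda>k. cnj (h \<omega> j k))}"
  define F :: "_ \<Rightarrow> ennreal" where "F = indicator E"
  have inv: "mutually_inverse n (perturbed D \<omega>) (\<lambda>k j. h \<omega> j k)" if "\<omega> \<in> E" for \<omega>
    using that mutually_inverse_fun_inverse[of n "perturbed D \<omega>"] by (simp add: E_def mutually_inverse_def h_def inverse_column_def)
  have h: "(\<lambda>\<omega>. h \<omega> q p) \<in> borel_measurable (iid ?S)" if "p < n" "q < n" for p q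
    unfolding h_def inverse_column_def using that by (intro measurable_fun_inverse_perturbed)
  have cnj_h: "(\<lambda>\<omega>. cnj (h \<omega> q p)) \<in> borel_measurable (iid ?S)" if "p < n" "q < n" for p q
    by (rule measurable_compose[OF h[OF that]]) (intro borel_measurable_continuous_onI continuous_intros)
  have meas: "(\<lambda>\<omega>. fun_det n (perturbed D \<omega>)) \<in> borel_measurable (iid ?S)"
    "(\<lambda>\<omega>. wedge_sq n (h \<omega> i) (h \<omega> j)) \<in> borel_measurable (iid ?S)"
    "(\<lambda>\<omega>. sq_norm n (h \<omega> j)) \<in> borel_measurable (iid ?S)"
    "(\<lambda>\<omega>. wedge_sq n (h \<omega> j) (\<lambda>k. cnj (h \<omega> j k))) \<in> borel_measurable (iid ?S)"
    using ij h cnj_h by (intro measurable_fun_det_perturbed measurable_wedge_sq measurable_sq_norm; simp)+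
  have F: "F \<in> borel_measurable (iid ?S)"
    unfolding F_def E_def using meas by (intro measurable_indicator_skew_event)
  define mix where "mix J \<omega> \<eta> = (\<lambda>a. if a \<in> J then \<eta> a else \<omega> a)"
    for J and \<omega> \<eta> :: "nat \<times> nat \<Rightarrow> real"
  define J where "J = {i, j} \<times> {..<n}"
  define R where "R = {j} \<times> {..<n}"
  have J: "J \<subseteq> ?S" "R \<subseteq> ?S" using ij by (auto simp: J_def R_def)
  define C where "C = 8 * real n * K\<^sup>2 / \<kappa>"
  have C: "C \<ge> 0" using \<kappa> by (simp add: C_def)
  have "(\<integral>\<^sup>+\<omega>. F \<omega> \<partial>iid ?S) = (\<integral>\<^sup>+\<omega>. \<integral>\<^sup>+\<eta>. F (mix J \<omega> \<eta>) \<partial>iid ?S \<partial>iid ?S)"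
    unfolding mix_def using J by (intro nn_integral_resample F) auto
  also have "\<dots> \<le> (\<integral>\<^sup>+\<omega>. ennreal (C * (32 * K * sqrt n * w powr - (3/4))) \<partial>iid ?S)"
  proof (rule nn_integral_mono)
    fix \<omega> assume \<omega>: "\<omega> \<in> space (iid ?S)"
    have F1: "(\<lambda>\<eta>. F (mix J \<omega> \<eta>)) \<in> borel_measurable (iid ?S)"
      unfolding mix_def by (rule measurable_compose[OF measurable_mix[OF \<omega>] F])
    show "(\<integral>\<^sup>+\<eta>. F (mix J \<omega> \<eta>) \<partial>iid ?S) \<le> ennreal (C * (32 * K * sqrt n * w powr - (3/4)))"
    proof (cases "\<exists>\<eta>. mix J \<omega> \<eta> \<in> E")
      case False
      then show ?thesis by (simp add: F_def)
    next
      case True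
      then obtain \<eta>0 where \<eta>0: "mix J \<omega> \<eta>0 \<in> E" by auto
      define N where "N = sq_norm n (h (mix J \<omega> \<eta>0) i)"
      have N: "N > 0"
      proof (rule ccontr)
        assume "\<not> N > 0"
        then have "N = 0" using sq_norm_nonneg[of n] by (simp add: N_def not_less antisym)
        then have "wedge_sq n (h (mix J \<omega> \<eta>0) i) (h (mix J \<omega> \<eta>0) j) \<le> 0"
          using wedge_sq_le[of n "h (mix J \<omega> \<eta>0) i" "h (mix J \<omega> \<eta>0) j"] by (simp add: N_def)
        then show False using \<eta>0 w by (simp add: E_def)
      qed
      \<comment> \<open>Column \<open>i\<close> of any one invertible sample is annihilated by all rows other than \<open>i\<close>, hence by
          all the rows that stay fixed.\<close>
      define \<phi> where "\<phi> k = complex_of_real (1 / sqrt N) * h (mix J \<omega> \<eta>0) i k" for k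
      have \<phi>: "sq_norm n \<phi> = 1"
        unfolding \<phi>_def sq_norm_scale N_def[symmetric] using N by (simp add: power_divide norm_divide)
      have ker: "(\<Sum>q<n. perturbed D (mix J \<omega> \<eta>) a q * \<phi> q) = 0" if "a < n" "a \<noteq> i" "a \<noteq> j" for a \<eta>
      proof -
        have "(\<Sum>q<n. perturbed D (mix J \<omega> \<eta>) a q * \<phi> q)
            = (\<Sum>q<n. perturbed D (mix J \<omega> \<eta>0) a q * (complex_of_real (1 / sqrt N) * h (mix J \<omega> \<eta>0) i q))"
          using that by (intro sum.cong) (auto simp: perturbed_def mix_def J_def \<phi>_def)
        also have "\<dots> = complex_of_real (1 / sqrt N) * (\<Sum>q<n. perturbed D (mix J \<omega> \<eta>0) a q * h (mix J \<omega> \<eta>0) i q)"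
          by (simp add: sum_distrib_left mult_ac)
        also have "\<dots> = 0" using inv[OF \<eta>0] that ij by (simp add: mutually_inverse_def)
        finally show ?thesis .
      qed
      define \<tau> where "\<tau> \<eta> = (cmod (\<Sum>q<n. perturbed D \<eta> i q * \<phi> q))\<^sup>2" for \<eta>
      define e where "e \<eta> = 8 / (sqrt w + w * \<tau> \<eta>)" for \<eta>
      have den: "sqrt w + w * \<tau> \<eta> > 0" for \<eta>
        using w by (intro add_pos_nonneg) (auto simp: \<tau>_def)
      have e: "e \<eta> \<ge> 0" for \<eta> using den[of \<eta>] by (simp add: e_def)
      have "(\<integral>\<^sup>+\<eta>. F (mix J \<omega> \<eta>) \<partial>iid ?S) = (\<integral>\<^sup>+\<eta>. \<integral>\<^sup>+\<zeta>. F (mix J \<omega> (mix R \<eta> \<zeta>)) \<partial>iid ?S \<partial>iid ?S)"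
        using nn_integral_resample[OF _ J(2) F1] by (simp add: mix_def)
      also have "\<dots> \<le> (\<integral>\<^sup>+\<eta>. ennreal C * ennreal (e \<eta>) \<partial>iid ?S)"
      proof (rule nn_integral_mono)
        fix \<eta>
        let ?\<omega> = "\<lambda>\<zeta>. mix J \<omega> (mix R \<eta> \<zeta>)"
        show "(\<integral>\<^sup>+\<zeta>. F (?\<omega> \<zeta>) \<partial>iid ?S) \<le> ennreal C * ennreal (e \<eta>)"
        proof (cases "\<exists>\<zeta>. ?\<omega> \<zeta> \<in> E")
          case False
          then show ?thesis by (simp add: F_def)
        next
          case True
          then obtain \<zeta>0 where \<zeta>0: "?\<omega> \<zeta>0 \<in> E" by auto
          define N0 where "N0 = sq_norm n (h (?\<omega> \<zeta>0) j)"
          have "sqrt w / 2 \<le> N0" using \<zeta>0 by (simp add: E_def N0_def)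
          then have N0: "N0 > 0" using w by (smt (verit) half_gt_zero real_sqrt_gt_zero)
          \<comment> \<open>The direction of column \<open>j\<close> is determined by the rows other than \<open>j\<close>.\<close>
          define g where "g k = complex_of_real (1 / sqrt N0) * h (?\<omega> \<zeta>0) j k" for k
          have g1: "sq_norm n g = 1"
            unfolding g_def sq_norm_scale N0_def[symmetric] using N0 by (simp add: power_divide norm_divide)
          have "wedge_sq n g (\<lambda>k. cnj (g k)) = wedge_sq n (\<lambda>k. complex_of_real (1 / sqrt N0) * h (?\<omega> \<zeta>0) j k)
              (\<lambda>k. complex_of_real (1 / sqrt N0) * cnj (h (?\<omega> \<zeta>0) j k))"
            unfolding g_def by simp
          also have "\<dots> = wedge_sq n (h (?\<omega> \<zeta>0) j) (\<lambda>k. cnj (h (?\<omega> \<zeta>0) j k)) / N0\<^sup>2"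
            unfolding wedge_sq_scale using N0 by (simp add: power_divide norm_divide power2_eq_square)
          also have "\<dots> \<ge> \<kappa>\<^sup>2"
            using \<zeta>0 N0 by (simp add: E_def N0_def[symmetric] pos_le_divide_eq)
          finally have g2: "\<kappa>\<^sup>2 \<le> wedge_sq n g (\<lambda>k. cnj (g k))" .
          have "F (?\<omega> \<zeta>) \<le> indicator {\<zeta>. (cmod (\<Sum>q<n. perturbed D \<zeta> j q * g q))\<^sup>2 \<le> e \<eta>} \<zeta>" for \<zeta>
          proof (cases "?\<omega> \<zeta> \<in> E")
            case True
            define s where "s = (\<Sum>q<n. perturbed D \<zeta> j q * g q)"
            define M where "M = sq_norm n (h (?\<omega> \<zeta>) j)"
            have s_eq: "complex_of_real (1 / sqrt N0) * (\<Sum>q<n. perturbed D (?\<omega> \<zeta>) j q * h (?\<omega> \<zeta>0) j q) = s"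
              unfolding s_def g_def sum_distrib_left
              by (intro sum.cong refl) (auto simp: perturbed_def mix_def J_def R_def)
            have "h (?\<omega> \<zeta>) j p * s = g p" if "p < n" for p
            proof -
              have "h (?\<omega> \<zeta>) j p * (\<Sum>q<n. perturbed D (?\<omega> \<zeta>) j q * h (?\<omega> \<zeta>0) j q) = h (?\<omega> \<zeta>0) j p"
                using ij that
                by (intro inverse_column_change_row[OF inv[OF \<zeta>0] inv[OF True]])
                   (auto simp: perturbed_def mix_def J_def R_def)
              then show ?thesis unfolding s_eq[symmetric] g_def by (simp add: mult_ac)
            qed
            then have "sq_norm n (\<lambda>p. s * h (?\<omega> \<zeta>) j p) = 1"
              using g1 sq_norm_cong[of n "\<lambda>p. s * h (?\<omega> \<zeta>) j p" g] by (simp add: mult.commute)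
            then have sM: "(cmod s)\<^sup>2 * M = 1" by (simp add: sq_norm_scale M_def)
            \<comment> \<open>\<open>\<phi> \<and> h\<^sub>j = (r\<^sub>i \<cdot> \<phi>) h\<^sub>i \<and> h\<^sub>j\<close>: a large wedge forces a long column \<open>j\<close> unless \<open>r\<^sub>i \<cdot> \<phi>\<close> is small.\<close>
            have "\<tau> \<eta> * w \<le> \<tau> \<eta> * wedge_sq n (h (?\<omega> \<zeta>) i) (h (?\<omega> \<zeta>) j)"
              using True by (intro mult_left_mono) (auto simp: E_def \<tau>_def)
            also have "\<dots> = wedge_sq n \<phi> (h (?\<omega> \<zeta>) j)"
            proof -
              have "(\<Sum>q<n. perturbed D (?\<omega> \<zeta>) i q * \<phi> q) = (\<Sum>q<n. perturbed D \<eta> i q * \<phi> q)"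
                using ij by (intro sum.cong) (auto simp: perturbed_def mix_def J_def R_def)
              then show ?thesis
                using wedge_sq_two_columns[OF inv[OF True] ij ker] by (simp add: \<tau>_def)
            qed
            also have "\<dots> \<le> 4 * M" using wedge_sq_le[of n \<phi>] by (simp add: \<phi> M_def)
            finally have 1: "\<tau> \<eta> * w \<le> 4 * M" .
            have 2: "sqrt w / 2 \<le> M" using True by (simp add: E_def M_def)
            have "(sqrt w + w * \<tau> \<eta>) / 8 \<le> M"
            proof -
              have "0 \<le> M" by (simp add: M_def)
              then show ?thesis using 1 2 by (simp add: mult.commute)
            qed
            then have "(cmod s)\<^sup>2 * ((sqrt w + w * \<tau> \<eta>) / 8) \<le> 1"
              using sM mult_left_mono[of "(sqrt w + w * \<tau> \<eta>) / 8" M "(cmod s)\<^sup>2"] by simp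
            then have "(cmod s)\<^sup>2 \<le> e \<eta>" using den[of \<eta>] by (simp add: e_def field_simps)
            then show ?thesis using True by (simp add: F_def s_def)
          qed (simp add: F_def)
          then have "(\<integral>\<^sup>+\<zeta>. F (?\<omega> \<zeta>) \<partial>iid ?S)
              \<le> (\<integral>\<^sup>+\<zeta>. indicator {\<zeta>. (cmod (\<Sum>q<n. perturbed D \<zeta> j q * g q))\<^sup>2 \<le> e \<eta>} \<zeta> \<partial>iid ?S)"
            by (intro nn_integral_mono)
          also have "\<dots> \<le> ennreal (8 * real n * K\<^sup>2 * e \<eta> / \<kappa>)"
            using ij \<kappa> e g2 by (intro prob_row_small_le) auto
          also have "\<dots> = ennreal C * ennreal (e \<eta>)"
            using C e by (simp add: C_def flip: ennreal_mult)
          finally show ?thesis .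
        qed
      qed
      also have "\<dots> = ennreal C * (\<integral>\<^sup>+\<eta>. ennreal (e \<eta>) \<partial>iid ?S)"
      proof (rule nn_integral_cmult)
        have [measurable]: "(\<lambda>\<omega>. \<Sum>q<n. perturbed D \<omega> i q * \<phi> q) \<in> borel_measurable (iid ?S)"
          using ij by (intro measurable_row_sum)
        show "(\<lambda>\<eta>. ennreal (e \<eta>)) \<in> borel_measurable (iid ?S)"
          unfolding e_def \<tau>_def by measurable
      qed
      also have "\<dots> \<le> ennreal C * ennreal (32 * K * sqrt n * w powr - (3/4))"
        unfolding e_def \<tau>_def using ij w \<phi> by (intro mult_left_mono expectation_row_weight_le) auto
      also have "\<dots> = ennreal (C * (32 * K * sqrt n * w powr - (3/4)))"
        using C K_pos by (intro ennreal_mult[symmetric]) auto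
      finally show ?thesis .
    qed
  qed
  also have "\<dots> = ennreal (256 * real n * sqrt n * K ^ 3 / \<kappa> * w powr - (3/4))"
    by (simp only: nn_integral_iid_const) (simp add: C_def power2_eq_square power3_eq_cube mult_ac)
  finally show ?thesis by (simp add: F_def E_def)
qed

end

section \<open>Probability of a large compound inverse\<close>

text \<open>The event that is averaged over the shift: the second compound of the inverse is large, and every
  column of squared length at least \<open>\<theta>\<close> is skew with constant \<open>\<kappa>\<close>. The skewness clause replaces the bound
  on the operator norm by a condition on finitely many rational functions of the entries, which is
  visibly measurable; for \<open>\<kappa> = 0\<close> it is void.\<close>
definition wedge_blowup :: "nat \<Rightarrow> (nat \<Rightarrow> nat \<Rightarrow> complex) \<Rightarrow> real \<Rightarrow> real \<Rightarrow> real \<Rightarrow> bool" where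
  "wedge_blowup n Y \<theta> \<kappa> W \<longleftrightarrow> fun_det n Y \<noteq> 0 \<and>
     (\<forall>j<n. \<theta> \<le> sq_norm n (\<lambda>k. fun_inverse n Y k j) \<longrightarrow>
        \<kappa>\<^sup>2 * (sq_norm n (\<lambda>k. fun_inverse n Y k j))\<^sup>2 \<le> wedge_sq n (\<lambda>k. fun_inverse n Y k j) (\<lambda>k. cnj (fun_inverse n Y k j))) \<and>
     W \<le> (\<Sum>(i, j)\<in>{..<n} \<times> {..<n}. wedge_sq n (\<lambda>k. fun_inverse n Y k i) (\<lambda>k. fun_inverse n Y k j))"

lemma
  assumes Y: "\<And>i j. i < n \<Longrightarrow> j < n \<Longrightarrow> (\<lambda>x. Y x i j) \<in> borel_measurable M"
  shows measurable_wedge_sq_fun_inverse: "i < n \<Longrightarrow> j < n \<Longrightarrow>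
      (\<lambda>x. wedge_sq n (\<lambda>k. fun_inverse n (Y x) k i) (\<lambda>k. fun_inverse n (Y x) k j)) \<in> borel_measurable M"
    and measurable_wedge_sq_cnj_fun_inverse: "j < n \<Longrightarrow>
      (\<lambda>x. wedge_sq n (\<lambda>k. fun_inverse n (Y x) k j) (\<lambda>k. cnj (fun_inverse n (Y x) k j))) \<in> borel_measurable M"
    and measurable_sq_norm_fun_inverse: "j < n \<Longrightarrow> (\<lambda>x. sq_norm n (\<lambda>k. fun_inverse n (Y x) k j)) \<in> borel_measurable M"
proof -
  note f = measurable_fun_inverse[where Y=Y, OF Y]
  have c: "(\<lambda>x. cnj (fun_inverse n (Y x) k j)) \<in> borel_measurable M" if "k < n" "j < n" for k j
    by (rule measurable_compose[OF f[OF _ _ that]])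
      (auto intro!: borel_measurable_continuous_onI continuous_intros)
  show "i < n \<Longrightarrow> j < n \<Longrightarrow>
      (\<lambda>x. wedge_sq n (\<lambda>k. fun_inverse n (Y x) k i) (\<lambda>k. fun_inverse n (Y x) k j)) \<in> borel_measurable M"
    by (intro measurable_wedge_sq f)
  show "j < n \<Longrightarrow> (\<lambda>x. sq_norm n (\<lambda>k. fun_inverse n (Y x) k j)) \<in> borel_measurable M"
    by (intro measurable_sq_norm f)
  show "j < n \<Longrightarrow>
      (\<lambda>x. wedge_sq n (\<lambda>k. fun_inverse n (Y x) k j) (\<lambda>k. cnj (fun_inverse n (Y x) k j))) \<in> borel_measurable M"
    by (intro measurable_wedge_sq f c)
qed

lemma pred_invertible_skew:
  assumes Y: "\<And>i j. i < n \<Longrightarrow> j < n \<Longrightarrow> (\<lambda>x. Y x i j) \<in> borel_measurable M"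
    and [measurable]: "\<theta> \<in> borel_measurable M" "\<kappa> \<in> borel_measurable M"
  shows "Measurable.pred M (\<lambda>x. fun_det n (Y x) \<noteq> 0 \<and> (\<forall>j<n. \<theta> x \<le> sq_norm n (\<lambda>k. fun_inverse n (Y x) k j) \<longrightarrow>
      (\<kappa> x)\<^sup>2 * (sq_norm n (\<lambda>k. fun_inverse n (Y x) k j))\<^sup>2
        \<le> wedge_sq n (\<lambda>k. fun_inverse n (Y x) k j) (\<lambda>k. cnj (fun_inverse n (Y x) k j))))"
proof -
  have d: "Measurable.pred M (\<lambda>x. fun_det n (Y x) \<noteq> 0)"
  proof -
    have [measurable]: "(\<lambda>x. fun_det n (Y x)) \<in> borel_measurable M" by (rule measurable_fun_det[OF Y])
    show ?thesis by measurable
  qed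
  have "Measurable.pred M (\<lambda>x. \<forall>j\<in>{..<n}. \<theta> x \<le> sq_norm n (\<lambda>k. fun_inverse n (Y x) k j) \<longrightarrow>
      (\<kappa> x)\<^sup>2 * (sq_norm n (\<lambda>k. fun_inverse n (Y x) k j))\<^sup>2
        \<le> wedge_sq n (\<lambda>k. fun_inverse n (Y x) k j) (\<lambda>k. cnj (fun_inverse n (Y x) k j)))"
  proof (rule pred_intros_finite(3))
    fix j assume j: "j \<in> {..<n}"
    have [measurable]: "(\<lambda>x. sq_norm n (\<lambda>k. fun_inverse n (Y x) k j)) \<in> borel_measurable M"
      using j by (intro measurable_sq_norm_fun_inverse Y) auto
    have [measurable]: "(\<lambda>x. wedge_sq n (\<lambda>k. fun_inverse n (Y x) k j) (\<lambda>k. cnj (fun_inverse n (Y x) k j))) \<in> borel_measurable M"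
      using j by (intro measurable_wedge_sq_cnj_fun_inverse Y) auto
    show "Measurable.pred M (\<lambda>x. \<theta> x \<le> sq_norm n (\<lambda>k. fun_inverse n (Y x) k j) \<longrightarrow>
      (\<kappa> x)\<^sup>2 * (sq_norm n (\<lambda>k. fun_inverse n (Y x) k j))\<^sup>2
        \<le> wedge_sq n (\<lambda>k. fun_inverse n (Y x) k j) (\<lambda>k. cnj (fun_inverse n (Y x) k j)))"
      by measurable
  qed simp
  then have r: "Measurable.pred M (\<lambda>x. \<forall>j<n. \<theta> x \<le> sq_norm n (\<lambda>k. fun_inverse n (Y x) k j) \<longrightarrow>
      (\<kappa> x)\<^sup>2 * (sq_norm n (\<lambda>k. fun_inverse n (Y x) k j))\<^sup>2
        \<le> wedge_sq n (\<lambda>k. fun_inverse n (Y x) k j) (\<lambda>k. cnj (fun_inverse n (Y x) k j)))"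
    by (simp only: Ball_def lessThan_iff)
  show ?thesis by (rule pred_intros_logic(3)[OF d r])
qed

lemma pred_wedge_blowup:
  assumes Y: "\<And>i j. i < n \<Longrightarrow> j < n \<Longrightarrow> (\<lambda>x. Y x i j) \<in> borel_measurable M"
    and \<theta>: "\<theta> \<in> borel_measurable M" and \<kappa>: "\<kappa> \<in> borel_measurable M"
  shows "Measurable.pred M (\<lambda>x. wedge_blowup n (Y x) (\<theta> x) (\<kappa> x) W)"
proof -
  have "(\<lambda>x. \<Sum>p\<in>{..<n} \<times> {..<n}. wedge_sq n (\<lambda>k. fun_inverse n (Y x) k (fst p)) (\<lambda>k. fun_inverse n (Y x) k (snd p)))
      \<in> borel_measurable M"
    by (intro borel_measurable_sum measurable_wedge_sq_fun_inverse Y) auto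
  then have [measurable]: "(\<lambda>x. \<Sum>(i, j)\<in>{..<n} \<times> {..<n}. wedge_sq n (\<lambda>k. fun_inverse n (Y x) k i) (\<lambda>k. fun_inverse n (Y x) k j))
      \<in> borel_measurable M"
    by (simp add: case_prod_unfold)
  have W: "Measurable.pred M (\<lambda>x. W \<le> (\<Sum>(i, j)\<in>{..<n} \<times> {..<n}. wedge_sq n (\<lambda>k. fun_inverse n (Y x) k i) (\<lambda>k. fun_inverse n (Y x) k j)))"
    by measurable
  show ?thesis
    unfolding wedge_blowup_def using pred_intros_logic(3)[OF pred_invertible_skew[OF Y \<theta> \<kappa>] W]
    by (simp add: conj_assoc)
qed

context bounded_density
begin

lemma prob_wedge_ge:
  fixes D :: "nat \<Rightarrow> nat \<Rightarrow> complex" and w :: real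
  assumes ij: "i < n" "j < n" and w: "w > 0"
  defines "H \<equiv> \<lambda>\<omega>. fun_inverse n (perturbed D \<omega>)"
  shows "(\<integral>\<^sup>+\<omega>. indicator {\<omega>. fun_det n (perturbed D \<omega>) \<noteq> 0 \<and>
        w \<le> wedge_sq n (\<lambda>k. H \<omega> k i) (\<lambda>k. H \<omega> k j)} \<omega> \<partial>iid ({..<n} \<times> {..<n}))
      \<le> ennreal (800 * real n ^ 2 * K\<^sup>2 * w powr - (1/2))"
proof -
  let ?S = "{..<n} \<times> {..<n}"
  define Z where "Z = (\<lambda>(k, l) \<omega>. (cmod (H \<omega> k i * H \<omega> l j - H \<omega> l i * H \<omega> k j))\<^sup>2)"
  have f: "(\<lambda>\<omega>. H \<omega> p q) \<in> borel_measurable (iid ?S)" if "p < n" "q < n" for p q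
    unfolding H_def using that by (intro measurable_fun_inverse_perturbed)
  have "(\<integral>\<^sup>+\<omega>. indicator {\<omega>. fun_det n (perturbed D \<omega>) \<noteq> 0 \<and> w \<le> (\<Sum>p\<in>?S. Z p \<omega>)} \<omega> \<partial>iid ?S)
      \<le> ennreal (16 * real (card ?S) * (50 * K\<^sup>2) * w powr - (1/2))"
  proof (rule nn_integral_weak_sum_le)
    show "Z p \<in> borel_measurable (iid ?S)" if "p \<in> ?S" for p
    proof -
      obtain k l where p: "p = (k, l)" "k < n" "l < n" using \<open>p \<in> ?S\<close> by auto
      show ?thesis unfolding Z_def p prod.case
        using p ij by (intro borel_measurable_power measurable_compose[OF _ borel_measurable_norm]
          borel_measurable_diff borel_measurable_times f)
    qed
    show "Measurable.pred (iid ?S) (\<lambda>\<omega>. fun_det n (perturbed D \<omega>) \<noteq> 0)"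
    proof -
      have [measurable]: "(\<lambda>\<omega>. fun_det n (perturbed D \<omega>)) \<in> borel_measurable (iid ?S)"
        by (rule measurable_fun_det_perturbed)
      show ?thesis by measurable
    qed
    show "(\<integral>\<^sup>+\<omega>. indicator {\<omega>. fun_det n (perturbed D \<omega>) \<noteq> 0 \<and> v \<le> Z p \<omega>} \<omega> \<partial>iid ?S)
        \<le> ennreal (50 * K\<^sup>2 * v powr - (1/2))" if "p \<in> ?S" "v > 0" for p v
    proof -
      obtain k l where p: "p = (k, l)" "k < n" "l < n" using \<open>p \<in> ?S\<close> by auto
      show ?thesis unfolding Z_def p prod.case H_def
        by (rule prob_minor_inverse_ge) (use p ij that in auto)
    qed
  qed (use w in \<open>auto simp: Z_def\<close>)
  moreover have "(\<Sum>p\<in>?S. Z p \<omega>) = wedge_sq n (\<lambda>k. H \<omega> k i) (\<lambda>k. H \<omega> k j)" for \<omega>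
    by (simp add: wedge_sq_def Z_def sum.cartesian_product case_prod_unfold)
  ultimately show ?thesis by (simp add: power2_eq_square mult_ac)
qed

text \<open>The bound for real shifts.\<close>
lemma prob_wedge_blowup_le:
  assumes W: "W > 0"
  shows "(\<integral>\<^sup>+\<omega>. indicator {\<omega>. wedge_blowup n (perturbed D \<omega>) \<theta> \<kappa> W} \<omega> \<partial>iid ({..<n} \<times> {..<n}))
      \<le> ennreal (12800 * real n ^ 4 * K\<^sup>2 * W powr - (1/2))"
proof -
  let ?S = "{..<n} \<times> {..<n}"
  define Z where "Z = (\<lambda>(i, j) \<omega>. wedge_sq n (\<lambda>k. fun_inverse n (perturbed D \<omega>) k i) (\<lambda>k. fun_inverse n (perturbed D \<omega>) k j))"
  have "(\<integral>\<^sup>+\<omega>. indicator {\<omega>. wedge_blowup n (perturbed D \<omega>) \<theta> \<kappa> W} \<omega> \<partial>iid ?S)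
    \<le> (\<integral>\<^sup>+\<omega>. indicator {\<omega>. fun_det n (perturbed D \<omega>) \<noteq> 0 \<and> W \<le> (\<Sum>p\<in>?S. Z p \<omega>)} \<omega> \<partial>iid ?S)"
    by (intro nn_integral_mono) (auto simp: wedge_blowup_def Z_def case_prod_unfold split: split_indicator)
  also have "\<dots> \<le> ennreal (16 * real (card ?S) * (800 * real n ^ 2 * K\<^sup>2) * W powr - (1/2))"
  proof (rule nn_integral_weak_sum_le)
    show "Z p \<in> borel_measurable (iid ?S)" if "p \<in> ?S" for p
      using that unfolding Z_def case_prod_unfold
      by (intro measurable_wedge_sq_fun_inverse measurable_perturbed) auto
    show "Measurable.pred (iid ?S) (\<lambda>\<omega>. fun_det n (perturbed D \<omega>) \<noteq> 0)"
    proof -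
      have [measurable]: "(\<lambda>\<omega>. fun_det n (perturbed D \<omega>)) \<in> borel_measurable (iid ?S)"
        by (rule measurable_fun_det_perturbed)
      show ?thesis by measurable
    qed
    show "(\<integral>\<^sup>+\<omega>. indicator {\<omega>. fun_det n (perturbed D \<omega>) \<noteq> 0 \<and> v \<le> Z p \<omega>} \<omega> \<partial>iid ?S)
        \<le> ennreal (800 * real n ^ 2 * K\<^sup>2 * v powr - (1/2))" if "p \<in> ?S" "v > 0" for p v
    proof -
      obtain i j where p: "p = (i, j)" "i < n" "j < n" using \<open>p \<in> ?S\<close> by auto
      show ?thesis unfolding Z_def p prod.case
        by (rule prob_wedge_ge) (use p that in auto)
    qed
  qed (use W in \<open>auto simp: Z_def\<close>)
  also have "16 * real (card ?S) * (800 * real n ^ 2 * K\<^sup>2) * W powr - (1/2) = 12800 * real n ^ 4 * K\<^sup>2 * W powr - (1/2)"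
    by (simp add: power2_eq_square power4_eq_xxxx)
  finally show ?thesis .
qed

text \<open>The bound for nonreal shifts, where long columns are skew.\<close>
lemma prob_wedge_blowup_le_of_skew:
  fixes n :: nat and D :: "nat \<Rightarrow> nat \<Rightarrow> complex" and W \<theta> \<kappa> :: real
  assumes W: "W > 0" and \<theta>: "\<theta> > 0" and \<kappa>: "\<kappa> > 0"
  defines "C \<equiv> 800 * real n ^ 2 * K\<^sup>2 * sqrt (2 * \<theta>) + 512 * real n * sqrt n * K ^ 3 / \<kappa>"
  shows "(\<integral>\<^sup>+\<omega>. indicator {\<omega>. wedge_blowup n (perturbed D \<omega>) \<theta> \<kappa> W} \<omega> \<partial>iid ({..<n} \<times> {..<n}))
      \<le> ennreal (16 * real n ^ 2 * C * W powr - (3/4))"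
proof -
  let ?S = "{..<n} \<times> {..<n}"
  let ?h = "inverse_column n D"
  define Z where "Z = (\<lambda>(i, j) \<omega>. wedge_sq n (?h \<omega> i) (?h \<omega> j))"
  define P where "P \<omega> \<longleftrightarrow> fun_det n (perturbed D \<omega>) \<noteq> 0 \<and> (\<forall>j<n. \<theta> \<le> sq_norm n (?h \<omega> j) \<longrightarrow>
        \<kappa>\<^sup>2 * (sq_norm n (?h \<omega> j))\<^sup>2 \<le> wedge_sq n (?h \<omega> j) (\<lambda>k. cnj (?h \<omega> j k)))" for \<omega>
  have h: "?h \<omega> j = (\<lambda>k. fun_inverse n (perturbed D \<omega>) k j)" for \<omega> j by (rule ext) (simp add: inverse_column_def)
  have C: "C \<ge> 0" using \<theta> \<kappa> K_pos by (simp add: C_def)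
  have "(\<integral>\<^sup>+\<omega>. indicator {\<omega>. wedge_blowup n (perturbed D \<omega>) \<theta> \<kappa> W} \<omega> \<partial>iid ?S)
    = (\<integral>\<^sup>+\<omega>. indicator {\<omega>. P \<omega> \<and> W \<le> (\<Sum>p\<in>?S. Z p \<omega>)} \<omega> \<partial>iid ?S)"
    by (simp only: wedge_blowup_def Z_def case_prod_unfold P_def h conj_assoc)
  also have "\<dots> \<le> ennreal (16 * real (card ?S) * C * W powr - (3/4))"
  proof (rule nn_integral_weak_sum_le)
    show "Z p \<in> borel_measurable (iid ?S)" if "p \<in> ?S" for p
      using that unfolding Z_def case_prod_unfold h
      by (intro measurable_wedge_sq_fun_inverse measurable_perturbed) auto
    show "Measurable.pred (iid ?S) P"
      unfolding P_def h by (intro pred_invertible_skew measurable_perturbed) auto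
    show "(\<integral>\<^sup>+\<omega>. indicator {\<omega>. P \<omega> \<and> w \<le> Z p \<omega>} \<omega> \<partial>iid ?S)
        \<le> ennreal (C * w powr - (3/4))" if "p \<in> ?S" and w: "w > 0" for p w
    proof -
      obtain i j where p: "p = (i, j)" and ij: "i < n" "j < n" using \<open>p \<in> ?S\<close> by auto
      let ?B = "256 * real n * sqrt n * K ^ 3 / \<kappa> * w powr - (3/4)"
      have B: "?B \<ge> 0" using \<kappa> K_pos by simp
      \<comment> \<open>A large wedge makes one of its two columns long. If its squared length reaches \<open>\<theta>\<close>, that column is
          skew; below this threshold \<open>w\<close> is at most \<open>4 \<theta>\<^sup>2\<close> and the exponent \<open>1/2\<close> can be traded for
          \<open>3/4\<close> at the price of \<open>sqrt (2 \<theta>)\<close>.\<close>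
      consider "i = j" | "i \<noteq> j" "\<theta> \<le> sqrt w / 2" | "sqrt w / 2 < \<theta>" by linarith
      then show ?thesis
      proof cases
        case 1
        then have "{\<omega>. P \<omega> \<and> w \<le> Z p \<omega>} = {}" using w by (simp add: p Z_def)
        then show ?thesis by simp
      next
        case 2
        define E where "E i j = {\<omega>. fun_det n (perturbed D \<omega>) \<noteq> 0 \<and>
          w \<le> wedge_sq n (?h \<omega> i) (?h \<omega> j) \<and> sqrt w / 2 \<le> sq_norm n (?h \<omega> j) \<and>
          \<kappa>\<^sup>2 * (sq_norm n (?h \<omega> j))\<^sup>2 \<le> wedge_sq n (?h \<omega> j) (\<lambda>k. cnj (?h \<omega> j k))}" for i j
        have E_le: "(\<integral>\<^sup>+\<omega>. indicator (E i j) \<omega> \<partial>iid ?S) \<le> ennreal ?B" if "i < n" "j < n" "i \<noteq> j" for i j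
          unfolding E_def using that w \<kappa> by (intro prob_skew_wedge_ge)
        have E_meas: "(indicator (E i j) :: _ \<Rightarrow> ennreal) \<in> borel_measurable (iid ?S)" if "i < n" "j < n" for i j
          unfolding E_def h using that
          by (intro measurable_indicator_skew_event measurable_fun_det_perturbed measurable_wedge_sq_fun_inverse
              measurable_sq_norm_fun_inverse measurable_wedge_sq_cnj_fun_inverse measurable_perturbed)
        have sub: "{\<omega>. P \<omega> \<and> w \<le> Z p \<omega>} \<subseteq> E i j \<union> E j i"
        proof
          fix \<omega> assume "\<omega> \<in> {\<omega>. P \<omega> \<and> w \<le> Z p \<omega>}"
          then have P: "P \<omega>" and wz: "w \<le> wedge_sq n (?h \<omega> i) (?h \<omega> j)" by (simp_all add: p Z_def)
          have "sqrt w / 2 \<le> sq_norm n (?h \<omega> i) \<or> sqrt w / 2 \<le> sq_norm n (?h \<omega> j)"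
          proof (rule ccontr)
            assume "\<not> ?thesis"
            then have "sq_norm n (?h \<omega> i) * sq_norm n (?h \<omega> j) < sqrt w / 2 * (sqrt w / 2)"
              by (intro mult_strict_mono') auto
            also have "\<dots> = w / 4" using w by simp
            finally show False using wz wedge_sq_le[of n "?h \<omega> i" "?h \<omega> j"] by simp
          qed
          then show "\<omega> \<in> E i j \<union> E j i"
            using P wz 2(2) ij wedge_sq_commute[of n "?h \<omega> i" "?h \<omega> j"] by (auto simp: E_def P_def)
        qed
        have "(\<integral>\<^sup>+\<omega>. indicator {\<omega>. P \<omega> \<and> w \<le> Z p \<omega>} \<omega> \<partial>iid ?S)
            \<le> (\<integral>\<^sup>+\<omega>. indicator (E i j) \<omega> + indicator (E j i) \<omega> \<partial>iid ?S)"
          using sub by (intro nn_integral_mono) (auto split: split_indicator)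
        also have "\<dots> = (\<integral>\<^sup>+\<omega>. indicator (E i j) \<omega> \<partial>iid ?S) + (\<integral>\<^sup>+\<omega>. indicator (E j i) \<omega> \<partial>iid ?S)"
          using ij by (intro nn_integral_add E_meas)
        also have "\<dots> \<le> ennreal ?B + ennreal ?B"
          using ij 2 by (intro add_mono E_le) auto
        also have "\<dots> = ennreal (?B + ?B)" using B by (intro ennreal_plus[symmetric])
        also have "\<dots> \<le> ennreal (C * w powr - (3/4))"
        proof (rule ennreal_leI)
          have "?B + ?B = (512 * real n * sqrt n * K ^ 3 / \<kappa>) * w powr - (3/4)" by simp
          also have "\<dots> \<le> C * w powr - (3/4)"
            unfolding C_def using \<theta> by (intro mult_right_mono) auto
          finally show "?B + ?B \<le> C * w powr - (3/4)" .
        qed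
        finally show ?thesis .
      next
        case 3
        have "(\<integral>\<^sup>+\<omega>. indicator {\<omega>. P \<omega> \<and> w \<le> Z p \<omega>} \<omega> \<partial>iid ?S)
            \<le> (\<integral>\<^sup>+\<omega>. indicator {\<omega>. fun_det n (perturbed D \<omega>) \<noteq> 0 \<and>
                w \<le> wedge_sq n (\<lambda>k. fun_inverse n (perturbed D \<omega>) k i) (\<lambda>k. fun_inverse n (perturbed D \<omega>) k j)} \<omega> \<partial>iid ?S)"
          by (intro nn_integral_mono) (auto simp: p Z_def P_def h split: split_indicator)
        also have "\<dots> \<le> ennreal (800 * real n ^ 2 * K\<^sup>2 * w powr - (1/2))"
          using ij w by (rule prob_wedge_ge)
        also have "\<dots> \<le> ennreal (C * w powr - (3/4))"
        proof (rule ennreal_leI)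
          have "w powr - (1/2) = w powr (1/4) * w powr - (3/4)"
            by (simp add: powr_add[symmetric])
          also have "w powr (1/4) = sqrt (sqrt w)"
            using w by (simp add: powr_half_sqrt[symmetric] powr_powr)
          also have "sqrt (sqrt w) * w powr - (3/4) \<le> sqrt (2 * \<theta>) * w powr - (3/4)"
            using 3 by (intro mult_right_mono) auto
          finally have "800 * real n ^ 2 * K\<^sup>2 * w powr - (1/2)
              \<le> 800 * real n ^ 2 * K\<^sup>2 * (sqrt (2 * \<theta>) * w powr - (3/4))"
            by (intro mult_left_mono) auto
          also have "\<dots> = 800 * real n ^ 2 * K\<^sup>2 * sqrt (2 * \<theta>) * w powr - (3/4)" by simp
          also have "\<dots> \<le> C * w powr - (3/4)"
            unfolding C_def using \<kappa> K_pos by (intro mult_right_mono) auto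
          finally show "800 * real n ^ 2 * K\<^sup>2 * w powr - (1/2) \<le> C * w powr - (3/4)" .
        qed
        finally show ?thesis .
      qed
    qed
  qed (use W C in \<open>auto simp: Z_def\<close>)
  also have "real (card ?S) = real n ^ 2" by (simp add: power2_eq_square)
  finally show ?thesis .
qed

end

section \<open>Close eigenvalues and shifts near them\<close>

lemma sq_norm_diff_le: "sq_norm n (\<lambda>i. u i - v i) \<le> 2 * sq_norm n u + 2 * sq_norm n v"
  unfolding sq_norm_def sum_distrib_left sum.distrib[symmetric] by (intro sum_mono square_norm_diff_le)

lemma mat_mult_entry:
  assumes "A \<in> carrier_mat n m" "B \<in> carrier_mat m p" "i < n" "j < p"
  shows "(A * B) $$ (i, j) = (\<Sum>k<m. A $$ (i, k) * B $$ (k, j))"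
  using assms by (simp add: scalar_prod_def atLeast0LessThan)

lemma wedge_sq_ge_entry:
  assumes "k < n" "l < n"
  shows "(cmod (u k * v l - u l * v k))\<^sup>2 \<le> wedge_sq n u v"
proof -
  have "(cmod (u k * v l - u l * v k))\<^sup>2 \<le> (\<Sum>l<n. (cmod (u k * v l - u l * v k))\<^sup>2)"
    using assms by (intro member_le_sum) auto
  also have "\<dots> \<le> wedge_sq n u v"
    unfolding wedge_sq_def using assms
    by (intro member_le_sum[where f="\<lambda>k. \<Sum>l<n. (cmod (u k * v l - u l * v k))\<^sup>2"]) (auto intro: sum_nonneg)
  finally show ?thesis .
qed

lemma proots_linear_factors:
  "proots (\<Prod>a\<leftarrow>as. [:- a, 1:]) = mset (as :: complex list)"
proof (induction as)
  case (Cons a as)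
  have nz: "(\<Prod>a\<leftarrow>as. [:- a, 1:]) \<noteq> (0 :: complex poly)"
    by (auto simp: prod_list_zero_iff)
  have "proots ([:- a, 1:] * (\<Prod>a\<leftarrow>as. [:- a, 1:])) = proots [:- a, 1:] + proots (\<Prod>a\<leftarrow>as. [:- a, 1:])"
    by (rule proots_mult) (use nz in auto)
  then show ?case by (simp only: list.map prod_list.Cons Cons proots_linear_factor) simp
qed simp

text \<open>The first two columns of the similarity to a Schur form whose diagonal starts with \<open>a\<close>, \<open>b\<close>. Taking
  generalized eigenvectors treats distinct and repeated eigenvalues alike.\<close>
lemma two_generalized_eigenvectors:
  fixes A :: "complex mat"
  assumes A: "A \<in> carrier_mat n n" and ab: "{#a, b#} \<subseteq># proots (char_poly A)"
  shows "\<exists>u v c. (\<forall>i<n. (\<Sum>k<n. A $$ (i, k) * u k) = a * u i) \<and>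
    (\<forall>i<n. (\<Sum>k<n. A $$ (i, k) * v k) = b * v i + c * u i) \<and> wedge_sq n u v > 0"
proof -
  obtain as where as: "char_poly A = (\<Prod>a\<leftarrow>as. [:- a, 1:])" "length as = n"
    using char_poly_factorized[OF A] by auto
  have "proots (char_poly A) = mset as"
    unfolding as(1) by (rule proots_linear_factors)
  then obtain ms where "mset as = {#a, b#} + ms" using ab by (metis subset_mset.add_diff_inverse)
  moreover obtain cs where "mset cs = ms" using ex_mset by blast
  ultimately have mset: "mset as = mset (a # b # cs)" by simp
  have "char_poly A = prod_mset (image_mset (\<lambda>a. [:- a, 1:]) (mset as))"
    unfolding as(1) by (simp flip: prod_mset_prod_list)
  also have "\<dots> = (\<Prod>a\<leftarrow>a # b # cs. [:- a, 1:])"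
    unfolding mset by (simp flip: prod_mset_prod_list)
  finally have cp: "char_poly A = (\<Prod>a\<leftarrow>a # b # cs. [:- a, 1:])" .
  obtain B P Q where BPQ: "schur_decomposition A (a # b # cs) = (B, P, Q)" by (metis prod_cases3)
  have sim: "similar_mat_wit A B P Q" and tri: "upper_triangular B" and diag: "diag_mat B = a # b # cs"
    using schur_decomposition[OF A cp BPQ] by auto
  note wit = similar_mat_witD2[OF A sim]
  have n2: "n \<ge> 2"
    using arg_cong[OF diag, of length] wit(5) by (simp add: diag_mat_def)
  have B00: "B $$ (0, 0) = a" and B11: "B $$ (1, 1) = b"
    using arg_cong[OF diag, of "\<lambda>xs. xs ! 0"] arg_cong[OF diag, of "\<lambda>xs. xs ! 1"] wit(5) n2
    by (simp_all add: diag_mat_def)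
  have B_tri: "B $$ (k, l) = 0" if "l < k" "k < n" for k l
    using tri that wit(5) by (auto intro: upper_triangularD)
  have AP: "A * P = P * B"
  proof -
    have "A * P = P * B * (Q * P)"
      using wit by (simp add: assoc_mult_mat[of _ n n _ n _ n])
    then show ?thesis using wit by simp
  qed
  have AP_entry: "(\<Sum>k<n. A $$ (i, k) * P $$ (k, j)) = (\<Sum>k<n. P $$ (i, k) * B $$ (k, j))"
    if "i < n" "j < n" for i j
    using arg_cong[OF AP, of "\<lambda>X. X $$ (i, j)"] that wit
      mat_mult_entry[OF wit(4,6) that] mat_mult_entry[OF wit(6,5) that] by simp
  have QP_entry: "(\<Sum>k<n. Q $$ (i, k) * P $$ (k, j)) = of_bool (i = j)" if "i < n" "j < n" for i j
    using arg_cong[OF wit(2), of "\<lambda>X. X $$ (i, j)"] that mat_mult_entry[OF wit(7,6) that] by simp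
  let ?u = "\<lambda>k. P $$ (k, 0)" and ?v = "\<lambda>k. P $$ (k, 1)"
  have u_eq: "(\<Sum>k<n. A $$ (i, k) * ?u k) = a * ?u i" if "i < n" for i
  proof -
    have "(\<Sum>k<n. A $$ (i, k) * ?u k) = (\<Sum>k<n. P $$ (i, k) * B $$ (k, 0))"
      using that n2 by (intro AP_entry) auto
    also have "\<dots> = (\<Sum>k\<in>{0}. P $$ (i, k) * B $$ (k, 0))"
      using n2 B_tri by (intro sum.mono_neutral_right) auto
    finally show ?thesis by (simp add: B00)
  qed
  have v_eq: "(\<Sum>k<n. A $$ (i, k) * ?v k) = b * ?v i + B $$ (0, 1) * ?u i" if "i < n" for i
  proof -
    have "(\<Sum>k<n. A $$ (i, k) * ?v k) = (\<Sum>k<n. P $$ (i, k) * B $$ (k, 1))"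
      using that n2 by (intro AP_entry) auto
    also have "\<dots> = (\<Sum>k\<in>{0, 1}. P $$ (i, k) * B $$ (k, 1))"
      using n2 B_tri by (intro sum.mono_neutral_right) auto
    finally show ?thesis by (simp add: B11[simplified])
  qed
  \<comment> \<open>The wedge of the first two rows of \<open>Q\<close> pairs to 1 with \<open>u \<and> v\<close>.\<close>
  have pos: "wedge_sq n ?u ?v > 0"
  proof (rule ccontr)
    assume "\<not> wedge_sq n ?u ?v > 0"
    then have "wedge_sq n ?u ?v = 0" using wedge_sq_nonneg[of n ?u ?v] by linarith
    then have z: "?u k * ?v l - ?u l * ?v k = 0" if "k < n" "l < n" for k l
      using wedge_sq_ge_entry[OF that, of ?u ?v] by simp
    have "(1::complex) = (\<Sum>k<n. Q $$ (0, k) * ?u k) * (\<Sum>l<n. Q $$ (1, l) * ?v l)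
        - (\<Sum>k<n. Q $$ (0, k) * ?v k) * (\<Sum>l<n. Q $$ (1, l) * ?u l)"
      using n2 by (simp add: QP_entry)
    also have "\<dots> = (\<Sum>k<n. \<Sum>l<n. Q $$ (0, k) * Q $$ (1, l) * (?u k * ?v l - ?u l * ?v k))"
      unfolding sum_product sum_subtractf[symmetric]
      by (intro sum.cong refl) (simp add: algebra_simps)
    also have "\<dots> = 0" by (intro sum.neutral ballI) (simp only: lessThan_iff z mult_zero_right)
    finally show False by simp
  qed
  show ?thesis
    by (intro exI[of _ ?u] exI[of _ ?v] exI[of _ "B $$ (0, 1)"] conjI allI impI u_eq v_eq pos)
qed

lemma eigenvalue_gap_le_imp_pair:
  assumes M: "M \<in> carrier_mat n n" and n: "n \<ge> 2" and gap: "eigenvalue_gap M \<le> s"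
  shows "\<exists>a b. {#a, b#} \<subseteq># proots (char_poly (map_mat complex_of_real M)) \<and> cmod (a - b) \<le> s"
proof -
  let ?R = "complex_eigenvalues M"
  let ?X = "{cmod (a - b) | a b. {#a, b#} \<subseteq># ?R}"
  have Mc: "map_mat complex_of_real M \<in> carrier_mat n n" using M by simp
  obtain as where as: "char_poly (map_mat complex_of_real M) = (\<Prod>a\<leftarrow>as. [:- a, 1:])" "length as = n"
    using char_poly_factorized[OF Mc] by auto
  have R: "?R = mset as"
    unfolding complex_eigenvalues_def as(1) by (rule proots_linear_factors)
  obtain a b cs where "as = a # b # cs" using as(2) n by (cases as; cases "tl as") auto
  then have "{#a, b#} \<subseteq># ?R" using R by simp
  then have "cmod (a - b) \<in> ?X" by blast
  then have ne: "?X \<noteq> {}" by blast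
  have "?X \<subseteq> (\<lambda>(a, b). cmod (a - b)) ` (set_mset ?R \<times> set_mset ?R)"
    by (force dest: mset_subset_eqD)
  then have "finite ?X" by (rule finite_subset) auto
  then have "Min ?X \<in> ?X" using ne by (rule Min_in)
  then obtain a b where ab: "{#a, b#} \<subseteq># ?R" "Min ?X = cmod (a - b)" by blast
  then have "cmod (a - b) \<le> s" using gap by (simp add: eigenvalue_gap_def)
  then show ?thesis using ab(1) unfolding complex_eigenvalues_def by blast
qed

lemma l2_norm_mult_le:
  assumes v: "v \<in> carrier_vec (dim_col A)"
  shows "l2_norm (A *\<^sub>v v) \<le> op_norm A * l2_norm v"
proof -
  let ?S = "{v \<in> carrier_vec (dim_col A). l2_norm v \<le> 1}"
  have bdd: "bdd_above ((\<lambda>v. l2_norm (A *\<^sub>v v)) ` ?S)"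
  proof (rule bdd_aboveI2)
    fix v assume v: "v \<in> ?S"
    have "l2_norm (A *\<^sub>v v) \<le> (\<Sum>i<dim_row A. \<bar>(A *\<^sub>v v) $ i\<bar>)"
      unfolding l2_norm_def dim_mult_mat_vec by (rule L2_set_le_sum_abs)
    also have "\<dots> \<le> (\<Sum>i<dim_row A. \<Sum>k<dim_col A. \<bar>A $$ (i, k)\<bar>)"
    proof (rule sum_mono)
      fix i assume i: "i \<in> {..<dim_row A}"
      have "\<bar>v $ k\<bar> \<le> 1" if "k < dim_col A" for k
      proof -
        have "\<bar>v $ k\<bar> \<le> L2_set (\<lambda>k. \<bar>v $ k\<bar>) {..<dim_vec v}"
          using v that by (intro member_le_L2_set) auto
        also have "\<dots> = l2_norm v" by (simp add: l2_norm_def L2_set_def)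
        finally show ?thesis using v by simp
      qed
      then have "\<bar>A $$ (i, k) * v $ k\<bar> \<le> \<bar>A $$ (i, k)\<bar>" if "k < dim_col A" for k
        using that by (simp add: abs_mult mult_left_le)
      then have "(\<Sum>k<dim_col A. \<bar>A $$ (i, k) * v $ k\<bar>) \<le> (\<Sum>k<dim_col A. \<bar>A $$ (i, k)\<bar>)"
        by (intro sum_mono) auto
      moreover have "\<bar>(A *\<^sub>v v) $ i\<bar> \<le> (\<Sum>k<dim_col A. \<bar>A $$ (i, k) * v $ k\<bar>)"
        using i v by (auto simp: scalar_prod_def atLeast0LessThan intro: order.trans[OF _ sum_abs])
      ultimately show "\<bar>(A *\<^sub>v v) $ i\<bar> \<le> (\<Sum>k<dim_col A. \<bar>A $$ (i, k)\<bar>)" by linarith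
    qed
    finally show "l2_norm (A *\<^sub>v v) \<le> (\<Sum>i<dim_row A. \<Sum>k<dim_col A. \<bar>A $$ (i, k)\<bar>)" .
  qed
  have scale: "l2_norm (c \<cdot>\<^sub>v w) = \<bar>c\<bar> * l2_norm w" for c w
  proof -
    have "l2_norm (c \<cdot>\<^sub>v w) = L2_set (\<lambda>i. \<bar>c\<bar> * w $ i) {..<dim_vec w}"
      by (simp add: l2_norm_def L2_set_def power_mult_distrib)
    then show ?thesis by (simp add: l2_norm_def L2_set_right_distrib)
  qed
  have nonneg: "0 \<le> l2_norm w" for w by (simp add: l2_norm_def)
  show ?thesis
  proof (cases "l2_norm v = 0")
    case True
    then have "v $ k = 0" if "k < dim_vec v" for k
      using that by (auto simp: l2_norm_def L2_set_eq_0_iff)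
    then have "v = 0\<^sub>v (dim_col A)" using v by (intro eq_vecI) auto
    then have "A *\<^sub>v v = 0\<^sub>v (dim_row A)" by (intro eq_vecI) (auto simp: scalar_prod_def)
    then show ?thesis using True by (simp add: l2_norm_def L2_set_def)
  next
    case False
    define l where "l = l2_norm v"
    have l: "l > 0" using False nonneg[of v] by (simp add: l_def)
    have "l2_norm ((1 / l) \<cdot>\<^sub>v v) \<le> 1" using l by (simp add: scale l_def[symmetric])
    then have "l2_norm (A *\<^sub>v ((1 / l) \<cdot>\<^sub>v v)) \<le> op_norm A"
      unfolding op_norm_def using v by (intro cSUP_upper bdd) auto
    moreover have "A *\<^sub>v ((1 / l) \<cdot>\<^sub>v v) = (1 / l) \<cdot>\<^sub>v (A *\<^sub>v v)"
      using v by (intro mult_mat_vec[of _ "dim_row A" "dim_col A"]) auto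
    ultimately show ?thesis using l by (simp add: scale l_def[symmetric] field_simps)
  qed
qed

lemma sum_squares_perturbation_le:
  assumes A: "A \<in> carrier_mat n n" "op_norm A \<le> r" and G: "G \<in> carrier_mat n n" "op_norm G \<le> r'"
    and \<delta>: "\<delta> \<ge> 0"
  shows "(\<Sum>i<n. (\<Sum>k<n. (A + \<delta> \<cdot>\<^sub>m G) $$ (i, k) * x k)\<^sup>2) \<le> (r + \<delta> * r')\<^sup>2 * (\<Sum>k<n. (x k)\<^sup>2)"
proof -
  define v where "v = vec n x"
  have v: "v \<in> carrier_vec n" by (simp add: v_def)
  have l2v: "l2_norm v = L2_set x {..<n}" by (simp add: v_def l2_norm_def L2_set_def)
  have l2: "l2_norm (B *\<^sub>v v) = L2_set (\<lambda>i. \<Sum>k<n. B $$ (i, k) * x k) {..<n}" if "B \<in> carrier_mat n n" for B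
    using that by (simp add: l2_norm_def L2_set_def v_def scalar_prod_def atLeast0LessThan)
  have row: "(\<Sum>k<n. (A + \<delta> \<cdot>\<^sub>m G) $$ (i, k) * x k)
      = (\<Sum>k<n. A $$ (i, k) * x k) + \<delta> * (\<Sum>k<n. G $$ (i, k) * x k)" if "i < n" for i
  proof -
    have "(\<Sum>k<n. (A + \<delta> \<cdot>\<^sub>m G) $$ (i, k) * x k) = (\<Sum>k<n. A $$ (i, k) * x k + \<delta> * (G $$ (i, k) * x k))"
      using A(1) G(1) that by (intro sum.cong refl) (simp add: distrib_right)
    then show ?thesis by (simp only: sum.distrib sum_distrib_left)
  qed
  have "L2_set (\<lambda>i. \<Sum>k<n. (A + \<delta> \<cdot>\<^sub>m G) $$ (i, k) * x k) {..<n}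
      = L2_set (\<lambda>i. (\<Sum>k<n. A $$ (i, k) * x k) + \<delta> * (\<Sum>k<n. G $$ (i, k) * x k)) {..<n}"
    by (intro L2_set_cong refl row) auto
  also have "\<dots> \<le> L2_set (\<lambda>i. \<Sum>k<n. A $$ (i, k) * x k) {..<n}
      + L2_set (\<lambda>i. \<delta> * (\<Sum>k<n. G $$ (i, k) * x k)) {..<n}"
    by (rule L2_set_triangle_ineq)
  also have "\<dots> = l2_norm (A *\<^sub>v v) + \<delta> * l2_norm (G *\<^sub>v v)"
    using A G \<delta> by (simp add: l2 L2_set_right_distrib)
  also have "\<dots> \<le> r * l2_norm v + \<delta> * (r' * l2_norm v)"
  proof (intro add_mono mult_left_mono \<delta>)
    have "0 \<le> l2_norm v" by (simp add: l2_norm_def)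
    then show "l2_norm (A *\<^sub>v v) \<le> r * l2_norm v" "l2_norm (G *\<^sub>v v) \<le> r' * l2_norm v"
      using l2_norm_mult_le[of v A] l2_norm_mult_le[of v G] A G v
        mult_right_mono[OF A(2)] mult_right_mono[OF G(2)] by fastforce+
  qed
  finally have "L2_set (\<lambda>i. \<Sum>k<n. (A + \<delta> \<cdot>\<^sub>m G) $$ (i, k) * x k) {..<n} \<le> (r + \<delta> * r') * L2_set x {..<n}"
    by (simp add: l2v algebra_simps)
  then have "(L2_set (\<lambda>i. \<Sum>k<n. (A + \<delta> \<cdot>\<^sub>m G) $$ (i, k) * x k) {..<n})\<^sup>2 \<le> ((r + \<delta> * r') * L2_set x {..<n})\<^sup>2"
    by (intro power_mono) auto
  then show ?thesis by (simp add: L2_set_def sum_nonneg power_mult_distrib)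
qed

lemma sq_norm_real_matrix_le:
  assumes "\<And>x :: nat \<Rightarrow> real. (\<Sum>i<n. (\<Sum>k<n. M i k * x k)\<^sup>2) \<le> C * (\<Sum>k<n. (x k)\<^sup>2)"
  shows "sq_norm n (\<lambda>i. \<Sum>k<n. complex_of_real (M i k) * x k) \<le> C * sq_norm n x"
proof -
  have "sq_norm n (\<lambda>i. \<Sum>k<n. complex_of_real (M i k) * x k)
      = (\<Sum>i<n. (\<Sum>k<n. M i k * Re (x k))\<^sup>2) + (\<Sum>i<n. (\<Sum>k<n. M i k * Im (x k))\<^sup>2)"
    by (simp add: sq_norm_def cmod_power2 sum.distrib)
  also have "\<dots> \<le> C * (\<Sum>k<n. (Re (x k))\<^sup>2) + C * (\<Sum>k<n. (Im (x k))\<^sup>2)"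
    by (intro add_mono assms)
  also have "\<dots> = C * sq_norm n x"
    by (simp add: sq_norm_def cmod_power2 sum.distrib distrib_left)
  finally show ?thesis .
qed

lemma finite_singular_shifts:
  fixes A :: "complex mat"
  assumes A: "A \<in> carrier_mat n n" and d: "d \<noteq> 0"
  shows "finite {z. fun_det n (\<lambda>i j. (A $$ (i, j) - z * of_bool (i = j)) / d) = 0}"
proof -
  have "{z. fun_det n (\<lambda>i j. (A $$ (i, j) - z * of_bool (i = j)) / d) = 0} \<subseteq> {z. poly (char_poly A) z = 0}"
  proof
    fix z assume z: "z \<in> {z. fun_det n (\<lambda>i j. (A $$ (i, j) - z * of_bool (i = j)) / d) = 0}"
    have "mat n n (\<lambda>(i, j). (A $$ (i, j) - z * of_bool (i = j)) / d) = (1 / d) \<cdot>\<^sub>m char_matrix A z"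
      using A by (intro eq_matI) (auto simp: char_matrix_def)
    then have "(1 / d) ^ n * det (char_matrix A z) = 0"
      using z A by (simp add: fun_det_def det_smult char_matrix_def)
    then have "det (char_matrix A z) = 0" using d by simp
    then show "z \<in> {z. poly (char_poly A) z = 0}"
      using eigenvalue_det[OF A] eigenvalue_root_char_poly[OF A] by simp
  qed
  moreover have "char_poly A \<noteq> 0" using degree_monic_char_poly[OF A] by auto
  ultimately show ?thesis using poly_roots_finite finite_subset by blast
qed

text \<open>The deterministic half of the argument, for the matrix \<open>Y = (M - z) / d\<close> whose real random entries have
  unit scale. The thresholds are those of the skewness lemma with norm bound \<open>6 R\<close> for \<open>M - z\<close>. For a real
  shift both \<open>4 d\<^sup>2 / y\<^sup>2\<close> and \<open>|y| / (6 R)\<close> are 0, the former as a division by 0, and the skewness clause is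
  void.\<close>
lemma wedge_blowup_near_eigenvalues:
  fixes M :: "nat \<Rightarrow> nat \<Rightarrow> real" and a b c :: complex and x0 y d R W :: real
  assumes u: "\<And>i. i < n \<Longrightarrow> (\<Sum>k<n. complex_of_real (M i k) * u k) = a * u i"
    and v: "\<And>i. i < n \<Longrightarrow> (\<Sum>k<n. complex_of_real (M i k) * v k) = b * v i + c * u i"
    and uv: "wedge_sq n u v > 0"
    and bound: "\<And>x. sq_norm n (\<lambda>i. \<Sum>k<n. complex_of_real (M i k) * x k) \<le> R\<^sup>2 * sq_norm n x"
    and R: "R > 0" and d: "d > 0" and z: "cmod (Complex x0 y) \<le> 4 * R"
    and W: "W * (cmod ((a - Complex x0 y) * (b - Complex x0 y)))\<^sup>2 \<le> 4 * d ^ 4"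
  defines "Y \<equiv> \<lambda>i j. (complex_of_real (M i j) - Complex x0 y * of_bool (i = j)) / complex_of_real d"
  assumes det: "fun_det n Y \<noteq> 0"
  shows "wedge_blowup n Y (4 * d\<^sup>2 / y\<^sup>2) (\<bar>y\<bar> / (6 * R)) W"
proof -
  define z where "z = Complex x0 y"
  define H where "H = fun_inverse n Y"
  have inv: "mutually_inverse n Y H" unfolding H_def by (rule mutually_inverse_fun_inverse[OF det])
  have Y_sum: "(\<Sum>k<n. Y i k * x k) = ((\<Sum>k<n. complex_of_real (M i k) * x k) - z * x i) / d" if "i < n" for i x
  proof -
    have "(\<Sum>k<n. Y i k * x k) = (\<Sum>k<n. (complex_of_real (M i k) * x k - (if i = k then z * x k else 0)) / d)"
      by (intro sum.cong refl) (simp add: Y_def z_def diff_divide_distrib left_diff_distrib)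
    also have "\<dots> = ((\<Sum>k<n. complex_of_real (M i k) * x k) - (\<Sum>k<n. if i = k then z * x k else 0)) / d"
      by (simp add: sum_divide_distrib[symmetric] sum_subtractf)
    finally show ?thesis using that by simp
  qed
  have "4 \<le> (cmod ((a - z) / d * ((b - z) / d)))\<^sup>2 * (\<Sum>i<n. \<Sum>j<n. wedge_sq n (\<lambda>k. H k i) (\<lambda>k. H k j))"
  proof (rule sum_wedge_sq_inverse_ge[OF inv _ _ uv])
    show "(\<Sum>k<n. Y i k * u k) = (a - z) / d * u i" if "i < n" for i
      unfolding Y_sum[OF that] u[OF that] by (simp add: algebra_simps)
    show "(\<Sum>k<n. Y i k * v k) = (b - z) / d * v i + c / d * u i" if "i < n" for i
      unfolding Y_sum[OF that] v[OF that] by (simp add: algebra_simps add_divide_distrib diff_divide_distrib)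
  qed
  also have "(cmod ((a - z) / d * ((b - z) / d)))\<^sup>2 = (cmod ((a - z) * (b - z)))\<^sup>2 / d ^ 4"
    using d by (simp add: norm_mult norm_divide power_mult_distrib power_divide power4_eq_xxxx power2_eq_square)
  finally have 1: "4 * d ^ 4 \<le> (cmod ((a - z) * (b - z)))\<^sup>2 * (\<Sum>(i, j)\<in>{..<n} \<times> {..<n}. wedge_sq n (\<lambda>k. H k i) (\<lambda>k. H k j))"
    using d by (simp add: sum.cartesian_product field_simps)
  have "0 < 4 * d ^ 4" using d by simp
  then have "cmod ((a - z) * (b - z)) \<noteq> 0" using 1 by auto
  then have pos: "0 < (cmod ((a - z) * (b - z)))\<^sup>2" by simp
  have "W * (cmod ((a - z) * (b - z)))\<^sup>2
      \<le> (\<Sum>(i, j)\<in>{..<n} \<times> {..<n}. wedge_sq n (\<lambda>k. H k i) (\<lambda>k. H k j)) * (cmod ((a - z) * (b - z)))\<^sup>2"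
    using 1 W unfolding z_def by (simp add: mult.commute)
  then have sum_ge: "W \<le> (\<Sum>(i, j)\<in>{..<n} \<times> {..<n}. wedge_sq n (\<lambda>k. H k i) (\<lambda>k. H k j))"
    using pos by (rule mult_right_le_imp_le)
  have area: "(\<bar>y\<bar> / (6 * R))\<^sup>2 * (sq_norm n (\<lambda>k. H k j))\<^sup>2 \<le> wedge_sq n (\<lambda>k. H k j) (\<lambda>k. cnj (H k j))"
    if j: "j < n" and large: "4 * d\<^sup>2 / y\<^sup>2 \<le> sq_norm n (\<lambda>k. H k j)" for j
  proof (cases "y = 0")
    case False
    show ?thesis
    proof (rule wedge_sq_cnj_ge[where M=M and d=d, OF j False d])
      show "sq_norm n (\<lambda>i. (\<Sum>k<n. complex_of_real (M i k) * x k) - Complex x0 y * x i) \<le> (6 * R)\<^sup>2 * sq_norm n x" for x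
      proof -
        have "sq_norm n (\<lambda>i. (\<Sum>k<n. complex_of_real (M i k) * x k) - Complex x0 y * x i)
            \<le> 2 * sq_norm n (\<lambda>i. \<Sum>k<n. complex_of_real (M i k) * x k) + 2 * sq_norm n (\<lambda>i. Complex x0 y * x i)"
          by (rule sq_norm_diff_le)
        also have "\<dots> \<le> 2 * (R\<^sup>2 * sq_norm n x) + 2 * ((4 * R)\<^sup>2 * sq_norm n x)"
          unfolding sq_norm_scale using z by (intro add_mono mult_left_mono bound mult_right_mono power_mono) auto
        also have "\<dots> = 34 * (R\<^sup>2 * sq_norm n x)" by (simp add: power_mult_distrib)
        also have "\<dots> \<le> (6 * R)\<^sup>2 * sq_norm n x" by (simp add: power_mult_distrib mult_right_mono)
        finally show ?thesis .
      qed
      show "(\<Sum>k<n. complex_of_real (M i k) * H k j) - Complex x0 y * H i j = complex_of_real (d * of_bool (i = j))"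
        if "i < n" for i
      proof -
        have "((\<Sum>k<n. complex_of_real (M i k) * H k j) - z * H i j) / d = of_bool (i = j)"
        proof -
          have "(\<Sum>k<n. Y i k * H k j) = of_bool (i = j)"
            using inv that j by (simp add: mutually_inverse_def)
          then show ?thesis unfolding Y_sum[OF that] .
        qed
        then show ?thesis using d by (simp add: z_def field_simps)
      qed
      have "(2 * d / \<bar>y\<bar>)\<^sup>2 \<le> sq_norm n (\<lambda>k. H k j)" using large by (simp add: power_divide power_mult_distrib)
      then have "2 * d / \<bar>y\<bar> \<le> sqrt (sq_norm n (\<lambda>k. H k j))" by (rule real_le_rsqrt)
      then show "2 * d \<le> \<bar>y\<bar> * sqrt (sq_norm n (\<lambda>k. H k j))" using False by (simp add: field_simps)
    qed (use R in simp)
  qed simp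
  show ?thesis
    unfolding wedge_blowup_def H_def[symmetric] using det sum_ge area by blast
qed

section \<open>Averaging over the shift\<close>

lemma interval_length_le_nn_integral:
  fixes f :: "real \<Rightarrow> ennreal"
  assumes "finite X" "l \<le> u" and f: "\<And>x. l \<le> x \<Longrightarrow> x \<le> u \<Longrightarrow> x \<notin> X \<Longrightarrow> c \<le> f x"
  shows "ennreal (u - l) * c \<le> (\<integral>\<^sup>+x. f x \<partial>lborel)"
proof -
  have "X \<in> null_sets lborel" using assms(1) by (rule finite_imp_null_set_lborel)
  then have "AE x in lborel. x \<notin> X" by (rule AE_not_in)
  then have "(\<integral>\<^sup>+x. c * indicator {l..u} x \<partial>lborel) \<le> (\<integral>\<^sup>+x. f x \<partial>lborel)"
    by (intro nn_integral_mono_AE) (auto elim!: eventually_mono simp: f split: split_indicator)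
  then show ?thesis using assms(2) by (simp add: nn_integral_cmult mult.commute)
qed

text \<open>The source of the logarithm: the skewness constant is proportional to the height of the shift.\<close>
lemma nn_integral_inverse_abs_le:
  assumes s: "0 < s" "s \<le> r"
  shows "(\<integral>\<^sup>+y. indicator {y. s \<le> \<bar>y\<bar> \<and> \<bar>y\<bar> \<le> r} y * ennreal (1 / \<bar>y\<bar>) \<partial>lborel) \<le> ennreal (2 * ln (r / s))"
proof -
  define f where "f y = ennreal (1 / y) * indicator {s..r} y" for y :: real
  have [measurable]: "f \<in> borel_measurable borel" unfolding f_def by measurable
  have "(\<integral>\<^sup>+y. ennreal (1 / y) * indicator {s..r} y \<partial>lborel) = ennreal (ln r - ln s)"
    using s by (intro nn_integral_FTC_Icc) (auto intro!: derivative_eq_intros)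
  then have int: "(\<integral>\<^sup>+y. f y \<partial>lborel) = ennreal (ln (r / s))"
    using s by (simp add: f_def ln_div)
  have int': "(\<integral>\<^sup>+y. f (- y) \<partial>lborel) = ennreal (ln (r / s))"
    using nn_integral_real_affine[of f "-1" 0] by (simp add: int)
  have "(\<integral>\<^sup>+y. indicator {y. s \<le> \<bar>y\<bar> \<and> \<bar>y\<bar> \<le> r} y * ennreal (1 / \<bar>y\<bar>) \<partial>lborel)
      \<le> (\<integral>\<^sup>+y. f y + f (- y) \<partial>lborel)"
    by (intro nn_integral_mono) (auto simp: f_def abs_if split: split_indicator)
  also have "\<dots> = ennreal (ln (r / s)) + ennreal (ln (r / s))"
    by (subst nn_integral_add) (auto simp: int int')
  also have "\<dots> = ennreal (2 * ln (r / s))"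
    using s by (subst ennreal_plus[symmetric]) auto
  finally show ?thesis .
qed

lemma fun_det_cong: "(\<And>i j. i < n \<Longrightarrow> j < n \<Longrightarrow> Y i j = Y' i j) \<Longrightarrow> fun_det n Y = fun_det n Y'"
  unfolding fun_det_def by (intro arg_cong[where f=det] eq_matI) auto

text \<open>The bookkeeping of constants. With \<open>d = \<delta> / sqrt n\<close> the powers of \<open>n\<close> and \<open>\<delta>\<close> combine to \<open>n\<^sup>5 / \<delta>\<^sup>3\<close>, using
  \<open>R \<ge> 1\<close> and \<open>\<delta> < 1\<close> to absorb the terms with \<open>K\<^sup>2 / \<delta>\<^sup>2\<close>, and the logarithm is at least 1.\<close>
lemma gap_constants_le:
  fixes n :: nat and K \<delta> K' s :: real
  assumes n: "n \<ge> 2" and K: "K > 0" and \<delta>: "0 < \<delta>" "\<delta> < 1" and K': "K' > 0" and s: "0 < s" "s \<le> 1"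
  defines "R \<equiv> 1 + \<delta> * K'" and "d \<equiv> \<delta> / sqrt n"
  defines "W \<equiv> d ^ 4 / (36 * s ^ 4)"
  shows "1 / s * (4 * R * (12800 * real n ^ 4 * K\<^sup>2 * W powr - (1/2))) +
      1 / s\<^sup>2 * (4 * R * (2 * ln (2 * R / s) * (16 * real n ^ 2 *
        (800 * real n ^ 2 * K\<^sup>2 * (3 * d) + 512 * real n * sqrt n * K ^ 3 * (6 * R)) * W powr - (3/4))))
    \<le> 20000000 * log 2 (2 * (1 + \<delta> * K') / s) * (1 + \<delta> * K')\<^sup>2 * max (K ^ 2) (K ^ 3) * real n ^ 5 * (s / \<delta> ^ 3)"
proof -
  have R: "R \<ge> 1" using \<delta> K' by (simp add: R_def)
  have d: "d > 0" using \<delta> n by (simp add: d_def)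
  \<comment> \<open>The two summands are bounded by \<open>307200\<close> and \<open>8 * 1313280\<close> times the same quantity.\<close>
  define t where "t = d / s"
  have t: "t > 0" using d s by (simp add: t_def)
  have W: "W = t ^ 4 / 36" by (simp add: W_def t_def power_divide)
  have tp: "t ^ 4 = t powr 4" using t by simp
  have W1: "W powr - (1/2) = 6 / t\<^sup>2"
  proof -
    have "W powr (1/2) = sqrt W" using t by (simp add: powr_half_sqrt W)
    also have "sqrt W = t\<^sup>2 / 6"
      by (rule real_sqrt_unique) (simp_all add: W power_divide power2_eq_square power4_eq_xxxx)
    finally have e: "W powr (1/2) = t\<^sup>2 / 6" .
    show ?thesis unfolding powr_minus_divide e by simp
  qed
  have W2: "W powr - (3/4) \<le> 15 / t ^ 3"
  proof -
    have p36: "(36::real) powr (3/4) \<le> 15"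
    proof -
      have "((36::real) powr (3/4)) ^ 4 = (36 powr (3/4)) powr 4" by simp
      also have "\<dots> = 36 powr 3" unfolding powr_powr by simp
      also have "\<dots> = 36 ^ 3" by simp
      also have "\<dots> \<le> 15 ^ 4" by simp
      finally show ?thesis using power_le_imp_le_base[of "36 powr (3/4::real)" 3 15] by simp
    qed
    have "W powr - (3/4) = 36 powr (3/4) / t powr 3"
      unfolding W tp using t by (simp add: powr_divide powr_powr powr_minus_divide del: powr_numeral)
    also have "t powr 3 = t ^ 3" using t by simp
    finally show ?thesis using p36 t by (simp add: divide_right_mono)
  qed
  define m where "m = max (K ^ 2) (K ^ 3)"
  have m: "K\<^sup>2 \<le> m" "K ^ 3 \<le> m" "0 \<le> m" using K by (auto simp: m_def le_max_iff_disj)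
  define L where "L = log 2 (2 * R / s)"
  have x: "2 * R / s \<ge> 2" using R s by (simp add: field_simps)
  have L1: "L \<ge> 1" unfolding L_def using x by (subst le_log_iff) auto
  have L2: "ln (2 * R / s) \<le> L"
  proof -
    have "ln (2 * R / s) \<ge> 0" using x by (intro ln_ge_zero) linarith
    moreover have "ln 2 \<le> (1::real)" using ln_le_minus_one[of "2::real"] by simp
    ultimately have "ln (2 * R / s) * ln 2 \<le> ln (2 * R / s)" by (simp add: mult_left_le)
    then show ?thesis by (simp add: L_def log_def field_simps)
  qed
  have sq: "sqrt n > 0" using n by simp
  have sqn: "sqrt n * sqrt n = real n" by simp
  have d2: "d\<^sup>2 = \<delta>\<^sup>2 / n" using n by (simp add: d_def power_divide)
  have d3: "d ^ 3 = \<delta> ^ 3 / (n * sqrt n)" by (simp add: d_def power_divide power3_eq_cube)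
  define Q where "Q = m * real n ^ 5 * (s / \<delta> ^ 3)"
  have Q: "Q \<ge> 0" using m s \<delta> by (simp add: Q_def)
  have K2: "K\<^sup>2 / \<delta>\<^sup>2 \<le> m / \<delta> ^ 3"
  proof -
    have "\<delta> ^ 3 \<le> \<delta>\<^sup>2" using \<delta> by (intro power_decreasing) auto
    then show ?thesis using m \<delta> by (intro frac_le) auto
  qed
  have first: "1 / s * (4 * R * (12800 * real n ^ 4 * K\<^sup>2 * W powr - (1/2))) \<le> 307200 * (L * R\<^sup>2 * Q)"
  proof -
    have "1 / s * (4 * R * (12800 * real n ^ 4 * K\<^sup>2 * W powr - (1/2)))
        = 307200 * (R * (real n ^ 5 * s * (K\<^sup>2 / \<delta>\<^sup>2)))"
      unfolding W1 t_def power_divide d2 using s \<delta> n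
      by (simp add: field_simps power2_eq_square eval_nat_numeral)
    also have "\<dots> \<le> 307200 * (R * (real n ^ 5 * s * (m / \<delta> ^ 3)))"
      using R s K2 by (intro mult_left_mono) auto
    also have "\<dots> = 307200 * (1 * R * Q)" by (simp add: Q_def)
    also have "\<dots> \<le> 307200 * (L * R\<^sup>2 * Q)"
      using L1 R Q by (intro mult_left_mono mult_right_mono mult_mono) (auto simp: power2_eq_square)
    finally show ?thesis .
  qed
  let ?C = "800 * real n ^ 2 * K\<^sup>2 * (3 * d) + 512 * real n * sqrt n * K ^ 3 * (6 * R)"
  have C: "?C * (1 / d ^ 3) \<le> 5472 * (real n ^ 3 * (m / \<delta> ^ 3) * R)"
  proof -
    have "?C * (1 / d ^ 3) = 2400 * real n ^ 2 * K\<^sup>2 * (1 / d\<^sup>2) + 3072 * real n * sqrt n * K ^ 3 * R * (1 / d ^ 3)"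
      using d by (simp add: field_simps power2_eq_square power3_eq_cube)
    also have "2400 * real n ^ 2 * K\<^sup>2 * (1 / d\<^sup>2) = 2400 * (real n ^ 3 * (K\<^sup>2 / \<delta>\<^sup>2))"
      unfolding d2 using n \<delta> by (simp add: field_simps power2_eq_square power3_eq_cube)
    also have "3072 * real n * sqrt n * K ^ 3 * R * (1 / d ^ 3) = 3072 * (real n * (sqrt n * sqrt n) * n * (K ^ 3 / \<delta> ^ 3) * R)"
      unfolding d3 using n \<delta> by (simp add: field_simps)
    also have "\<dots> = 3072 * (real n ^ 3 * (K ^ 3 / \<delta> ^ 3) * R)" unfolding sqn by (simp add: power3_eq_cube)
    also have "2400 * (real n ^ 3 * (K\<^sup>2 / \<delta>\<^sup>2)) + \<dots>
        \<le> 2400 * (real n ^ 3 * (m / \<delta> ^ 3) * R) + 3072 * (real n ^ 3 * (m / \<delta> ^ 3) * R)"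
    proof (intro add_mono mult_left_mono mult_right_mono)
      have "real n ^ 3 * (K\<^sup>2 / \<delta>\<^sup>2) \<le> real n ^ 3 * (m / \<delta> ^ 3) * 1"
        unfolding mult_1_right by (intro mult_left_mono K2) simp
      also have "\<dots> \<le> real n ^ 3 * (m / \<delta> ^ 3) * R"
        using R m \<delta> by (intro mult_left_mono) auto
      finally show "real n ^ 3 * (K\<^sup>2 / \<delta>\<^sup>2) \<le> real n ^ 3 * (m / \<delta> ^ 3) * R" .
    qed (use R m \<delta> in \<open>auto intro: divide_right_mono\<close>)
    also have "\<dots> = 5472 * (real n ^ 3 * (m / \<delta> ^ 3) * R)"
      unfolding distrib_right[symmetric] by simp
    finally show ?thesis .
  qed
  have second: "1 / s\<^sup>2 * (4 * R * (2 * ln (2 * R / s) * (16 * real n ^ 2 * ?C * W powr - (3/4))))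
      \<le> 10506240 * (L * R\<^sup>2 * Q)"
  proof -
    have C0: "0 \<le> ?C" using d K R by (intro add_nonneg_nonneg) auto
    have "16 * real n ^ 2 * ?C * W powr - (3/4) \<le> 16 * real n ^ 2 * ?C * (15 / t ^ 3)"
      by (intro mult_left_mono W2 mult_nonneg_nonneg C0) auto
    also have "\<dots> = 240 * real n ^ 2 * s ^ 3 * (?C * (1 / d ^ 3))"
      by (simp add: t_def power_divide)
    also have "\<dots> \<le> 240 * real n ^ 2 * s ^ 3 * (5472 * (real n ^ 3 * (m / \<delta> ^ 3) * R))"
      using s by (intro mult_left_mono C) auto
    also have "\<dots> = 1313280 * s\<^sup>2 * (Q * R)"
      by (simp add: Q_def eval_nat_numeral)
    finally have 1: "16 * real n ^ 2 * ?C * W powr - (3/4) \<le> 1313280 * s\<^sup>2 * (Q * R)" .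
    have "1 / s\<^sup>2 * (4 * R * (2 * ln (2 * R / s) * (16 * real n ^ 2 * ?C * W powr - (3/4))))
        \<le> 1 / s\<^sup>2 * (4 * R * (2 * L * (1313280 * s\<^sup>2 * (Q * R))))"
      using R x L2 L1 s Q by (intro mult_left_mono mult_mono 1 mult_nonneg_nonneg C0) auto
    also have "\<dots> = 10506240 * (L * R\<^sup>2 * Q)"
      using s by (simp add: power2_eq_square)
    finally show ?thesis .
  qed
  have "0 \<le> L * R\<^sup>2 * Q" using L1 Q by simp
  then have "1 / s * (4 * R * (12800 * real n ^ 4 * K\<^sup>2 * W powr - (1/2))) +
      1 / s\<^sup>2 * (4 * R * (2 * ln (2 * R / s) * (16 * real n ^ 2 * ?C * W powr - (3/4))))
      \<le> 20000000 * (L * R\<^sup>2 * Q)"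
    using first second by linarith
  also have "20000000 * (L * R\<^sup>2 * Q) = 20000000 * log 2 (2 * (1 + \<delta> * K') / s) * (1 + \<delta> * K')\<^sup>2 * max (K ^ 2) (K ^ 3) * real n ^ 5 * (s / \<delta> ^ 3)"
    by (simp add: L_def R_def Q_def m_def)
  finally show ?thesis .
qed

context bounded_density
begin

text \<open>On the gap event the good shifts fill an interval of length \<open>s\<close> or a square of area \<open>s\<^sup>2\<close>, so its
  probability is at most the integral of the pointwise probabilities divided by \<open>s\<close> or \<open>s\<^sup>2\<close>. The value of
  \<open>W\<close> fits distances at most \<open>3 s\<close> and \<open>4 s\<close> of the two eigenvalues from the shift. Integrating over shifts,
  instead of summing over a net, disposes of shifts for which \<open>M - z\<close> is singular.\<close>
lemma prob_gap_event_le: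
  fixes n :: nat and A :: "real mat" and \<delta> K' s :: real
  assumes n: "n \<ge> 2" and A: "A \<in> carrier_mat n n" "op_norm A \<le> 1"
    and \<delta>: "0 < \<delta>" "\<delta> < 1" and K': "K' > 0" and s: "0 < s" "s \<le> 1"
    and E: "E \<in> sets (iid ({..<n} \<times> {..<n}))"
    and E_gap: "\<And>\<omega>. \<omega> \<in> E \<Longrightarrow> op_norm (G_mat n \<omega>) \<le> K' \<and> eigenvalue_gap (A + \<delta> \<cdot>\<^sub>m G_mat n \<omega>) \<le> s"
  defines "R \<equiv> 1 + \<delta> * K'" and "d \<equiv> \<delta> / sqrt n"
  defines "W \<equiv> d ^ 4 / (36 * s ^ 4)"
  shows "emeasure (iid ({..<n} \<times> {..<n})) E \<le> ennreal (
      1 / s * (4 * R * (12800 * real n ^ 4 * K\<^sup>2 * W powr - (1/2))) +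
      1 / s\<^sup>2 * (4 * R * (2 * ln (2 * R / s) * (16 * real n ^ 2 *
        (800 * real n ^ 2 * K\<^sup>2 * (3 * d) + 512 * real n * sqrt n * K ^ 3 * (6 * R)) * W powr - (3/4)))))"
proof -
  let ?S = "{..<n} \<times> {..<n}"
  let ?P = "iid ?S"
  interpret P: prob_space ?P by (rule prob_space_iid)
  interpret PL: pair_sigma_finite ?P lborel ..
  have R: "R \<ge> 1" using \<delta> K' by (simp add: R_def)
  have d: "d > 0" using \<delta> n by (simp add: d_def)
  have W: "W > 0" using d s by (simp add: W_def)
  \<comment> \<open>\<open>perturbed (D x y) \<omega>\<close> is \<open>(M - z) / d\<close> for the shift \<open>z = x + i y\<close>.\<close>
  define D where "D x y i j = (complex_of_real (A $$ (i, j)) - Complex x y * of_bool (i = j)) / complex_of_real d" for x y i j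
  define B where "B \<omega> x y \<longleftrightarrow> wedge_blowup n (perturbed (D x y) \<omega>) (4 * d\<^sup>2 / y\<^sup>2) (\<bar>y\<bar> / (6 * R)) W" for \<omega> x y
  define b :: "_ \<Rightarrow> _ \<Rightarrow> _ \<Rightarrow> ennreal" where "b \<omega> x y = indicator {\<omega>. B \<omega> x y} \<omega>" for \<omega> x y
  define X where "X = {- (2 * R)..2 * R}"
  define Y where "Y = {y. s \<le> \<bar>y\<bar> \<and> \<bar>y\<bar> \<le> 2 * R}"
  have XY [measurable]: "X \<in> sets borel" "Y \<in> sets borel" unfolding X_def Y_def by measurable
  define f where "f \<omega> x = indicator X x * b \<omega> x 0" for \<omega> x
  define g where "g \<omega> x y = indicator X x * (indicator Y y * b \<omega> x y)" for \<omega> x y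

  have b_meas [measurable]: "(\<lambda>p. b (fst (fst p)) (snd (fst p)) (snd p)) \<in> borel_measurable ((?P \<Otimes>\<^sub>M lborel) \<Otimes>\<^sub>M lborel)"
  proof -
    let ?N = "(?P \<Otimes>\<^sub>M lborel) \<Otimes>\<^sub>M (lborel :: real measure)"
    have entry: "(\<lambda>p. perturbed (D (snd (fst p)) (snd p)) (fst (fst p)) i j) \<in> borel_measurable ?N"
      if ij: "i < n" "j < n" for i j
    proof -
      have "(\<lambda>\<omega>. \<omega> (i, j)) \<in> ?P \<rightarrow>\<^sub>M \<xi>"
        using ij by (intro measurable_component_singleton) auto
      then have [measurable]: "(\<lambda>\<omega>. \<omega> (i, j)) \<in> borel_measurable ?P"
        by (simp add: measurable_cong_sets[OF refl sets_law])
      show ?thesis unfolding perturbed_def D_def Complex_eq by measurable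
    qed
    have "Measurable.pred ?N (\<lambda>p. B (fst (fst p)) (snd (fst p)) (snd p))"
      unfolding B_def by (rule pred_wedge_blowup[OF entry]) measurable
    then have "(\<lambda>p. if B (fst (fst p)) (snd (fst p)) (snd p) then 1 else 0 :: ennreal) \<in> borel_measurable ?N"
      by measurable
    then show ?thesis by (simp add: b_def indicator_def of_bool_def)
  qed
  have b0_meas [measurable]: "(\<lambda>p. b (fst p) (snd p) 0) \<in> borel_measurable (?P \<Otimes>\<^sub>M lborel)"
  proof -
    have "(\<lambda>p. (p, 0::real)) \<in> ?P \<Otimes>\<^sub>M lborel \<rightarrow>\<^sub>M (?P \<Otimes>\<^sub>M lborel) \<Otimes>\<^sub>M lborel" by measurable
    from measurable_compose[OF this b_meas] show ?thesis by simp
  qed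
  have f_meas: "(\<lambda>(\<omega>, x). f \<omega> x) \<in> borel_measurable (?P \<Otimes>\<^sub>M lborel)"
    unfolding f_def case_prod_unfold by measurable
  have g_meas: "(\<lambda>p. g (fst (fst p)) (snd (fst p)) (snd p)) \<in> borel_measurable ((?P \<Otimes>\<^sub>M lborel) \<Otimes>\<^sub>M lborel)"
    unfolding g_def by measurable
  have g_meas': "(\<lambda>(\<omega>, x). \<integral>\<^sup>+y. g \<omega> x y \<partial>lborel) \<in> borel_measurable (?P \<Otimes>\<^sub>M lborel)"
  proof -
    have "(\<lambda>p. \<integral>\<^sup>+y. g (fst p) (snd p) y \<partial>lborel) \<in> borel_measurable (?P \<Otimes>\<^sub>M lborel)"
      by (rule lborel.borel_measurable_nn_integral) (use g_meas in \<open>simp add: case_prod_unfold\<close>)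
    then show ?thesis by (simp add: case_prod_unfold)
  qed
  have g_meas_x: "(\<lambda>(\<omega>, y). g \<omega> x y) \<in> borel_measurable (?P \<Otimes>\<^sub>M lborel)" for x
  proof -
    have "(\<lambda>p. ((fst p, x), snd p)) \<in> ?P \<Otimes>\<^sub>M lborel \<rightarrow>\<^sub>M (?P \<Otimes>\<^sub>M lborel) \<Otimes>\<^sub>M lborel" by measurable
    from measurable_compose[OF this g_meas] show ?thesis by (simp add: case_prod_unfold)
  qed

  define B1 where "B1 = 12800 * real n ^ 4 * K\<^sup>2 * W powr - (1/2)"
  define B0 where "B0 = 16 * real n ^ 2 * (800 * real n ^ 2 * K\<^sup>2 * (3 * d) + 512 * real n * sqrt n * K ^ 3 * (6 * R)) * W powr - (3/4)"
  have B1: "B1 \<ge> 0" by (simp add: B1_def)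
  have B0: "B0 \<ge> 0" using d K_pos R by (simp add: B0_def)
  define \<Lambda> where "\<Lambda> = ln (2 * R / s)"
  have \<Lambda>: "\<Lambda> \<ge> 0" unfolding \<Lambda>_def using R s by (intro ln_ge_zero) (simp add: field_simps)
  have X_int: "(\<integral>\<^sup>+x. indicator X x * ennreal c \<partial>lborel) = ennreal (4 * R * c)" if "c \<ge> 0" for c
    using R that by (simp add: X_def nn_integral_multc flip: ennreal_mult)

  have T1: "(\<integral>\<^sup>+\<omega>. \<integral>\<^sup>+x. f \<omega> x \<partial>lborel \<partial>?P) \<le> ennreal (4 * R * B1)"
  proof -
    have "(\<integral>\<^sup>+\<omega>. \<integral>\<^sup>+x. f \<omega> x \<partial>lborel \<partial>?P) = (\<integral>\<^sup>+x. \<integral>\<^sup>+\<omega>. f \<omega> x \<partial>?P \<partial>lborel)"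
      by (rule PL.Fubini'[OF f_meas, symmetric])
    also have "\<dots> \<le> (\<integral>\<^sup>+x. indicator X x * ennreal B1 \<partial>lborel)"
    proof (rule nn_integral_mono)
      fix x
      have "(\<integral>\<^sup>+\<omega>. b \<omega> x 0 \<partial>?P) \<le> ennreal B1"
        unfolding b_def B_def B1_def using W by (rule prob_wedge_blowup_le)
      then show "(\<integral>\<^sup>+\<omega>. f \<omega> x \<partial>?P) \<le> indicator X x * ennreal B1"
        by (cases "x \<in> X") (simp_all add: f_def)
    qed
    finally show ?thesis using B1 by (simp add: X_int)
  qed

  have T2: "(\<integral>\<^sup>+\<omega>. \<integral>\<^sup>+x. \<integral>\<^sup>+y. g \<omega> x y \<partial>lborel \<partial>lborel \<partial>?P) \<le> ennreal (4 * R * (2 * \<Lambda> * B0))"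
  proof -
    have "(\<integral>\<^sup>+\<omega>. \<integral>\<^sup>+x. \<integral>\<^sup>+y. g \<omega> x y \<partial>lborel \<partial>lborel \<partial>?P)
        = (\<integral>\<^sup>+x. \<integral>\<^sup>+\<omega>. \<integral>\<^sup>+y. g \<omega> x y \<partial>lborel \<partial>?P \<partial>lborel)"
      by (rule PL.Fubini'[OF g_meas', symmetric])
    also have "\<dots> = (\<integral>\<^sup>+x. \<integral>\<^sup>+y. \<integral>\<^sup>+\<omega>. g \<omega> x y \<partial>?P \<partial>lborel \<partial>lborel)"
      by (intro nn_integral_cong PL.Fubini'[OF g_meas_x, symmetric])
    also have "\<dots> \<le> (\<integral>\<^sup>+x. indicator X x * ennreal (2 * \<Lambda> * B0) \<partial>lborel)"
    proof (rule nn_integral_mono)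
      fix x
      have prob: "(\<integral>\<^sup>+\<omega>. b \<omega> x y \<partial>?P) \<le> ennreal B0 * ennreal (1 / \<bar>y\<bar>)" if "y \<in> Y" for y
      proof -
        have y: "\<bar>y\<bar> > 0" using that s by (auto simp: Y_def)
        have sqrt_\<theta>: "sqrt (2 * (4 * d\<^sup>2 / y\<^sup>2)) \<le> 3 * d / \<bar>y\<bar>"
        proof (rule real_le_lsqrt)
          have "2 * (4 * d\<^sup>2 / y\<^sup>2) \<le> 9 * d\<^sup>2 / y\<^sup>2" by (simp add: divide_right_mono)
          also have "\<dots> = (3 * d / \<bar>y\<bar>)\<^sup>2" by (simp add: power_divide power_mult_distrib)
          finally show "2 * (4 * d\<^sup>2 / y\<^sup>2) \<le> (3 * d / \<bar>y\<bar>)\<^sup>2" .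
        qed (use d in auto)
        let ?C = "800 * real n ^ 2 * K\<^sup>2 * sqrt (2 * (4 * d\<^sup>2 / y\<^sup>2)) + 512 * real n * sqrt n * K ^ 3 / (\<bar>y\<bar> / (6 * R))"
        have "(\<integral>\<^sup>+\<omega>. b \<omega> x y \<partial>?P) \<le> ennreal (16 * real n ^ 2 * ?C * W powr - (3/4))"
          unfolding b_def B_def using y d R by (intro prob_wedge_blowup_le_of_skew W) auto
        also have "\<dots> \<le> ennreal (B0 * (1 / \<bar>y\<bar>))"
        proof (rule ennreal_leI)
          have "?C \<le> 800 * real n ^ 2 * K\<^sup>2 * (3 * d / \<bar>y\<bar>) + 512 * real n * sqrt n * K ^ 3 * (6 * R) / \<bar>y\<bar>"
            by (intro add_mono mult_left_mono sqrt_\<theta>) auto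
          also have "\<dots> = (800 * real n ^ 2 * K\<^sup>2 * (3 * d) + 512 * real n * sqrt n * K ^ 3 * (6 * R)) * (1 / \<bar>y\<bar>)"
            by (simp add: add_divide_distrib)
          finally have C: "?C \<le> \<dots>" .
          have "16 * real n ^ 2 * ?C * W powr - (3/4) \<le> 16 * real n ^ 2 *
              ((800 * real n ^ 2 * K\<^sup>2 * (3 * d) + 512 * real n * sqrt n * K ^ 3 * (6 * R)) * (1 / \<bar>y\<bar>)) * W powr - (3/4)"
            by (intro mult_right_mono mult_left_mono C) auto
          also have "\<dots> = B0 * (1 / \<bar>y\<bar>)" by (simp only: B0_def mult_ac)
          finally show "16 * real n ^ 2 * ?C * W powr - (3/4) \<le> B0 * (1 / \<bar>y\<bar>)" .
        qed
        also have "\<dots> = ennreal B0 * ennreal (1 / \<bar>y\<bar>)" using B0 by (intro ennreal_mult) auto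
        finally show ?thesis .
      qed
      have "(\<integral>\<^sup>+y. \<integral>\<^sup>+\<omega>. g \<omega> x y \<partial>?P \<partial>lborel)
          \<le> (\<integral>\<^sup>+y. indicator X x * ennreal B0 * (indicator Y y * ennreal (1 / \<bar>y\<bar>)) \<partial>lborel)"
      proof (rule nn_integral_mono)
        fix y
        show "(\<integral>\<^sup>+\<omega>. g \<omega> x y \<partial>?P) \<le> indicator X x * ennreal B0 * (indicator Y y * ennreal (1 / \<bar>y\<bar>))"
          using prob[of y] by (cases "x \<in> X"; cases "y \<in> Y") (simp_all add: g_def)
      qed
      also have "\<dots> = indicator X x * ennreal B0 * (\<integral>\<^sup>+y. indicator Y y * ennreal (1 / \<bar>y\<bar>) \<partial>lborel)"
        by (rule nn_integral_cmult) measurable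
      also have "\<dots> \<le> indicator X x * ennreal B0 * ennreal (2 * \<Lambda>)"
        unfolding Y_def \<Lambda>_def using s R by (intro mult_left_mono nn_integral_inverse_abs_le) auto
      also have "\<dots> = indicator X x * ennreal (2 * \<Lambda> * B0)"
        using B0 \<Lambda> by (simp add: mult.assoc mult.commute[of B0] flip: ennreal_mult)
      finally show "(\<integral>\<^sup>+y. \<integral>\<^sup>+\<omega>. g \<omega> x y \<partial>?P \<partial>lborel) \<le> indicator X x * ennreal (2 * \<Lambda> * B0)" .
    qed
    finally show ?thesis using B0 \<Lambda> by (simp add: X_int)
  qed

  have pointwise: "1 \<le> ennreal (1 / s) * (\<integral>\<^sup>+x. f \<omega> x \<partial>lborel) +
      ennreal (1 / s\<^sup>2) * (\<integral>\<^sup>+x. \<integral>\<^sup>+y. g \<omega> x y \<partial>lborel \<partial>lborel)" if \<omega>: "\<omega> \<in> E" for \<omega>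
  proof -
    define M where "M = A + \<delta> \<cdot>\<^sub>m G_mat n \<omega>"
    have G: "G_mat n \<omega> \<in> carrier_mat n n" by (simp add: G_mat_def)
    have M: "M \<in> carrier_mat n n" using A G by (simp add: M_def)
    let ?Mc = "map_mat complex_of_real M"
    have Mc: "?Mc \<in> carrier_mat n n" using M by simp
    define m where "m i j = A $$ (i, j) + d * \<omega> (i, j)" for i j
    have m: "M $$ (i, j) = m i j" if "i < n" "j < n" for i j
      using that A by (simp add: M_def m_def d_def G_mat_def)
    obtain a a' where aa: "{#a, a'#} \<subseteq># proots (char_poly ?Mc)" and gap: "cmod (a - a') \<le> s"
      using eigenvalue_gap_le_imp_pair[OF M n] E_gap[OF \<omega>] unfolding M_def by blast
    obtain u v c where u0: "\<forall>i<n. (\<Sum>k<n. ?Mc $$ (i, k) * u k) = a * u i"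
      and v0: "\<forall>i<n. (\<Sum>k<n. ?Mc $$ (i, k) * v k) = a' * v i + c * u i" and uv: "wedge_sq n u v > 0"
      using two_generalized_eigenvectors[OF Mc aa] by blast
    have Mc_sum: "(\<Sum>k<n. ?Mc $$ (i, k) * x k) = (\<Sum>k<n. complex_of_real (m i k) * x k)" if "i < n" for i x
      using that M by (intro sum.cong refl) (simp add: m)
    have u: "(\<Sum>k<n. complex_of_real (m i k) * u k) = a * u i" if "i < n" for i
      by (rule trans[OF Mc_sum[OF that, symmetric] u0[rule_format, OF that]])
    have v: "(\<Sum>k<n. complex_of_real (m i k) * v k) = a' * v i + c * u i" if "i < n" for i
      by (rule trans[OF Mc_sum[OF that, symmetric] v0[rule_format, OF that]])
    have bound: "sq_norm n (\<lambda>i. \<Sum>k<n. complex_of_real (m i k) * x k) \<le> R\<^sup>2 * sq_norm n x" for x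
    proof (rule sq_norm_real_matrix_le)
      fix x :: "nat \<Rightarrow> real"
      have "(\<Sum>i<n. (\<Sum>k<n. M $$ (i, k) * x k)\<^sup>2) \<le> (1 + \<delta> * K')\<^sup>2 * (\<Sum>k<n. (x k)\<^sup>2)"
        unfolding M_def using A G E_gap[OF \<omega>] \<delta> by (intro sum_squares_perturbation_le) auto
      then show "(\<Sum>i<n. (\<Sum>k<n. m i k * x k)\<^sup>2) \<le> R\<^sup>2 * (\<Sum>k<n. (x k)\<^sup>2)"
        by (simp add: R_def m)
    qed
    have aR: "cmod a \<le> R"
    proof -
      have "sq_norm n u > 0" using uv wedge_sq_le[of n u v] sq_norm_nonneg[of n u]
        by (metis less_le mult_zero_left mult_zero_right not_less)
      moreover have "(cmod a)\<^sup>2 * sq_norm n u \<le> R\<^sup>2 * sq_norm n u"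
        using bound[of u] sq_norm_cong[of n "\<lambda>i. \<Sum>k<n. complex_of_real (m i k) * u k" "\<lambda>i. a * u i", OF u]
        by (simp add: sq_norm_scale)
      ultimately have "(cmod a)\<^sup>2 \<le> R\<^sup>2" by simp
      then show ?thesis by (rule power2_le_imp_le) (use R in simp)
    qed
    \<comment> \<open>The finitely many shifts that are eigenvalues carry no mass in the integrals over the shift.\<close>
    define Z where "Z = {z. fun_det n (\<lambda>i j. (?Mc $$ (i, j) - z * of_bool (i = j)) / complex_of_real d) = 0}"
    have Z: "finite Z" unfolding Z_def using d by (intro finite_singular_shifts[OF Mc]) auto
    have pert: "perturbed (D x y) \<omega> = (\<lambda>i j. (complex_of_real (m i j) - Complex x y * of_bool (i = j)) / complex_of_real d)" for x y
      using d by (intro ext) (simp add: perturbed_def D_def m_def field_simps)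
    have B: "B \<omega> x y" if z: "Complex x y \<notin> Z" "cmod (Complex x y) \<le> 4 * R"
      and close: "cmod (a - Complex x y) \<le> 3 * s" "cmod (a' - Complex x y) \<le> 4 * s" for x y
      unfolding B_def pert
    proof (rule wedge_blowup_near_eigenvalues[OF u v uv bound _ d z(2)])
      have "cmod ((a - Complex x y) * (a' - Complex x y)) \<le> 3 * s * (4 * s)"
        unfolding norm_mult using close s by (intro mult_mono) auto
      then have "(cmod ((a - Complex x y) * (a' - Complex x y)))\<^sup>2 \<le> (3 * s * (4 * s))\<^sup>2"
        by (intro power_mono) auto
      then have "W * (cmod ((a - Complex x y) * (a' - Complex x y)))\<^sup>2 \<le> W * (3 * s * (4 * s))\<^sup>2"
        using W by (intro mult_left_mono) auto
      also have "\<dots> = 4 * d ^ 4"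
        using s by (simp add: W_def power2_eq_square power4_eq_xxxx)
      finally show "W * (cmod ((a - Complex x y) * (a' - Complex x y)))\<^sup>2 \<le> 4 * d ^ 4" .
      have "fun_det n (\<lambda>i j. (complex_of_real (m i j) - Complex x y * of_bool (i = j)) / complex_of_real d)
          = fun_det n (\<lambda>i j. (?Mc $$ (i, j) - Complex x y * of_bool (i = j)) / complex_of_real d)"
        using M by (intro fun_det_cong) (simp add: m)
      then show "fun_det n (\<lambda>i j. (complex_of_real (m i j) - Complex x y * of_bool (i = j)) / complex_of_real d) \<noteq> 0"
        using z(1) by (simp add: Z_def)
    qed (use R in auto)
    have cmod_le: "cmod (Complex x y) \<le> \<bar>x\<bar> + \<bar>y\<bar>" for x y
      using cmod_le[of "Complex x y"] by simp
    have a_diff: "a - Complex x y = Complex (Re a - x) (Im a - y)" for x y by (simp add: complex_eq_iff)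
    have close': "cmod (a' - Complex x y) \<le> cmod (a - Complex x y) + s" for x y
      using norm_triangle_ineq[of "a' - a" "a - Complex x y"] gap by (simp add: norm_minus_commute)
    have ReR: "\<bar>Re a\<bar> \<le> R" and ImR: "\<bar>Im a\<bar> \<le> R"
      using aR abs_Re_le_cmod[of a] abs_Im_le_cmod[of a] by linarith+
    show ?thesis
    \<comment> \<open>Either a whole interval of real shifts, of length \<open>s\<close>, or a whole square of shifts at height at
        least \<open>s\<close>, of side \<open>s\<close>, is close to both eigenvalues.\<close>
    proof (cases "\<bar>Im a\<bar> \<le> 2 * s")
      case True
      have "ennreal ((Re a + s / 2) - (Re a - s / 2)) * 1 \<le> (\<integral>\<^sup>+x. f \<omega> x \<partial>lborel)"
      proof (rule interval_length_le_nn_integral)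
        show "finite (Re ` Z)" using Z by simp
        fix x assume x: "Re a - s / 2 \<le> x" "x \<le> Re a + s / 2" "x \<notin> Re ` Z"
        have xr: "\<bar>x\<bar> \<le> 2 * R" using x(1,2) ReR s R by linarith
        have zc: "cmod (a - Complex x 0) \<le> 3 * s"
          unfolding a_diff by (rule order.trans[OF cmod_le]) (use x True s in simp)
        have "Complex x 0 \<notin> Z" using x(3) by force
        moreover have "cmod (Complex x 0) \<le> 4 * R"
          by (rule order.trans[OF cmod_le]) (use xr R in simp)
        ultimately have "B \<omega> x 0" using zc close'[of x 0] by (intro B) linarith+
        moreover have "x \<in> X" using xr by (simp add: X_def abs_le_iff)
        ultimately show "1 \<le> f \<omega> x" by (simp add: f_def b_def)
      qed (use s in simp)
      then have "ennreal s \<le> (\<integral>\<^sup>+x. f \<omega> x \<partial>lborel)" by simp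
      then have "ennreal (1 / s) * ennreal s \<le> ennreal (1 / s) * (\<integral>\<^sup>+x. f \<omega> x \<partial>lborel)"
        by (intro mult_left_mono) auto
      moreover have "ennreal (1 / s) * ennreal s = 1" using s by (simp flip: ennreal_mult)
      ultimately show ?thesis by (simp add: add_increasing2)
    next
      case False
      have inner: "ennreal s \<le> (\<integral>\<^sup>+y. g \<omega> x y \<partial>lborel)" if x: "Re a - s / 2 \<le> x" "x \<le> Re a + s / 2" for x
      proof -
        have xr: "\<bar>x\<bar> \<le> 2 * R" using x ReR s R by linarith
        have "ennreal ((Im a + s / 2) - (Im a - s / 2)) * 1 \<le> (\<integral>\<^sup>+y. g \<omega> x y \<partial>lborel)"
        proof (rule interval_length_le_nn_integral)
          show "finite (Im ` Z)" using Z by simp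
          fix y assume y: "Im a - s / 2 \<le> y" "y \<le> Im a + s / 2" "y \<notin> Im ` Z"
          have yr: "s \<le> \<bar>y\<bar>" "\<bar>y\<bar> \<le> 2 * R" using y(1,2) ImR False s R by linarith+
          have zc: "cmod (a - Complex x y) \<le> s"
            unfolding a_diff by (rule order.trans[OF cmod_le]) (use x y(1,2) in simp)
          have "Complex x y \<notin> Z" using y(3) by force
          moreover have "cmod (Complex x y) \<le> 4 * R"
            by (rule order.trans[OF cmod_le]) (use xr yr in simp)
          ultimately have "B \<omega> x y" using zc close'[of x y] s by (intro B) linarith+
          moreover have "x \<in> X" "y \<in> Y" using xr yr by (auto simp: X_def Y_def abs_le_iff)
          ultimately show "1 \<le> g \<omega> x y" by (simp add: g_def b_def)
        qed (use s in simp)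
        then show ?thesis by simp
      qed
      have "ennreal ((Re a + s / 2) - (Re a - s / 2)) * ennreal s
          \<le> (\<integral>\<^sup>+x. \<integral>\<^sup>+y. g \<omega> x y \<partial>lborel \<partial>lborel)"
        by (rule interval_length_le_nn_integral[of "{}"]) (use s inner in auto)
      then have "ennreal (s\<^sup>2) \<le> (\<integral>\<^sup>+x. \<integral>\<^sup>+y. g \<omega> x y \<partial>lborel \<partial>lborel)"
        using s by (simp add: power2_eq_square ennreal_mult)
      then have "ennreal (1 / s\<^sup>2) * ennreal (s\<^sup>2)
          \<le> ennreal (1 / s\<^sup>2) * (\<integral>\<^sup>+x. \<integral>\<^sup>+y. g \<omega> x y \<partial>lborel \<partial>lborel)"
        by (intro mult_left_mono) auto
      moreover have "ennreal (1 / s\<^sup>2) * ennreal (s\<^sup>2) = 1" using s by (simp flip: ennreal_mult)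
      ultimately show ?thesis by (simp add: add_increasing)
    qed
  qed

  have "emeasure ?P E = (\<integral>\<^sup>+\<omega>. indicator E \<omega> \<partial>?P)" using E by simp
  also have "\<dots> \<le> (\<integral>\<^sup>+\<omega>. ennreal (1 / s) * (\<integral>\<^sup>+x. f \<omega> x \<partial>lborel) +
      ennreal (1 / s\<^sup>2) * (\<integral>\<^sup>+x. \<integral>\<^sup>+y. g \<omega> x y \<partial>lborel \<partial>lborel) \<partial>?P)"
    using pointwise by (intro nn_integral_mono) (auto split: split_indicator)
  also have "\<dots> = ennreal (1 / s) * (\<integral>\<^sup>+\<omega>. \<integral>\<^sup>+x. f \<omega> x \<partial>lborel \<partial>?P) +
      ennreal (1 / s\<^sup>2) * (\<integral>\<^sup>+\<omega>. \<integral>\<^sup>+x. \<integral>\<^sup>+y. g \<omega> x y \<partial>lborel \<partial>lborel \<partial>?P)"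
  proof -
    have [measurable]: "(\<lambda>\<omega>. \<integral>\<^sup>+x. f \<omega> x \<partial>lborel) \<in> borel_measurable ?P"
      using f_meas by (rule lborel.borel_measurable_nn_integral)
    have [measurable]: "(\<lambda>\<omega>. \<integral>\<^sup>+x. \<integral>\<^sup>+y. g \<omega> x y \<partial>lborel \<partial>lborel) \<in> borel_measurable ?P"
      using g_meas' by (rule lborel.borel_measurable_nn_integral)
    show ?thesis by (simp add: nn_integral_add nn_integral_cmult)
  qed
  also have "\<dots> \<le> ennreal (1 / s) * ennreal (4 * R * B1) + ennreal (1 / s\<^sup>2) * ennreal (4 * R * (2 * \<Lambda> * B0))"
    by (intro add_mono mult_left_mono T1 T2) auto
  also have "\<dots> = ennreal (1 / s * (4 * R * B1) + 1 / s\<^sup>2 * (4 * R * (2 * \<Lambda> * B0)))"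
  proof -
    have p: "0 \<le> 4 * R * B1" "0 \<le> 4 * R * (2 * \<Lambda> * B0)" "0 \<le> 1 / s" "0 \<le> 1 / s\<^sup>2"
      using s R B1 B0 \<Lambda> by auto
    show ?thesis
      using p by (simp only: ennreal_mult[symmetric] ennreal_plus[symmetric] mult_nonneg_nonneg)
  qed
  finally show ?thesis by (simp only: B1_def B0_def \<Lambda>_def)
qed

end

lemma bounded_densityI:
  assumes "prob_space \<xi>" and "has_continuous_density_bounded_by \<xi> K"
  shows "bounded_density \<xi> K"
proof -
  obtain f where f: "continuous_on UNIV f" "\<And>x. 0 \<le> f x \<and> f x \<le> K"
    and \<xi>: "\<xi> = density lborel (\<lambda>x. ennreal (f x))"
    using assms(2) unfolding has_continuous_density_bounded_by_def by blast
  have [measurable]: "f \<in> borel_measurable borel"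
    using f(1) by (rule borel_measurable_continuous_onI)
  have "(\<integral>\<^sup>+x. g x \<partial>\<xi>) \<le> ennreal K * (\<integral>\<^sup>+x. g x \<partial>lborel)" if [measurable]: "g \<in> borel_measurable borel" for g
  proof -
    have "(\<integral>\<^sup>+x. g x \<partial>\<xi>) = (\<integral>\<^sup>+x. ennreal (f x) * g x \<partial>lborel)"
      unfolding \<xi> by (rule nn_integral_density) measurable
    also have "\<dots> \<le> (\<integral>\<^sup>+x. ennreal K * g x \<partial>lborel)"
      using f(2) by (intro nn_integral_mono mult_right_mono ennreal_leI) auto
    also have "\<dots> = ennreal K * (\<integral>\<^sup>+x. g x \<partial>lborel)"
      by (rule nn_integral_cmult) measurable
    finally show ?thesis .
  qed
  then show ?thesis
    using assms(1) by (intro bounded_density.intro bounded_density_axioms.intro) (auto simp: \<xi>)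
qed

theorem proposition4p3:
  shows "\<exists>c::real. c > 0 \<and>
    (\<forall>(\<xi> :: real measure) (K :: real) (n :: nat) (A :: real mat) (\<delta> :: real) (K' :: real) (s :: real).
      prob_space \<xi> \<and> sub_gaussian \<xi> \<and> has_continuous_density_bounded_by \<xi> K \<and>
      n \<ge> 2 \<and> A \<in> carrier_mat n n \<and> op_norm A \<le> 1 \<and>
      0 < \<delta> \<and> \<delta> < 1 \<and> K' > 0 \<and> 0 < s \<and> s \<le> 1 \<longrightarrow>
      measure (iid_array n \<xi>)
        {\<omega> \<in> space (iid_array n \<xi>).
          op_norm (G_mat n \<omega>) \<le> K' \<and> eigenvalue_gap (A + \<delta> \<cdot>\<^sub>m G_mat n \<omega>) \<le> s}
      \<le> c * log 2 (2 * (1 + \<delta> * K') / s) * (1 + \<delta> * K')\<^sup>2 * max (K ^ 2) (K ^ 3) *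
          real n ^ 5 * (s / \<delta> ^ 3))"
proof (intro exI[of _ 20000000] conjI allI impI; (elim conjE)?)
  fix \<xi> :: "real measure" and K :: real and n :: nat and A :: "real mat" and \<delta> K' s :: real
  assume \<xi>: "prob_space \<xi>" "has_continuous_density_bounded_by \<xi> K"
    and n: "n \<ge> 2" and A: "A \<in> carrier_mat n n" "op_norm A \<le> 1"
    and \<delta>: "0 < \<delta>" "\<delta> < 1" and K': "K' > 0" and s: "0 < s" "s \<le> 1"
  interpret bounded_density \<xi> K using \<xi> by (rule bounded_densityI)
  let ?E = "{\<omega> \<in> space (iid_array n \<xi>).
      op_norm (G_mat n \<omega>) \<le> K' \<and> eigenvalue_gap (A + \<delta> \<cdot>\<^sub>m G_mat n \<omega>) \<le> s}"
  let ?c = "20000000 * log 2 (2 * (1 + \<delta> * K') / s) * (1 + \<delta> * K')\<^sup>2 * max (K ^ 2) (K ^ 3) * real n ^ 5 * (s / \<delta> ^ 3)"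
  have c: "0 \<le> ?c"
  proof -
    have "0 \<le> \<delta> * K'" using \<delta> K' by simp
    then have "s \<le> 2 * (1 + \<delta> * K')" using s unfolding distrib_left by linarith
    then have "2 * (1 + \<delta> * K') / s \<ge> 1" using s by (simp only: pos_le_divide_eq mult_1_left)
    then have "0 \<le> log 2 (2 * (1 + \<delta> * K') / s)" by (subst zero_le_log_cancel_iff) auto
    then show ?thesis using K_pos \<delta> s by (intro mult_nonneg_nonneg) (auto simp: le_max_iff_disj)
  qed
  show "measure (iid_array n \<xi>) ?E \<le> ?c"
  \<comment> \<open>\<open>measure\<close> takes the value 0 on a set that is not measurable.\<close>
  proof (cases "?E \<in> sets (iid_array n \<xi>)")
    case True
    have "emeasure (iid_array n \<xi>) ?E \<le> ennreal ?c"
      unfolding iid_array_def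
      by (rule order.trans[OF prob_gap_event_le[OF n A \<delta> K' s]
            ennreal_leI[OF gap_constants_le[OF n K_pos \<delta> K' s]]])
        (use True in \<open>auto simp: iid_array_def\<close>)
    then show ?thesis unfolding measure_def by (rule enn2real_leI[OF c])
  next
    case False
    then show ?thesis using c by (simp add: measure_notin_sets)
  qed
qed simp

end
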